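(* Let $m,n\in \mathbb{N}$ with $\gcd(m,n) = 1$ and put $l = \gcd(m-1, n)$. If $n \mid l^2$ and one of the following holds: \[ \begin{array}{llll} (1) & (m-1)/l &\equiv \pm 1 \pmod {n/l}, &\text{ set } k = \pm 1, \text{ or }\\ (2) & (m-1)/l &\equiv \pm 2 \pmod {n/l} \text{ and } l^2/n = 4, &\text{ set } k = \pm 2, \text{ or }\\ (3) & (m-1)/l &\equiv \pm 3 \pmod {n/l} \text{ and } l^2/n = 3, &\text{ set } k = \pm 3, \end{array} \] then \[ P(x,y) = \frac{n}{2} \left(x - \frac{m-1}{n}y\right)\left(x - \frac{m-1}{n}y - \frac{kl}{n}\right) + x + \frac{kl - (m-1)}{n} y + |k| - 1 \] is a quadratic packing polynomial on $I\left(\frac{n}{m}\right)$. Moreover, every quadratic packing polynomial on the lattice points $I(\alpha)$ of a sector $S(\alpha) \subseteq \mathbb{R}^2$ is one of the polynomials $P(x,y)$ given by this construction (for $\alpha = n/m$ and a choice of $k$ satisfying one of the conditions (1)–(3)).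
   Context: For $\alpha > 0$, $S(\alpha) = \{(x,y) \in \mathbb{R}^2 \mid 0 \leq y \leq \alpha x\}$ and $I(\alpha) = S(\alpha) \cap \mathbb{Z}^2$; $S(\infty)$ denotes the first quadrant and $I(\infty)$ its lattice points, which corresponds to the case $n=1$, $m=0$. A function $f:\mathbb{R}^2\to\mathbb{R}$ is a packing function on an enumerable set $I$ if it maps $I$ bijectively onto $\mathbb{N}_0$; a packing polynomial is a polynomial packing function, and a quadratic packing polynomial (QPP) is a packing polynomial of degree $2$. (Quadratic packing polynomials on sectors with irrational $\alpha$ do not exist, by prior work of Gjaldbæk.) *)

theory Defs
  imports "HOL-Analysis.Analysis" "HOL-Number_Theory.Cong"
begin

text \<open>
  The slope of a sector is an extended real. The value \<open>\<infinity>\<close> is treated separately because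
  \<open>\<infinity> * 0 = 0\<close> in \<^typ>\<open>ereal\<close> would lose the positive \<open>y\<close>-axis. Only positive slopes are meaningful.
\<close>

definition sector :: "ereal \<Rightarrow> (real \<times> real) set" where
  "sector \<alpha> =
     (if \<alpha> = \<infinity> then {(x, y). 0 \<le> x \<and> 0 \<le> y}
      else {(x, y). 0 \<le> y \<and> y \<le> real_of_ereal \<alpha> * x})"

definition sector_lattice :: "ereal \<Rightarrow> (real \<times> real) set" where
  "sector_lattice \<alpha> = sector \<alpha> \<inter> (\<int> \<times> \<int>)"

definition bivariate_polynomial_of_degree :: "nat \<Rightarrow> (real \<times> real \<Rightarrow> real) \<Rightarrow> bool" where
  "bivariate_polynomial_of_degree d f \<longleftrightarrow>
     (\<exists>c :: nat \<Rightarrow> nat \<Rightarrow> real.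
        (\<forall>x y. f (x, y) = (\<Sum>(i, j) | i + j \<le> d. c i j * x ^ i * y ^ j)) \<and>
        (\<exists>i j. i + j = d \<and> c i j \<noteq> 0))"

definition packing_function_on :: "(real \<times> real) set \<Rightarrow> (real \<times> real \<Rightarrow> real) \<Rightarrow> bool" where
  "packing_function_on I f \<longleftrightarrow> bij_betw f I \<nat>"

definition quadratic_packing_polynomial_on ::
    "(real \<times> real) set \<Rightarrow> (real \<times> real \<Rightarrow> real) \<Rightarrow> bool" where
  "quadratic_packing_polynomial_on I f \<longleftrightarrow>
     bivariate_polynomial_of_degree 2 f \<and> packing_function_on I f"

text \<open>Since \<open>m = 0\<close> is allowed, \<open>m - 1\<close> must be an integer difference.\<close>

definition packing_gcd :: "nat \<Rightarrow> nat \<Rightarrow> int" where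
  "packing_gcd m n = gcd (int m - 1) (int n)"

definition packing_condition :: "nat \<Rightarrow> nat \<Rightarrow> int \<Rightarrow> bool" where
  "packing_condition m n k \<longleftrightarrow>
     (let l = packing_gcd m n in
        int n dvd l\<^sup>2 \<and>
        [(int m - 1) div l = k] (mod (int n div l)) \<and>
        (k \<in> {1, -1} \<or>
         k \<in> {2, -2} \<and> l\<^sup>2 div int n = 4 \<or>
         k \<in> {3, -3} \<and> l\<^sup>2 div int n = 3))"

definition packing_poly :: "nat \<Rightarrow> nat \<Rightarrow> int \<Rightarrow> real \<times> real \<Rightarrow> real" where
  "packing_poly m n k = (\<lambda>(x, y).
     let l = real_of_int (packing_gcd m n);
         u = x - (real m - 1) / real n * y
     in real n / 2 * u * (u - real_of_int k * l / real n)
        + x + (real_of_int k * l - (real m - 1)) / real n * y + \<bar>real_of_int k\<bar> - 1)"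

text \<open>In \<^typ>\<open>ereal\<close> division by \<open>0\<close> yields \<open>\<infinity>\<close>, so \<open>m = 0\<close> gives the first quadrant.\<close>

definition rational_slope :: "nat \<Rightarrow> nat \<Rightarrow> ereal" where
  "rational_slope n m = ereal (real n) / ereal (real m)"

lemma rational_slope_zero: "n > 0 \<Longrightarrow> rational_slope n 0 = \<infinity>"
  by (simp add: rational_slope_def divide_ereal_def)

lemma rational_slope_pos: "m > 0 \<Longrightarrow> rational_slope n m = ereal (real n / real m)"
  by (simp add: rational_slope_def)

end

theory Submission
  imports Defs
begin

text \<open>
  Put \<open>\<beta> = 1/\<alpha>\<close>, so that the lattice points form the cone \<open>0 \<le> y\<close>, \<open>\<beta> y \<le> x\<close> for every slope including
  \<open>\<infinity>\<close>, and let \<open>f\<close> be a quadratic packing polynomial.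

  If the quadratic form of \<open>f\<close> is not positive on some ray of the closed cone, then \<open>f\<close> grows only linearly
  on infinitely many strips along that ray, with slopes growing linearly in the number of the strip. As the
  harmonic series diverges, too many points have small values.

  If the form is positive but nondegenerate, take a prime \<open>p\<close> not dividing twice the discriminant. Points with
  \<open>f < N\<close> are equidistributed over \<open>(\<int>/p)\<^sup>2\<close> up to \<open>O(\<surd>N)\<close>, whereas their values are equidistributed modulo \<open>p\<close>;
  but the critical value of \<open>f\<close> modulo \<open>p\<close> is not taken exactly \<open>p\<close> times.

  Hence the form is \<open>s t\<^sup>2 / 2\<close> for a primitive linear form \<open>t\<close>, and in unimodular coordinates \<open>(t, z)\<close> the
  polynomial is \<open>\<psi> t + e z\<close> on a cone \<open>\<lambda> t \<le> z \<le> \<mu> t\<close>. The values on the line \<open>t\<close> form an arithmetic progression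
  with step \<open>e\<close>, and the progressions belonging to one residue class modulo \<open>e\<close> have to fit together without gaps.
  This forces \<open>\<mu> = \<lambda> + s\<close>, then the slope \<open>\<lambda>\<close> modulo \<open>1\<close>, and finally \<open>e = 1\<close>, \<open>(e, s) = (2, 4)\<close> or \<open>(e, s) = (3, 3)\<close>;
  read backwards, it shows that these polynomials do pack.
\<close>

section \<open>Packings of a cone\<close>

text \<open>The parameters of the two descriptions are related by \<open>s\<close> = l^2/n,
  \<open>a\<close> = n/l, \<open>b\<close> = -(m-1)/l, where t = \<open>a x + b y\<close>;
  equivalently n = \<open>s a^2\<close> and m - 1 = \<open>- a b s\<close>. The step
  \<open>e\<close> is the number k of the theorem. Its sign depends on the orientation of the cone,
  and a negative step is reduced to a positive one by reflecting z. The equality \<mu> = \<lambda> +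
  s amounts to \<open>s a (b + \<beta> a) = 1\<close>. It shows in passing that \<beta> is rational,
  so irrational slopes drop out of the argument instead of being excluded beforehand. The
  nondegenerate case is refuted by counting alone: no area is evaluated, and a form that is
  indefinite but positive on the cone is treated like a definite one. The step stops at 3 for the
  following reason. Few pairs are left, and F is squeezed to e - 1.\<close>

text \<open>Strip \<open>j\<close> has about \<open>N / (M (j + 1))\<close> points whose value is at
  most \<open>N\<close> plus the offset \<open>K j\<close>, so \<open>J\<close> strips together have
  \<open>N / M\<close> times a harmonic sum. Once that sum exceeds \<open>2 M\<close>, at least
  \<open>2 N\<close> points compete for at most \<open>N + K' + 1\<close> values. The offsets may
  depend on the strip in any way, because \<open>J\<close> is fixed before \<open>N\<close>.\<close>

lemma harmonic_overcrowding:
  fixes f :: "'a \<Rightarrow> int" and p :: "nat \<Rightarrow> nat \<Rightarrow> 'a" and M :: real and K :: "nat \<Rightarrow> real"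
  assumes inj: "inj_on f S" and nonneg: "\<And>v. v \<in> S \<Longrightarrow> 0 \<le> f v"
    and pS: "\<And>j i. p j i \<in> S" and pinj: "\<And>j i j' i'. p j i = p j' i' \<Longrightarrow> j = j' \<and> i = i'"
    and M: "M > 0"
    and bound: "\<And>j i. real_of_int (f (p j i)) \<le> M * real (Suc j) * real i + K j"
  shows False
proof -
  have "\<not> bdd_above (range (\<lambda>J. \<Sum>j<J. 1 / real (Suc j)))"
  proof
    assume "bdd_above (range (\<lambda>J. \<Sum>j<J. 1 / real (Suc j)))"
    then obtain B where B: "\<And>J. (\<Sum>j<J. 1 / real (Suc j)) \<le> B"
      by (auto simp: bdd_above_def)
    have "(\<Sum>j\<le>J. 1 / real (Suc j)) \<le> B" for J
      using B[of "Suc J"] by (simp only: lessThan_Suc_atMost)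
    then have "summable (\<lambda>j. 1 / real (Suc j))"
      by (intro bounded_imp_summable[of _ B]) auto
    then have "summable (\<lambda>j. inverse (real (Suc j)))"
      by (simp add: divide_inverse)
    then show False
      using not_summable_harmonic[where 'a = real] summable_Suc_iff[of "\<lambda>j. inverse (real j)"] by simp
  qed
  then obtain J where J: "(\<Sum>j<J. 1 / real (Suc j)) > 2 * M"
    by (metis (mono_tags, lifting) bdd_above.I2 not_le)
  define K' where "K' = (\<Sum>j<J. \<bar>K j\<bar>)"
  have K': "K j \<le> K'" if "j < J" for j
  proof -
    have "\<bar>K j\<bar> \<le> K'"
      unfolding K'_def by (rule member_le_sum) (use that in auto)
    then show ?thesis by linarith
  qed
  have K'0: "K' \<ge> 0" unfolding K'_def by (simp add: sum_nonneg)
  \<comment> \<open>The summand \<open>2\<close> makes \<open>2 N\<close> exceed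
    \<open>N + K' + 1\<close>, the bound on the number of available values.\<close>
  define N where "N = nat \<lceil>K'\<rceil> + 2"
  have NK: "real N \<ge> K' + 2" "N > 0" unfolding N_def using K'0 by linarith+
  define Idx where "Idx = (SIGMA j:{..<J}. {..nat \<lfloor>real N / (M * real (Suc j))\<rfloor>})"
  have fin: "finite Idx" unfolding Idx_def by auto
  have maps: "(\<lambda>(j, i). f (p j i)) ` Idx \<subseteq> {0..\<lfloor>real N + K'\<rfloor>}"
  proof (intro subsetI, elim imageE, clarify, unfold atLeastAtMost_iff)
    fix j i assume ji: "(j, i) \<in> Idx"
    then have j: "j < J" and i: "i \<le> nat \<lfloor>real N / (M * real (Suc j))\<rfloor>"
      by (auto simp: Idx_def)
    have "real i \<le> real N / (M * real (Suc j))"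
    proof -
      have "real i \<le> of_int \<lfloor>real N / (M * real (Suc j))\<rfloor>"
        using i M by (metis divide_nonneg_nonneg le_nat_iff less_eq_real_def mult_nonneg_nonneg of_int_of_nat_eq of_int_le_iff of_nat_0_le_iff zero_le_floor)
      then show ?thesis by linarith
    qed
    then have "M * real (Suc j) * real i \<le> real N"
      using M by (simp add: pos_le_divide_eq mult.commute mult.left_commute del: of_nat_Suc)
    then have "real_of_int (f (p j i)) \<le> real N + K'"
      using bound[of j i] K'[OF j] by linarith
    then have "f (p j i) \<le> \<lfloor>real N + K'\<rfloor>" by (rule le_floor_iff[THEN iffD2])
    then show "0 \<le> f (p j i) \<and> f (p j i) \<le> \<lfloor>real N + K'\<rfloor>"
      using nonneg[OF pS] by blast
  qed
  have "inj_on (\<lambda>(j, i). f (p j i)) Idx"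
    by (rule inj_onI) (use inj pS pinj in \<open>auto dest!: inj_onD\<close>)
  then have "card Idx \<le> card {0..\<lfloor>real N + K'\<rfloor>}"
    by (rule card_inj_on_le[OF _ maps]) auto
  then have "real (card Idx) \<le> real N + K' + 1"
    using K'0 by simp linarith
  moreover have "2 * real N \<le> real (card Idx)"
  proof -
    have "2 * real N = real N / M * (2 * M)" using M by simp
    also have "\<dots> \<le> real N / M * (\<Sum>j<J. 1 / real (Suc j))"
      by (rule mult_left_mono) (use J M in auto)
    also have "\<dots> = (\<Sum>j<J. real N / M * (1 / real (Suc j)))"
      by (simp add: sum_distrib_left)
    also have "\<dots> \<le> (\<Sum>j<J. real (nat \<lfloor>real N / (M * real (Suc j))\<rfloor>) + 1)"
    proof (rule sum_mono)
      fix j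
      have "real N / M * (1 / real (Suc j)) = real N / (M * real (Suc j))" by simp
      also have "\<dots> \<le> real (nat \<lfloor>real N / (M * real (Suc j))\<rfloor>) + 1"
        by linarith
      finally show "real N / M * (1 / real (Suc j)) \<le> real (nat \<lfloor>real N / (M * real (Suc j))\<rfloor>) + 1" .
    qed
    also have "\<dots> = real (card Idx)"
      unfolding Idx_def by (subst card_SigmaI) (auto simp: add.commute)
    finally show ?thesis .
  qed
  ultimately show False using NK by linarith
qed

section \<open>Quadratic polynomials modulo a prime\<close>

text \<open>Around its critical point \<open>g\<close> is a constant plus the form \<open>Q\<close>,
  so the critical value is taken as often as \<open>Q\<close> vanishes modulo \<open>p\<close>. That
  happens once if \<open>Q\<close> is anisotropic. Otherwise an isotropic vector spans a line of
  \<open>p\<close> zeros, and nondegeneracy gives a further zero off that line. Neither count is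
  \<open>p\<close>.\<close>

lemma quadratic_not_uniform_mod_prime:
  fixes A B C D E F p :: int
  assumes p: "prime p" "p > 2" and disc: "\<not> p dvd B\<^sup>2 - A * C"
  defines "g \<equiv> \<lambda>x y. A * x\<^sup>2 + 2 * B * x * y + C * y\<^sup>2 + D * x + E * y + F"
  shows "\<exists>a. card {(x, y). x \<in> {0..<p} \<and> y \<in> {0..<p} \<and> [g x y = a] (mod p)} \<noteq> nat p"
proof -
  have inverse_ex: "\<exists>w. [d * w = 1] (mod p)" if "\<not> p dvd d" for d
    using that p by (metis cong_solve_coprime_int coprime_commute prime_imp_coprime)
  have "\<not> p dvd 2" using p by (auto dest: zdvd_imp_le)
  have "\<not> p dvd 4 * (A * C - B\<^sup>2)"
  proof -
    have "\<not> p dvd A * C - B\<^sup>2" using disc by (metis dvd_minus_iff minus_diff_eq)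
    moreover have "\<not> p dvd 2 * 2" using \<open>\<not> p dvd 2\<close> p(1) prime_dvd_multD by blast
    ultimately show ?thesis using p(1) prime_dvd_multD[of p 4 "A * C - B\<^sup>2"] by auto
  qed
  then obtain w where w: "[4 * (A * C - B\<^sup>2) * w = 1] (mod p)" using inverse_ex by blast
  then obtain k where k: "4 * (A * C - B\<^sup>2) * w = 1 + p * k"
    by (metis cong_iff_lin cong_sym)
  \<comment> \<open>Cramer's rule: \<open>w\<close> inverts the determinant of the gradient system
    modulo \<open>p\<close>, hence both partial derivatives of \<open>g\<close> vanish modulo
    \<open>p\<close> at \<open>(h1, h2)\<close>.\<close>
  define h1 where "h1 = w * (2 * B * E - 2 * C * D)"
  define h2 where "h2 = w * (2 * B * D - 2 * A * E)"
  have "2 * A * h1 + 2 * B * h2 + D = - D * (4 * (A * C - B\<^sup>2) * w) + D"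
    unfolding h1_def h2_def by (simp add: algebra_simps power2_eq_square)
  then have crit1: "2 * A * h1 + 2 * B * h2 + D = - p * (k * D)" unfolding k by (simp add: algebra_simps)
  have "2 * B * h1 + 2 * C * h2 + E = - E * (4 * (A * C - B\<^sup>2) * w) + E"
    unfolding h1_def h2_def by (simp add: algebra_simps power2_eq_square)
  then have crit2: "2 * B * h1 + 2 * C * h2 + E = - p * (k * E)" unfolding k by (simp add: algebra_simps)
  define Q where "Q = (\<lambda>u v. A * u\<^sup>2 + 2 * B * u * v + C * v\<^sup>2)"
  have g_shift: "[g (h1 + u) (h2 + v) = g h1 h2 + Q u v] (mod p)" for u v
  proof -
    have "g (h1 + u) (h2 + v) = g h1 h2 + Q u v + u * (2 * A * h1 + 2 * B * h2 + D) + v * (2 * B * h1 + 2 * C * h2 + E)"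
      unfolding g_def Q_def by (simp add: algebra_simps power2_eq_square)
    then have "g (h1 + u) (h2 + v) - (g h1 h2 + Q u v) = p * (- u * k * D - v * k * E)"
      unfolding crit1 crit2 by (simp add: algebra_simps)
    then show ?thesis by (simp add: cong_iff_dvd_diff)
  qed
  have g_mod: "[g (x mod p) (y mod p) = g x y] (mod p)" for x y
    unfolding g_def by (intro cong_add cong_mult cong_pow cong_refl cong_mod_left) auto
  define a where "a = g h1 h2"
  define Z where "Z = {(x, y). x \<in> {0..<p} \<and> y \<in> {0..<p} \<and> [g x y = a] (mod p)}"
  define R where "R = (\<lambda>u v. ((h1 + u) mod p, (h2 + v) mod p))"
  have R_in: "R u v \<in> Z" if "p dvd Q u v" for u v
  proof -
    have "[g ((h1 + u) mod p) ((h2 + v) mod p) = a + Q u v] (mod p)"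
      unfolding a_def using g_mod g_shift cong_trans by blast
    moreover have "[a + Q u v = a] (mod p)" using that by (simp add: cong_iff_dvd_diff)
    ultimately show ?thesis unfolding Z_def R_def using p(2) cong_trans by auto
  qed
  have R_eq: "p dvd u - u' \<and> p dvd v - v'" if "R u v = R u' v'" for u v u' v'
    using that unfolding R_def by (auto simp: mod_eq_dvd_iff)
  have finZ: "finite Z"
    by (rule finite_subset[of _ "{0..<p} \<times> {0..<p}"]) (auto simp: Z_def)
  show ?thesis
  proof (rule exI[of _ a], rule notI)
    assume "card {(x, y). x \<in> {0..<p} \<and> y \<in> {0..<p} \<and> [g x y = a] (mod p)} = nat p"
    then have cardZ: "card Z = nat p" unfolding Z_def .
    have "\<not> Z \<subseteq> {R 0 0}"
    proof
      assume "Z \<subseteq> {R 0 0}"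
      then have "card Z \<le> card {R 0 0}" by (intro card_mono) auto
      then show False using cardZ p(2) by simp
    qed
    then obtain x y where xy: "(x, y) \<in> Z" "(x, y) \<noteq> R 0 0" by auto
    define u where "u = x - h1"
    define v where "v = y - h2"
    have Quv: "p dvd Q u v"
    proof -
      have "[g x y = a] (mod p)" using xy unfolding Z_def by auto
      moreover have "[g x y = a + Q u v] (mod p)" using g_shift[of u v] unfolding u_def v_def a_def by simp
      ultimately have "[a + Q u v = a] (mod p)" using cong_sym cong_trans by blast
      then show ?thesis by (simp add: cong_iff_dvd_diff)
    qed
    have uv0: "\<not> (p dvd u \<and> p dvd v)"
    proof
      assume *: "p dvd u \<and> p dvd v"
      have "x mod p = h1 mod p" "y mod p = h2 mod p" using * unfolding u_def v_def by (auto simp: mod_eq_dvd_iff)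
      then show False using xy unfolding Z_def R_def by auto
    qed
    \<comment> \<open>\<open>c1 w1 + c2 w2\<close> is the symmetric bilinear form of
      \<open>Q\<close> at \<open>(u, v)\<close> and \<open>(w1, w2)\<close>; nondegeneracy supplies
      a vector where it does not vanish.\<close>
    define c1 where "c1 = A * u + B * v"
    define c2 where "c2 = B * u + C * v"
    have "\<not> (p dvd c1 \<and> p dvd c2)"
    proof
      assume *: "p dvd c1 \<and> p dvd c2"
      have "p dvd B * c2 - C * c1" "p dvd B * c1 - A * c2" using * by auto
      moreover have "B * c2 - C * c1 = (B\<^sup>2 - A * C) * u" "B * c1 - A * c2 = (B\<^sup>2 - A * C) * v"
        unfolding c1_def c2_def by (simp_all add: algebra_simps power2_eq_square)
      ultimately show False using disc p(1) uv0 by (metis prime_dvd_multD)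
    qed
    then obtain w1 w2 where w12: "\<not> p dvd c1 * w1 + c2 * w2"
      by (metis add.right_neutral add_0 mult.right_neutral mult_zero_right)
    define c where "c = c1 * w1 + c2 * w2"
    have "\<not> p dvd 2 * c" using w12 \<open>\<not> p dvd 2\<close> p(1) prime_dvd_multD unfolding c_def by blast
    then obtain i where i: "[2 * c * i = 1] (mod p)" using inverse_ex by blast
    \<comment> \<open>Adding \<tau> times the isotropic vector to \<open>(w1, w2)\<close> changes
      \<open>Q\<close> by \<open>2 c\<close> times \<tau>, up to multiples of \<open>p\<close>. This
      \<tau> cancels \<open>Q w1 w2\<close>, since \<open>i\<close> inverts
      \<open>2 c\<close>.\<close>
    define \<tau> where "\<tau> = - (Q w1 w2 * i)"
    have "Q (w1 + \<tau> * u) (w2 + \<tau> * v) = Q w1 w2 * (1 - 2 * c * i) + \<tau>\<^sup>2 * Q u v"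
      unfolding c_def c1_def c2_def Q_def \<tau>_def by (simp add: algebra_simps power2_eq_square)
    moreover have "p dvd 1 - 2 * c * i" using i by (metis cong_iff_dvd_diff cong_sym)
    ultimately have extra: "p dvd Q (w1 + \<tau> * u) (w2 + \<tau> * v)" using Quv by simp
    define L where "L = (\<lambda>t. R (t * u) (t * v)) ` {0..<p}"
    have "inj_on (\<lambda>t. R (t * u) (t * v)) {0..<p}"
    proof (rule inj_onI)
      fix t t' assume t: "t \<in> {0..<p}" "t' \<in> {0..<p}" "R (t * u) (t * v) = R (t' * u) (t' * v)"
      then have "p dvd (t - t') * u" "p dvd (t - t') * v" using R_eq by (auto simp: left_diff_distrib)
      then have "p dvd t - t'" using uv0 p(1) prime_dvd_multD by blast
      then have "t mod p = t' mod p" by (simp add: mod_eq_dvd_iff)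
      then show "t = t'" using t by simp
    qed
    then have cardL: "card L = nat p" unfolding L_def by (simp add: card_image)
    have "L \<subseteq> Z"
    proof -
      have "Q (t * u) (t * v) = t\<^sup>2 * Q u v" for t
        unfolding Q_def by (simp add: algebra_simps power2_eq_square)
      then show ?thesis unfolding L_def using R_in Quv by auto
    qed
    have "R (w1 + \<tau> * u) (w2 + \<tau> * v) \<notin> L"
    proof
      assume "R (w1 + \<tau> * u) (w2 + \<tau> * v) \<in> L"
      then obtain t where "R (w1 + \<tau> * u) (w2 + \<tau> * v) = R (t * u) (t * v)" unfolding L_def by auto
      then have "p dvd w1 + \<tau> * u - t * u" "p dvd w2 + \<tau> * v - t * v" using R_eq by blast+
      \<comment> \<open>Paired with \<open>(u, v)\<close>, every point of the line gives
        \<open>0\<close> modulo \<open>p\<close>, but the new zero gives \<open>c\<close>.\<close>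
      then have "p dvd c1 * (w1 + \<tau> * u - t * u) + c2 * (w2 + \<tau> * v - t * v)" by simp
      moreover have "c1 * (w1 + \<tau> * u - t * u) + c2 * (w2 + \<tau> * v - t * v) = c + (\<tau> - t) * Q u v"
        unfolding c_def c1_def c2_def Q_def by (simp add: algebra_simps power2_eq_square)
      ultimately have "p dvd c + (\<tau> - t) * Q u v" by simp
      then have "p dvd c" using Quv by (metis dvd_add_left_iff dvd_mult)
      then show False using w12 unfolding c_def by simp
    qed
    then have "card (insert (R (w1 + \<tau> * u) (w2 + \<tau> * v)) L) = nat p + 1"
      using cardL by (simp add: L_def)
    moreover have "card (insert (R (w1 + \<tau> * u) (w2 + \<tau> * v)) L) \<le> card Z"
      using \<open>L \<subseteq> Z\<close> R_in[OF extra] by (intro card_mono finZ) auto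
    ultimately show False using cardZ by simp
  qed
qed

lemma card_cong_class:
  fixes p a :: int and q :: nat
  assumes "p > 0"
  shows "card {k \<in> {0..<p * int q}. [k = a] (mod p)} = q"
proof -
  have "{k \<in> {0..<p * int q}. [k = a] (mod p)} = (\<lambda>i. a mod p + p * int i) ` {..<q}"
  proof (intro equalityI subsetI)
    fix k assume k: "k \<in> {k \<in> {0..<p * int q}. [k = a] (mod p)}"
    then have "k = a mod p + p * (k div p)" unfolding cong_def by (metis (lifting) mem_Collect_eq mod_mult_div_eq)
    moreover have "0 \<le> k div p"
      using k assms by (auto simp: pos_imp_zdiv_nonneg_iff)
    moreover have "k div p < int q"
    proof -
      have "p * (k div p) \<le> k" using assms by (metis add_increasing2 minus_mod_eq_mult_div
          mult_div_mod_eq order_refl pos_mod_sign)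
      then have "p * (k div p) < p * int q" using k by auto
      then show ?thesis using assms by simp
    qed
    ultimately show "k \<in> (\<lambda>i. a mod p + p * int i) ` {..<q}"
      by (intro image_eqI[of _ _ "nat (k div p)"]) auto
  next
    fix k assume "k \<in> (\<lambda>i. a mod p + p * int i) ` {..<q}"
    then obtain i where i: "i < q" "k = a mod p + p * int i" by auto
    have "p * (int i + 1) \<le> p * int q" using i assms by (intro mult_left_mono) auto
    moreover have "0 \<le> a mod p" "a mod p < p" using assms by auto
    moreover have "0 \<le> p * int i" using assms by simp
    ultimately show "k \<in> {k \<in> {0..<p * int q}. [k = a] (mod p)}"
      using i by (simp add: cong_def algebra_simps)
  qed
  moreover have "inj_on (\<lambda>i. a mod p + p * int i) {..<q}"
    using assms by (auto intro: inj_onI)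
  ultimately show ?thesis by (simp add: card_image)
qed

lemma bij_betw_restrict:
  "bij_betw h X Y \<Longrightarrow> bij_betw h {x \<in> X. P (h x)} {y \<in> Y. P y}"
  by (auto simp: bij_betw_def inj_on_def)

section \<open>Positivity of the quadratic form on the closed cone\<close>

definition lattice_cone :: "real \<Rightarrow> (int \<times> int) set" where
  "lattice_cone \<beta> = {(x, y). 0 \<le> y \<and> \<beta> * of_int y \<le> of_int x}"

text \<open>Doubling \<open>f\<close> makes all coefficients of an integer-valued quadratic polynomial integers.\<close>

locale cone_packing =
  fixes \<beta> :: real and A B C D E F :: int and f :: "int \<Rightarrow> int \<Rightarrow> int"
  assumes beta_nonneg: "0 \<le> \<beta>"
    and f_eq: "\<And>x y. 2 * f x y = A * x\<^sup>2 + 2 * B * x * y + C * y\<^sup>2 + D * x + E * y + F"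
    and bij: "bij_betw (\<lambda>(x, y). f x y) (lattice_cone \<beta>) {0..}"
begin

lemma f_inj: "inj_on (\<lambda>(x, y). f x y) (lattice_cone \<beta>)"
  using bij by (rule bij_betw_imp_inj_on)

lemma f_nonneg: "(x, y) \<in> lattice_cone \<beta> \<Longrightarrow> 0 \<le> f x y"
  using bij_betwE[OF bij] by fastforce

lemma f_surj: "0 \<le> v \<Longrightarrow> \<exists>(x, y) \<in> lattice_cone \<beta>. f x y = v"
  using bij_betw_imp_surj_on[OF bij] by (force simp: image_iff)

lemma f_eq_real: "2 * real_of_int (f x y) = of_int A * (of_int x)\<^sup>2 + 2 * of_int B * of_int x * of_int y
     + of_int C * (of_int y)\<^sup>2 + of_int D * of_int x + of_int E * of_int y + of_int F"
  using arg_cong[OF f_eq, of real_of_int x y] by simp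

text \<open>Strip \<open>j\<close> follows the ray through \<open>(\<gamma>, 1)\<close> at
  horizontal distance between \<open>j\<close> and \<open>j + 1\<close>. If the form is not positive
  there, the square of the height \<open>i\<close> has a nonpositive coefficient, and what remains
  is linear in \<open>i\<close> with slope proportional to \<open>j + 1\<close>. As \<gamma> is any
  real number, the ray itself may miss the lattice; rounding up selects points to its right, which
  stay inside the cone.\<close>

lemma form_pos_on_ray:
  assumes "\<beta> \<le> \<gamma>"
  shows "of_int A * \<gamma>\<^sup>2 + 2 * of_int B * \<gamma> + of_int C > 0" (is "?q > 0")
proof (rule ccontr)
  assume q: "\<not> ?q > 0"
  define M where "M = 2 * \<bar>of_int A * \<gamma> + of_int B\<bar> + \<bar>of_int D * \<gamma> + of_int E\<bar> + 1"
  define K where "K j = \<bar>real_of_int A\<bar> * (real (Suc j))\<^sup>2 + \<bar>of_int D\<bar> * real (Suc j) + \<bar>of_int F\<bar>" for j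
  define p where "p j i = (\<lceil>\<gamma> * real i\<rceil> + int j, int i)" for j i
  show False
  proof (rule harmonic_overcrowding[OF f_inj, of p M K])
    show "p j i \<in> lattice_cone \<beta>" for j i
    proof -
      have "\<beta> * real i \<le> \<gamma> * real i" using assms by (simp add: mult_right_mono)
      then show ?thesis unfolding p_def lattice_cone_def by simp linarith
    qed
    show "M > 0" unfolding M_def by (simp add: add_nonneg_pos)
    show "real_of_int (case p j i of (x, y) \<Rightarrow> f x y) \<le> M * real (Suc j) * real i + K j" for j i
    proof -
      define \<epsilon> where "\<epsilon> = real_of_int (\<lceil>\<gamma> * real i\<rceil> + int j) - \<gamma> * real i"
      have e: "0 \<le> \<epsilon>" "\<epsilon> \<le> real (Suc j)" unfolding \<epsilon>_def by simp_all linarith+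
      have x: "real_of_int (\<lceil>\<gamma> * real i\<rceil> + int j) = \<gamma> * real i + \<epsilon>" unfolding \<epsilon>_def by simp
      have "2 * real_of_int (f (\<lceil>\<gamma> * real i\<rceil> + int j) (int i)) =
         ?q * (real i)\<^sup>2 + 2 * (of_int A * \<gamma> + of_int B) * \<epsilon> * real i + (of_int D * \<gamma> + of_int E) * real i
          + of_int A * \<epsilon>\<^sup>2 + of_int D * \<epsilon> + of_int F"
        unfolding f_eq_real x by (simp add: algebra_simps power2_eq_square)
      moreover have "?q * (real i)\<^sup>2 \<le> 0" using q by (simp add: mult_nonpos_nonneg)
      moreover have "2 * (of_int A * \<gamma> + of_int B) * \<epsilon> * real i \<le>
          2 * \<bar>of_int A * \<gamma> + of_int B\<bar> * real (Suc j) * real i"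
        using e by (intro mult_right_mono[OF mult_mono] mult_left_mono) auto
      moreover have "(of_int D * \<gamma> + of_int E) * real i \<le> \<bar>of_int D * \<gamma> + of_int E\<bar> * (real (Suc j) * real i)"
        by (intro mult_mono) (auto simp: algebra_simps)
      moreover have "of_int A * \<epsilon>\<^sup>2 \<le> \<bar>real_of_int A\<bar> * (real (Suc j))\<^sup>2"
        using e by (intro mult_mono power_mono) auto
      moreover have "of_int D * \<epsilon> \<le> \<bar>real_of_int D\<bar> * real (Suc j)"
        using e by (intro mult_mono) auto
      moreover have "M * real (Suc j) * real i = 2 * \<bar>of_int A * \<gamma> + of_int B\<bar> * real (Suc j) * real i
          + \<bar>of_int D * \<gamma> + of_int E\<bar> * (real (Suc j) * real i) + real (Suc j) * real i"
        unfolding M_def by (simp add: algebra_simps)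
      moreover have "real (Suc j) * real i \<ge> 0" by simp
      moreover have "real_of_int F \<le> \<bar>of_int F\<bar>" by simp
      \<comment> \<open>The estimates bound twice the value of \<open>f\<close>. Since the bound is
        nonnegative, it may be doubled before the factor is cancelled.\<close>
      moreover have "M * real (Suc j) * real i + K j \<ge> 0"
        unfolding M_def K_def by (intro add_nonneg_nonneg mult_nonneg_nonneg) auto
      moreover have "a = p + q + r + s + s1 + s2 \<Longrightarrow> p \<le> 0 \<Longrightarrow> q \<le> q' \<Longrightarrow> r \<le> r' \<Longrightarrow> s \<le> s' \<Longrightarrow> s1 \<le> s1' \<Longrightarrow>
          m = q' + r' + u \<Longrightarrow> 0 \<le> u \<Longrightarrow> s2 \<le> s2' \<Longrightarrow> 0 \<le> m + (s' + s1' + s2') \<Longrightarrow> a \<le> 2 * (m + (s' + s1' + s2'))"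
        for a p q r s s1 s2 q' r' s' s1' s2' m u :: real
        by argo
      ultimately have "2 * real_of_int (f (\<lceil>\<gamma> * real i\<rceil> + int j) (int i)) \<le> 
         2 * (M * real (Suc j) * real i + K j)"
        unfolding K_def by blast
      then show ?thesis unfolding p_def by simp
    qed
  qed (auto simp: p_def dest: f_nonneg)
qed

text \<open>The edge through \<open>(1, 0)\<close> is only a limit of the rays through
  \<open>(\<gamma>, 1)\<close>. Here the strips are the rows \<open>y = j\<close>: without a
  positive square term, the growth in \<open>i\<close> comes from the mixed term, whose slope is
  proportional to \<open>j\<close>, and from the linear term.\<close>

lemma A_pos: "A > 0"
proof (rule ccontr)
  assume A: "\<not> A > 0"
  define X where "X j = \<lceil>\<beta> * real j\<rceil>" for j :: nat
  define M where "M = 2 * \<bar>real_of_int B\<bar> + \<bar>of_int D\<bar> + 1"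
  define \<kappa> where "\<kappa> j = 2 * real_of_int B * of_int (X j) * real j + of_int C * (real j)\<^sup>2
     + of_int D * of_int (X j) + of_int E * real j + of_int F" for j
  define K where "K j = \<bar>\<kappa> j\<bar>" for j
  define p where "p j i = (X j + int i, int j)" for j i
  show False
  proof (rule harmonic_overcrowding[OF f_inj, of p M K])
    show "p j i \<in> lattice_cone \<beta>" for j i
      unfolding p_def lattice_cone_def X_def by simp linarith
    show "M > 0" unfolding M_def by linarith
    show "real_of_int (case p j i of (x, y) \<Rightarrow> f x y) \<le> M * real (Suc j) * real i + K j" for j i
    proof -
      have "2 * real_of_int (f (X j + int i) (int j)) =
         of_int A * (of_int (X j) + real i)\<^sup>2 + 2 * of_int B * (real j * real i) + of_int D * real i
          + \<kappa> j"
        unfolding f_eq_real \<kappa>_def by (simp add: algebra_simps power2_eq_square)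
      moreover have "of_int A * (of_int (X j) + real i)\<^sup>2 \<le> 0"
        using A by (simp add: mult_nonpos_nonneg)
      moreover have "2 * of_int B * (real j * real i) \<le> 2 * \<bar>real_of_int B\<bar> * (real (Suc j) * real i)"
        by (rule mult_mono) (auto intro: mult_right_mono)
      moreover have "of_int D * real i \<le> \<bar>real_of_int D\<bar> * (real (Suc j) * real i)"
        by (intro mult_mono) (auto simp: algebra_simps)
      moreover have "M * real (Suc j) * real i = 2 * \<bar>real_of_int B\<bar> * (real (Suc j) * real i)
          + \<bar>of_int D\<bar> * (real (Suc j) * real i) + real (Suc j) * real i"
        unfolding M_def by (simp add: algebra_simps)
      moreover have "real (Suc j) * real i \<ge> 0" by simp
      moreover have "M * real (Suc j) * real i + K j \<ge> 0"
        unfolding M_def K_def by (intro add_nonneg_nonneg mult_nonneg_nonneg) auto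
      moreover have "\<kappa> j \<le> K j" unfolding K_def by auto
      moreover have "a = p + q + r + s \<Longrightarrow> p \<le> 0 \<Longrightarrow> q \<le> q' \<Longrightarrow> r \<le> r' \<Longrightarrow> m = q' + r' + u \<Longrightarrow>
          0 \<le> u \<Longrightarrow> 0 \<le> m + k \<Longrightarrow> s \<le> k \<Longrightarrow> a \<le> 2 * (m + k)" for a p q r s q' r' m u k :: real
        by argo
      ultimately have "2 * real_of_int (f (X j + int i) (int j)) \<le> 2 * (M * real (Suc j) * real i + K j)"
        by blast
      then show ?thesis unfolding p_def by simp
    qed
  qed (auto simp: p_def dest: f_nonneg)
qed

lemma cone_nonneg:
  assumes "(x, y) \<in> lattice_cone \<beta>"
  shows "0 \<le> x" "0 \<le> y"
proof -
  show "0 \<le> y" using assms by (simp add: lattice_cone_def)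
  then have "0 \<le> \<beta> * of_int y" using beta_nonneg by simp
  then have "0 \<le> real_of_int x" using assms by (simp add: lattice_cone_def)
  then show "0 \<le> x" by simp
qed

section \<open>Sublevel sets and the vanishing of the discriminant\<close>

text \<open>The segment \<open>x + y = 1\<close> of the real cone is compact and is parametrised by
  \<open>t = y / (x + y)\<close> in \<open>{0..1 / (1 + \<beta>)}\<close>. The form is positive on
  it, by \<open>A_pos\<close> at \<open>t = 0\<close> and by \<open>form_pos_on_ray\<close>
  elsewhere. Its minimum is therefore positive, and homogeneity gives the rest.\<close>

lemma form_coercive:
  obtains \<delta> :: real where "\<delta> > 0"
    "\<And>x y. (x, y) \<in> lattice_cone \<beta> \<Longrightarrow> \<delta> * (of_int (x + y))\<^sup>2 \<le>
        of_int A * (of_int x)\<^sup>2 + 2 * of_int B * of_int x * of_int y + of_int C * (of_int y)\<^sup>2"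
proof -
  define h where "h = (\<lambda>t::real. of_int A * (1 - t)\<^sup>2 + 2 * of_int B * (1 - t) * t + of_int C * t\<^sup>2)"
  define I where "I = {0..1 / (1 + \<beta>)}"
  have "continuous_on I h" unfolding h_def by (intro continuous_intros)
  moreover have "compact I" "I \<noteq> {}" unfolding I_def using beta_nonneg by auto
  ultimately obtain t0 where t0: "t0 \<in> I" "\<And>t. t \<in> I \<Longrightarrow> h t0 \<le> h t"
    using continuous_attains_inf by metis
  have "h t0 > 0"
  proof (cases "t0 = 0")
    case True
    then show ?thesis unfolding h_def using A_pos by simp
  next
    case False
    then have t: "0 < t0" "t0 \<le> 1 / (1 + \<beta>)" using t0 unfolding I_def by auto
    then have "t0 * (1 + \<beta>) \<le> 1" using beta_nonneg by (simp add: field_simps)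
    then have "\<beta> \<le> (1 - t0) / t0" using t by (simp add: field_simps)
    from form_pos_on_ray[OF this]
    have "0 < t0\<^sup>2 * (of_int A * ((1 - t0) / t0)\<^sup>2 + 2 * of_int B * ((1 - t0) / t0) + of_int C)"
      using t by simp
    also have "\<dots> = h t0" unfolding h_def using t by (simp add: field_simps power2_eq_square)
    finally show ?thesis .
  qed
  moreover have "h t0 * (of_int (x + y))\<^sup>2 \<le>
        of_int A * (of_int x)\<^sup>2 + 2 * of_int B * of_int x * of_int y + of_int C * (of_int y)\<^sup>2"
    if xy: "(x, y) \<in> lattice_cone \<beta>" for x y
  proof (cases "x + y = 0")
    case True
    then have "x = 0 \<and> y = 0" using cone_nonneg[OF xy] by linarith
    then show ?thesis by simp
  next
    case False
    then have pos: "real_of_int x + real_of_int y > 0" using cone_nonneg[OF xy] by linarith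
    define t where "t = real_of_int y / (real_of_int x + real_of_int y)"
    have "t \<in> I"
    proof -
      have "\<beta> * of_int y \<le> of_int x" using xy by (simp add: lattice_cone_def)
      then have "of_int y * (1 + \<beta>) \<le> real_of_int x + real_of_int y" by (simp add: algebra_simps)
      then show ?thesis unfolding I_def t_def using pos cone_nonneg[OF xy] beta_nonneg by (simp add: field_simps)
    qed
    then have "h t0 * (of_int (x + y))\<^sup>2 \<le> h t * (of_int (x + y))\<^sup>2"
      by (intro mult_right_mono t0) auto
    also have "\<dots> = of_int A * ((1 - t) * (of_int x + of_int y))\<^sup>2 
         + 2 * of_int B * ((1 - t) * (of_int x + of_int y)) * (t * (of_int x + of_int y))
         + of_int C * (t * (of_int x + of_int y))\<^sup>2"
      unfolding h_def by (simp add: algebra_simps power2_eq_square)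
    also have "(1 - t) * (of_int x + of_int y) = of_int x" unfolding t_def using pos by (simp add: field_simps)
    also have "t * (of_int x + of_int y) = of_int y" unfolding t_def using pos by (simp add: field_simps)
    finally show ?thesis .
  qed
  ultimately show ?thesis using that by blast
qed

text \<open>Taking the levels to be squares lets the size of the sublevel set be measured by
  \<open>S\<close> without square roots.\<close>

lemma sublevel_bounded:
  obtains c :: real where "c > 0"
    "\<And>x y S. (x, y) \<in> lattice_cone \<beta> \<Longrightarrow> S \<ge> 1 \<Longrightarrow> f x y \<le> (int S)\<^sup>2 \<Longrightarrow> of_int (x + y) \<le> c * real S"
proof -
  obtain \<delta> :: real where d: "\<delta> > 0" and low: "\<And>x y. (x, y) \<in> lattice_cone \<beta> \<Longrightarrow> \<delta> * (of_int (x + y))\<^sup>2 \<le>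
        of_int A * (of_int x)\<^sup>2 + 2 * of_int B * of_int x * of_int y + of_int C * (of_int y)\<^sup>2"
    by (rule form_coercive) blast
  define G where "G = \<bar>real_of_int D\<bar> + \<bar>of_int E\<bar>"
  define H where "H = \<bar>real_of_int F\<bar>"
  have GH: "G \<ge> 0" "H \<ge> 0" unfolding G_def H_def by auto
  \<comment> \<open>For \<open>r = x + y\<close> beyond \<open>c S\<close> the form is at least
    \<open>(G + H + 2) S r\<close>: \<open>G\<close> pays for the linear terms, \<open>H\<close> for
    the constant, and the remaining \<open>2 S r\<close> exceeds \<open>2 S^2\<close>.\<close>
  define c where "c = 1 + (G + H + 2) / \<delta>"
  have c1: "c \<ge> 1" unfolding c_def using d GH by simp
  have dc: "\<delta> * c \<ge> G + H + 2" unfolding c_def using d by (simp add: field_simps)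
  have "of_int (x + y) \<le> c * real S" if xy: "(x, y) \<in> lattice_cone \<beta>" and S: "S \<ge> 1" and le: "f x y \<le> (int S)\<^sup>2" for x y S
  proof (rule ccontr)
    define r where "r = real_of_int (x + y)"
    assume "\<not> ?thesis"
    then have r: "r > c * real S" unfolding r_def by simp
    have "c * real S \<ge> 1 * real S" using c1 by (intro mult_right_mono) auto
    then have rS: "r > real S" using r by simp
    have S1: "real S \<ge> 1" using S by simp
    have "\<bar>of_int D * real_of_int x\<bar> \<le> \<bar>of_int D\<bar> * r" "\<bar>of_int E * real_of_int y\<bar> \<le> \<bar>of_int E\<bar> * r"
      unfolding r_def abs_mult using cone_nonneg[OF xy] by (auto intro!: mult_left_mono)
    moreover have "G * r = \<bar>of_int D\<bar> * r + \<bar>of_int E\<bar> * r" unfolding G_def by (simp add: algebra_simps)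
    ultimately have "2 * real_of_int (f x y) \<ge> \<delta> * r\<^sup>2 - G * r - H"
      using f_eq_real[of x y] low[OF xy] unfolding r_def H_def by linarith
    moreover have "\<delta> * r\<^sup>2 \<ge> (G + H + 2) * (real S * r)"
    proof -
      have "(G + H + 2) * (real S * r) \<le> \<delta> * c * (real S * r)"
        using dc rS S1 by (intro mult_right_mono) auto
      also have "\<dots> = \<delta> * ((c * real S) * r)" by simp
      also have "\<dots> \<le> \<delta> * (r * r)" using d r rS S1 by (intro mult_left_mono mult_right_mono) auto
      finally show ?thesis by (simp add: power2_eq_square)
    qed
    moreover have "(G + H + 2) * (real S * r) = G * (real S * r) + H * (real S * r) + 2 * (real S * r)"
      by (simp add: algebra_simps)
    moreover have "G * (real S * r) \<ge> G * r" using GH S1 rS by (intro mult_left_mono) auto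
    moreover have "H * (real S * r) \<ge> H * 1" using GH S1 rS by (intro mult_left_mono) (auto intro: order_trans[OF _ mult_mono[of 1 "real S" 1 r]])
    moreover have "real S * r > real S * real S" using rS S1 by simp
    ultimately have "2 * real_of_int (f x y) > 2 * (real S * real S)" by simp
    then have "real_of_int (f x y) > real_of_int ((int S)\<^sup>2)" by (simp add: power2_eq_square)
    then show False using le by linarith
  qed
  then show ?thesis using that[of c] c1 by force
qed

text \<open>Under a bounded shift the quadratic terms cancel and the increment is linear in the
  point. The constant is crude; it only has to be independent of the point.\<close>

lemma shift_growth:
  fixes p x y d1 d2 :: int
  assumes "0 \<le> x" "0 \<le> y" "0 \<le> d1" "d1 < p" "0 \<le> d2" "d2 < p"
  shows "f (x + d1) (y + d2) - f x y \<le> (\<bar>A\<bar> + \<bar>B\<bar> + \<bar>C\<bar> + \<bar>D\<bar> + \<bar>E\<bar>) * p\<^sup>2 * (x + y + 1)"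
proof -
  have p: "p \<ge> 1" using assms by linarith
  then have pp: "p \<le> p\<^sup>2" by (simp add: power2_eq_square)
  have "2 * (f (x + d1) (y + d2) - f x y) = A * (2 * x * d1 + d1\<^sup>2)
     + B * (2 * x * d2 + 2 * y * d1 + 2 * d1 * d2) + C * (2 * y * d2 + d2\<^sup>2) + D * d1 + E * d2"
    using f_eq[of "x + d1" "y + d2"] f_eq[of x y] by (simp add: algebra_simps power2_eq_square)
  moreover have bd: "a * t \<le> \<bar>a\<bar> * (2 * p\<^sup>2 * (x + y + 1))" if "0 \<le> t" "t \<le> 2 * p\<^sup>2 * (x + y + 1)" for a t :: int
    using that by (intro mult_mono) auto
  have xd: "x * d1 \<le> p\<^sup>2 * x" "x * d2 \<le> p\<^sup>2 * x" "y * d1 \<le> p\<^sup>2 * y" "y * d2 \<le> p\<^sup>2 * y"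
    using assms pp by (auto simp: mult.commute[of x] mult.commute[of y] intro!: mult_right_mono)
  have dd: "d1\<^sup>2 \<le> p\<^sup>2" "d2\<^sup>2 \<le> p\<^sup>2" "d1 * d2 \<le> p\<^sup>2"
    using assms by (auto intro!: power_mono mult_mono simp: power2_eq_square)
  have nn: "0 \<le> x * d1" "0 \<le> x * d2" "0 \<le> y * d1" "0 \<le> y * d2" "0 \<le> d1 * d2" "0 \<le> p\<^sup>2 * x" "0 \<le> p\<^sup>2 * y" "0 \<le> d1\<^sup>2" "0 \<le> d2\<^sup>2"
    using assms by auto
  have e: "2 * p\<^sup>2 * (x + y + 1) = 2 * (p\<^sup>2 * x) + 2 * (p\<^sup>2 * y) + 2 * p\<^sup>2" by (simp add: algebra_simps)
  have "A * (2 * x * d1 + d1\<^sup>2) \<le> \<bar>A\<bar> * (2 * p\<^sup>2 * (x + y + 1))"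
    by (rule bd) (use xd dd nn e in linarith)+
  moreover have "B * (2 * x * d2 + 2 * y * d1 + 2 * d1 * d2) \<le> \<bar>B\<bar> * (2 * p\<^sup>2 * (x + y + 1))"
    by (rule bd) (use xd dd nn e in linarith)+
  moreover have "C * (2 * y * d2 + d2\<^sup>2) \<le> \<bar>C\<bar> * (2 * p\<^sup>2 * (x + y + 1))"
    by (rule bd) (use xd dd nn e in linarith)+
  moreover have "D * d1 \<le> \<bar>D\<bar> * (2 * p\<^sup>2 * (x + y + 1))"
    by (rule bd) (use xd dd nn e pp assms in linarith)+
  moreover have "E * d2 \<le> \<bar>E\<bar> * (2 * p\<^sup>2 * (x + y + 1))"
    by (rule bd) (use xd dd nn e pp assms in linarith)+
  ultimately have "2 * (f (x + d1) (y + d2) - f x y) \<le> 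
     (\<bar>A\<bar> + \<bar>B\<bar> + \<bar>C\<bar> + \<bar>D\<bar> + \<bar>E\<bar>) * (2 * p\<^sup>2 * (x + y + 1))"
    by (simp add: distrib_right)
  then show ?thesis by (simp add: algebra_simps)
qed

definition sublevel :: "int \<Rightarrow> (int \<times> int) set" where
  "sublevel N = {(x, y) \<in> lattice_cone \<beta>. f x y < N}"

lemma sublevel_bij: "bij_betw (\<lambda>(x, y). f x y) (sublevel N) {0..<N}"
  using bij unfolding bij_betw_def
proof (intro conjI; elim conjE)
  assume inj: "inj_on (\<lambda>(x, y). f x y) (lattice_cone \<beta>)"
    and im: "(\<lambda>(x, y). f x y) ` lattice_cone \<beta> = {0..}"
  show "inj_on (\<lambda>(x, y). f x y) (sublevel N)"
    by (rule inj_on_subset[OF inj]) (auto simp: sublevel_def)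
  show "(\<lambda>(x, y). f x y) ` sublevel N = {0..<N}"
    using f_nonneg f_surj by (fastforce simp: sublevel_def image_iff)
qed

lemma finite_sublevel: "finite (sublevel N)"
  using bij_betw_finite[OF sublevel_bij] by simp

lemma card_sublevel: "card (sublevel N) = nat N"
  using bij_betw_same_card[OF sublevel_bij] by simp

text \<open>The sublevel set has \<open>S^2\<close> points, and a translation by a residue vector
  loses only \<open>O(S)\<close> of them. Since such translations carry any residue class modulo
  \<open>p\<close> into any other, all classes are almost equally populated.\<close>

lemma shift_defect:
  fixes p :: int
  assumes "p > 0"
  obtains c :: real where "c > 0"
    "\<And>S d1 d2. S \<ge> 1 \<Longrightarrow> 0 \<le> d1 \<Longrightarrow> d1 < p \<Longrightarrow> 0 \<le> d2 \<Longrightarrow> d2 < p \<Longrightarrow>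
      real (card {(x, y) \<in> sublevel ((int S)\<^sup>2). (x + d1, y + d2) \<notin> sublevel ((int S)\<^sup>2)}) \<le> c * real S"
proof -
  obtain c0 :: real where c0: "c0 > 0" and bdd: "\<And>x y S. (x, y) \<in> lattice_cone \<beta> \<Longrightarrow> S \<ge> 1 \<Longrightarrow> f x y \<le> (int S)\<^sup>2 \<Longrightarrow>
       of_int (x + y) \<le> c0 * real S"
    by (rule sublevel_bounded) blast
  define G where "G = (\<bar>A\<bar> + \<bar>B\<bar> + \<bar>C\<bar> + \<bar>D\<bar> + \<bar>E\<bar>) * p\<^sup>2"
  have G: "G \<ge> 0" unfolding G_def by simp
  define W where "W = \<lceil>\<beta> * of_int p\<rceil>"
  have "0 \<le> \<beta> * of_int p" using beta_nonneg assms by simp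
  then have W: "W \<ge> 0" unfolding W_def by linarith
  define c where "c = (c0 + 1) * (of_int W + 1) + of_int G * (c0 + 2)"
  have "real (card {(x, y) \<in> sublevel ((int S)\<^sup>2). (x + d1, y + d2) \<notin> sublevel ((int S)\<^sup>2)}) \<le> c * real S"
    if S: "S \<ge> 1" and d: "0 \<le> d1" "d1 < p" "0 \<le> d2" "d2 < p" for S d1 d2
  proof -
    define T where "T = \<lfloor>c0 * real S\<rfloor>"
    have T0: "T \<ge> 0" unfolding T_def using c0 by simp
    have S1: "real S \<ge> 1" using S by simp
    (* A shifted point is lost at the edge of the cone or because its value was within O(S) of the bound;
       injectivity of f limits the number of points of the second kind. *)
    define Edge where "Edge = (\<lambda>(y, i). (\<lceil>\<beta> * of_int y\<rceil> + i, y)) ` ({0..T} \<times> {0..W})"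
    define Near where "Near = {(x, y) \<in> sublevel ((int S)\<^sup>2). (int S)\<^sup>2 - G * (T + 1) \<le> f x y}"
    have "{(x, y) \<in> sublevel ((int S)\<^sup>2). (x + d1, y + d2) \<notin> sublevel ((int S)\<^sup>2)} \<subseteq> Edge \<union> Near"
    proof clarify
      fix x y assume V: "(x, y) \<in> sublevel ((int S)\<^sup>2)" and out: "(x + d1, y + d2) \<notin> sublevel ((int S)\<^sup>2)"
        and notN: "(x, y) \<notin> Near"
      have K: "(x, y) \<in> lattice_cone \<beta>" and fN: "f x y < (int S)\<^sup>2" using V by (auto simp: sublevel_def)
      note xy = cone_nonneg[OF K]
      have "of_int (x + y) \<le> c0 * real S" using bdd[OF K S] fN by simp
      then have T: "x + y \<le> T" unfolding T_def by (simp add: le_floor_iff)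
      have "f (x + d1) (y + d2) - f x y \<le> G * (x + y + 1)" unfolding G_def using shift_growth xy d by blast
      also have "\<dots> \<le> G * (T + 1)" using T G by (intro mult_left_mono) auto
      finally have "f (x + d1) (y + d2) < (int S)\<^sup>2" using notN V unfolding Near_def by auto
      then have "(x + d1, y + d2) \<notin> lattice_cone \<beta>" using out by (auto simp: sublevel_def)
      then have "of_int (x + d1) < \<beta> * of_int (y + d2)" using xy d by (auto simp: lattice_cone_def)
      moreover have "\<beta> * of_int d2 \<le> \<beta> * of_int p" using beta_nonneg d by (intro mult_left_mono) auto
      moreover have "\<beta> * of_int (y + d2) = \<beta> * of_int y + \<beta> * of_int d2" by (simp add: algebra_simps)
      ultimately have "real_of_int x < \<beta> * of_int y + \<beta> * of_int p" using d by simp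
      then have "x \<le> \<lceil>\<beta> * of_int y\<rceil> + W" unfolding W_def by linarith
      moreover have "\<lceil>\<beta> * of_int y\<rceil> \<le> x" using K by (simp add: lattice_cone_def ceiling_le_iff)
      ultimately show "(x, y) \<in> Edge" unfolding Edge_def
        using xy T by (intro image_eqI[of _ _ "(y, x - \<lceil>\<beta> * of_int y\<rceil>)"]) auto
    qed
    moreover have "finite Edge" unfolding Edge_def by auto
    moreover have "finite Near" unfolding Near_def by (rule finite_subset[OF _ finite_sublevel]) auto
    ultimately have "card {(x, y) \<in> sublevel ((int S)\<^sup>2). (x + d1, y + d2) \<notin> sublevel ((int S)\<^sup>2)} \<le> card Edge + card Near"
      by (meson card_Un_le card_mono finite_UnI order_trans)
    moreover have "real (card Edge) \<le> (c0 + 1) * (of_int W + 1) * real S"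
    proof -
      have "card Edge \<le> card ({0..T} \<times> {0..W})" unfolding Edge_def by (rule card_image_le) auto
      also have "\<dots> = nat (T + 1) * nat (W + 1)" by (simp add: card_cartesian_product)
      finally have "real (card Edge) \<le> real (nat (T + 1) * nat (W + 1))" by (simp only: of_nat_le_iff)
      also have "\<dots> = (of_int T + 1) * (of_int W + 1)" using T0 W by simp
      also have "\<dots> \<le> ((c0 + 1) * real S) * (of_int W + 1)"
      proof (rule mult_right_mono)
        have "of_int T \<le> c0 * real S" unfolding T_def by linarith
        then show "of_int T + 1 \<le> (c0 + 1) * real S" using S1 by (simp add: algebra_simps)
      qed (use W in simp)
      finally show ?thesis by (simp add: algebra_simps)
    qed
    moreover have "real (card Near) \<le> of_int G * (c0 + 2) * real S"
    proof -
      have "card Near \<le> card {(int S)\<^sup>2 - G * (T + 1)..<(int S)\<^sup>2}"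
      proof (rule card_inj_on_le[of "\<lambda>(x, y). f x y"])
        show "inj_on (\<lambda>(x, y). f x y) Near"
          by (rule inj_on_subset[OF f_inj]) (auto simp: Near_def sublevel_def)
      qed (auto simp: Near_def sublevel_def)
      also have "\<dots> = nat (G * (T + 1))" by simp
      finally have "real (card Near) \<le> real (nat (G * (T + 1)))" by (simp only: of_nat_le_iff)
      also have "\<dots> = of_int G * (of_int T + 1)" using T0 G by simp
      also have "\<dots> \<le> of_int G * ((c0 + 2) * real S)"
      proof (rule mult_left_mono)
        have "of_int T \<le> c0 * real S" unfolding T_def by linarith
        then show "of_int T + 1 \<le> (c0 + 2) * real S" using S1 by (simp add: algebra_simps)
      qed (use G in simp)
      finally show ?thesis by (simp add: algebra_simps)
    qed
    ultimately show ?thesis unfolding c_def distrib_right by linarith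
  qed
  moreover have "c > 0"
  proof -
    have "(c0 + 1) * (of_int W + 1) > 0" using c0 W by (intro mult_pos_pos) auto
    moreover have "of_int G * (c0 + 2) \<ge> 0" using c0 G by (intro mult_nonneg_nonneg) auto
    ultimately show ?thesis unfolding c_def by linarith
  qed
  ultimately show ?thesis using that by blast
qed

text \<open>Every one of the \<open>p^2\<close> residue classes contains \<open>n0\<close> points up
  to the error \<open>e\<close>, so the classes in \<open>Z\<close> contain about
  \<open>|Z| n0\<close> points. Counted by their values they contain exactly a \<open>p\<close>-th
  part of all points, which is about \<open>p n0\<close>. As \<open>|Z|\<close> is not
  \<open>p\<close>, the errors have to compensate a difference of at least \<open>n0\<close>. Hence
  \<open>n0 = O(S)\<close>, although it should be about \<open>(S / p)^2\<close>.\<close>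

lemma disc_zero: "B\<^sup>2 = A * C"
proof (rule ccontr)
  assume "B\<^sup>2 \<noteq> A * C"
  define \<Delta> where "\<Delta> = B\<^sup>2 - A * C"
  have D0: "\<Delta> \<noteq> 0" unfolding \<Delta>_def using \<open>B\<^sup>2 \<noteq> A * C\<close> by simp
  obtain p' :: nat where p': "prime p'" "p' > nat \<bar>\<Delta>\<bar> + 2" using bigger_prime by blast
  define p where "p = int p'"
  have p: "prime p" "p > 2" "p > \<bar>\<Delta>\<bar>" unfolding p_def using p' by auto
  have "\<not> p dvd B\<^sup>2 - A * C"
    using D0 p(3) zdvd_imp_le[of p "\<bar>\<Delta>\<bar>"] unfolding \<Delta>_def by auto
  define g where "g = (\<lambda>x y. A * x\<^sup>2 + 2 * B * x * y + C * y\<^sup>2 + D * x + E * y + F)"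
  obtain a where a: "card {(x, y). x \<in> {0..<p} \<and> y \<in> {0..<p} \<and> [g x y = a] (mod p)} \<noteq> nat p"
    using quadratic_not_uniform_mod_prime[OF p(1,2) \<open>\<not> p dvd B\<^sup>2 - A * C\<close>] unfolding g_def by blast
  define R where "R = {0..<p} \<times> {0..<p}"
  define Z where "Z = {(x, y). x \<in> {0..<p} \<and> y \<in> {0..<p} \<and> [g x y = a] (mod p)}"
  have ZR: "Z \<subseteq> R" and finR: "finite R" unfolding Z_def R_def by auto
  have cardR: "card R = p' * p'" unfolding R_def p_def by (simp add: card_cartesian_product)
  have cardZ: "card Z \<noteq> p'" using a unfolding Z_def p_def by simp
  have g_mod: "[g (x mod p) (y mod p) = 2 * f x y] (mod p)" for x y
    unfolding f_eq g_def by (intro cong_add cong_mult cong_pow cong_refl cong_mod_left) auto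
  obtain c where c: "c > 0" and defect: "\<And>S d1 d2. S \<ge> 1 \<Longrightarrow> 0 \<le> d1 \<Longrightarrow> d1 < p \<Longrightarrow> 0 \<le> d2 \<Longrightarrow> d2 < p \<Longrightarrow>
      real (card {(x, y) \<in> sublevel ((int S)\<^sup>2). (x + d1, y + d2) \<notin> sublevel ((int S)\<^sup>2)}) \<le> c * real S"
    by (rule shift_defect[of p]) (use p(2) in \<open>simp, blast\<close>)
  \<comment> \<open>The count ends with a quantity quadratic in \<open>Y\<close> bounded by one
    linear in \<open>Y\<close>, and this \<open>Y\<close> exceeds the resulting bound
    \<open>(2 p' + 2) p' c\<close>. Making \<open>S\<close> a multiple of \<open>p'\<close> ensures
    that every residue class of values has the same number \<open>q\<close> of members below
    \<open>S^2\<close>.\<close>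
  define Y where "Y = (2 * p' + 2) * p' * (nat \<lceil>c\<rceil> + 1)"
  define S where "S = p' * Y"
  have Y1: "Y \<ge> 1" unfolding Y_def using p' by simp
  have S1: "S \<ge> 1" unfolding S_def using p' Y1 by simp
  define V where "V = sublevel ((int S)\<^sup>2)"
  have finV: "finite V" unfolding V_def by (rule finite_sublevel)
  define r where "r = (\<lambda>(x, y). (x mod p, y mod p))"
  define n where "n v = card {w \<in> V. r w = v}" for v
  have shift_mod: "(x + (w - x mod p) mod p) mod p = w mod p" for x w
  proof -
    have "x + (w - x mod p) = w + p * (x div p)" using mult_div_mod_eq[of p x] by linarith
    then show ?thesis by (simp only: mod_add_right_eq mod_mult_self2)
  qed
  have n_le: "real (n v) \<le> real (n w) + c * real S" if vw: "v \<in> R" "w \<in> R" for v w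
  proof -
    obtain v1 v2 w1 w2 where [simp]: "v = (v1, v2)" "w = (w1, w2)" by force
    define d1 where "d1 = (w1 - v1) mod p"
    define d2 where "d2 = (w2 - v2) mod p"
    have d: "0 \<le> d1" "d1 < p" "0 \<le> d2" "d2 < p" unfolding d1_def d2_def using p by auto
    define Bad where "Bad = {(x, y) \<in> V. (x + d1, y + d2) \<notin> V}"
    have finB: "finite Bad" unfolding Bad_def by (rule finite_subset[OF _ finV]) auto
    have sub: "{u \<in> V. r u = v} \<subseteq> Bad \<union> {u \<in> V - Bad. r u = v}" by auto
    have "card {u \<in> V - Bad. r u = v} \<le> n w"
      unfolding n_def
    proof (rule card_inj_on_le[of "\<lambda>(x, y). (x + d1, y + d2)"])
      show "(\<lambda>(x, y). (x + d1, y + d2)) ` {u \<in> V - Bad. r u = v} \<subseteq> {u \<in> V. r u = w}"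
      proof clarsimp
        fix x y assume *: "(x, y) \<in> V" "(x, y) \<notin> Bad" "r (x, y) = (v1, v2)"
        have "(x + d1) mod p = w1 mod p" "(y + d2) mod p = w2 mod p"
          using *(3) shift_mod unfolding d1_def d2_def r_def by auto
        then show "(x + d1, y + d2) \<in> V \<and> r (x + d1, y + d2) = (w1, w2)"
          using * vw unfolding Bad_def r_def R_def by auto
      qed
    qed (use finV in \<open>auto intro: inj_onI\<close>)
    then have "n v \<le> card Bad + n w"
      unfolding n_def[of v] using card_mono[OF _ sub] card_Un_le[of Bad "{u \<in> V - Bad. r u = v}"] finB finV
      by fastforce
    then have "real (n v) \<le> real (card Bad) + real (n w)" by linarith
    moreover have "real (card Bad) \<le> c * real S" using defect[OF S1 d] unfolding Bad_def V_def .
    ultimately show ?thesis by linarith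
  qed
  have r_R: "r v \<in> R" for v unfolding r_def R_def using p by (auto split: prod.split)
  have n_sum: "(\<Sum>v\<in>X. n v) = card {w \<in> V. r w \<in> X}" if "finite X" for X
  proof -
    have "card {w \<in> V. r w \<in> X} = card (\<Union>v\<in>X. {w \<in> V. r w = v})" by (rule arg_cong[of _ _ card]) auto
    also have "\<dots> = (\<Sum>v\<in>X. n v)" unfolding n_def using that finV by (intro card_UN_disjoint) auto
    finally show ?thesis by simp
  qed
  define q where "q = p' * Y\<^sup>2"
  have Sq: "(int S)\<^sup>2 = p * int q" unfolding S_def q_def p_def by (simp add: power2_eq_square algebra_simps)
  have sumR: "(\<Sum>v\<in>R. n v) = p' * q"
  proof -
    have "(\<Sum>v\<in>R. n v) = card V" using n_sum[OF finR] r_R by simp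
    also have "\<dots> = nat ((int S)\<^sup>2)" unfolding V_def by (rule card_sublevel)
    also have "\<dots> = p' * q" unfolding Sq p_def by (simp add: nat_mult_distrib)
    finally show ?thesis .
  qed
  \<comment> \<open>Modulo \<open>p\<close>, \<open>g\<close> is \<open>2 f\<close> and
    \<open>2\<close> is invertible. So \<open>Z\<close> collects exactly the points whose value lies
    in one residue class.\<close>
  have sumZ: "(\<Sum>v\<in>Z. n v) = q"
  proof -
    have "coprime 2 p" 
    proof -
      have "\<not> p dvd 2" using p(2) zdvd_imp_le[of p 2] by linarith
      then show ?thesis using prime_imp_coprime[OF p(1), of 2] by (simp add: coprime_commute)
    qed
    then obtain i where "[2 * i = 1] (mod p)" using cong_solve_coprime_int by blast
    then have i2: "[2 * (i * a) = a] (mod p)" using cong_scalar_right[of "2 * i" 1 p a] by (simp add: mult.assoc)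
    have iff: "[2 * k = a] (mod p) \<longleftrightarrow> [k = i * a] (mod p)" for k
      using i2 cong_mult_lcancel[of 2 p k "i * a"] \<open>coprime 2 p\<close> by (simp add: cong_def)
    have "r (x, y) \<in> Z \<longleftrightarrow> [f x y = i * a] (mod p)" for x y
    proof -
      have "r (x, y) \<in> Z \<longleftrightarrow> [g (x mod p) (y mod p) = a] (mod p)"
        unfolding Z_def r_def using p by auto
      also have "\<dots> \<longleftrightarrow> [2 * f x y = a] (mod p)" using g_mod[of x y] by (simp add: cong_def)
      finally show ?thesis unfolding iff .
    qed
    then have "{w \<in> V. r w \<in> Z} = {w \<in> V. [(\<lambda>(x, y). f x y) w = i * a] (mod p)}" by auto
    moreover have "bij_betw (\<lambda>(x, y). f x y) {w \<in> V. [(\<lambda>(x, y). f x y) w = i * a] (mod p)}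
        {k \<in> {0..<p * int q}. [k = i * a] (mod p)}"
      by (rule bij_betw_restrict[where P = "\<lambda>k. [k = i * a] (mod p)"]) (use sublevel_bij[of "(int S)\<^sup>2"] in \<open>simp add: V_def Sq\<close>)
    ultimately have "card {w \<in> V. r w \<in> Z} = card {k \<in> {0..<p * int q}. [k = i * a] (mod p)}"
      by (simp only: bij_betw_same_card)
    also have "\<dots> = q" by (rule card_cong_class) (use p(2) in simp)
    finally show ?thesis by (simp only: n_sum[OF finite_subset[OF ZR finR]])
  qed
  define n0 where "n0 = real (n (0, 0))"
  have z0: "(0, 0) \<in> R" unfolding R_def using p by auto
  define e where "e = c * real S"
  have e0: "e \<ge> 0" unfolding e_def using c by simp
  have nb: "n0 - e \<le> real (n v)" "real (n v) \<le> n0 + e" if "v \<in> R" for v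
    using n_le[OF that z0] n_le[OF z0 that] unfolding n0_def e_def by auto
  have R_le: "real (p' * q) \<le> real (p' * p') * (n0 + e)" "real (p' * p') * (n0 - e) \<le> real (p' * q)"
  proof -
    have "real (p' * q) = (\<Sum>v\<in>R. real (n v))" unfolding sumR[symmetric] by simp
    then show "real (p' * q) \<le> real (p' * p') * (n0 + e)" "real (p' * p') * (n0 - e) \<le> real (p' * q)"
      using sum_mono[of R "\<lambda>v. real (n v)" "\<lambda>_. n0 + e"] sum_mono[of R "\<lambda>_. n0 - e" "\<lambda>v. real (n v)"] nb
      by (simp_all add: cardR)
  qed
  have Z_le: "real q \<le> real (card Z) * (n0 + e)" "real (card Z) * (n0 - e) \<le> real q"
  proof -
    have "real q = (\<Sum>v\<in>Z. real (n v))" unfolding sumZ[symmetric] by simp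
    then show "real q \<le> real (card Z) * (n0 + e)" "real (card Z) * (n0 - e) \<le> real q"
      using sum_mono[of Z "\<lambda>v. real (n v)" "\<lambda>_. n0 + e"] sum_mono[of Z "\<lambda>_. n0 - e" "\<lambda>v. real (n v)"] nb ZR
      by (auto simp: subset_iff)
  qed
  define P where "P = real p'"
  define m where "m = real (card Z)"
  have P1: "P \<ge> 1" unfolding P_def using p' by simp
  have q1: "real q \<le> P * (n0 + e)" "P * (n0 - e) \<le> real q"
    using R_le P1 unfolding P_def by (simp_all add: mult.assoc)
  have m0: "m \<ge> 0" unfolding m_def by simp
  have "n0 \<le> (2 * P + 1) * e"
  proof (cases "card Z > p'")
    case True
    then have "m \<ge> P + 1" unfolding m_def P_def by linarith
    show ?thesis
    proof (cases "n0 \<ge> e")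
      case True
      then have "(P + 1) * (n0 - e) \<le> m * (n0 - e)" using \<open>m \<ge> P + 1\<close> by (intro mult_right_mono) auto
      then have "(P + 1) * (n0 - e) \<le> P * (n0 + e)" using Z_le(2) q1(1) unfolding m_def by linarith
      then show ?thesis by (simp add: algebra_simps)
    next
      case False
      moreover have "1 * e \<le> (2 * P + 1) * e" using P1 e0 by (intro mult_right_mono) auto
      ultimately show ?thesis by linarith
    qed
  next
    case False
    then have "m \<le> P - 1" unfolding m_def P_def using cardZ by linarith
    moreover have "n0 \<ge> 0" unfolding n0_def by simp
    ultimately have "m * (n0 + e) \<le> (P - 1) * (n0 + e)" using e0 by (intro mult_right_mono) auto
    then have "P * (n0 - e) \<le> (P - 1) * (n0 + e)" using Z_le(1) q1(2) unfolding m_def by linarith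
    then have "n0 \<le> (2 * P - 1) * e" by (simp add: algebra_simps)
    also have "\<dots> \<le> (2 * P + 1) * e" using e0 by (intro mult_right_mono) auto
    finally show ?thesis .
  qed
  then have "P * (n0 + e) \<le> P * ((2 * P + 2) * e)" using P1 by (intro mult_left_mono) (auto simp: algebra_simps)
  then have "real q \<le> P * ((2 * P + 2) * e)" using q1 by linarith
  then have "P * real Y * real Y \<le> P * real Y * ((2 * P + 2) * P * c)"
    unfolding q_def e_def S_def P_def by (simp add: power2_eq_square mult_ac)
  then have "real Y \<le> (2 * P + 2) * P * c"
    using P1 Y1 by (subst (asm) mult_le_cancel_left_pos) auto
  also have "\<dots> < (2 * P + 2) * P * (real (nat \<lceil>c\<rceil>) + 1)"
    using P1 by (intro mult_strict_left_mono) (auto, linarith)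
  also have "\<dots> = real Y" unfolding Y_def P_def by (simp add: algebra_simps)
  finally show False by simp
qed

end

section \<open>Packings with a degenerate quadratic part\<close>

text \<open>Line \<open>t\<close> of the degenerate form carries the values
  \<open>\<psi> t + e z\<close>, for \<open>z\<close> between the two edges. The constant is written
  \<open>2 F\<close> so that \<open>F\<close> is the value at the origin.\<close>

locale level_packing =
  fixes lam mu :: real and s d e F :: int and \<psi> :: "int \<Rightarrow> int"
  assumes lam_mu: "lam < mu" and s_pos: "s > 0" and e_pos: "e > 0"
    and psi_eq: "\<And>t. 2 * \<psi> t = s * t\<^sup>2 + d * t + 2 * F"
    and bij: "bij_betw (\<lambda>(t, z). \<psi> t + e * z) {(t, z). lam * of_int t \<le> of_int z \<and> of_int z \<le> mu * of_int t} {0..}"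
begin

text \<open>The ends of the progression on line \<open>t\<close>. If the line contains no lattice
  point, then \<open>lo t\<close> exceeds \<open>hi t\<close>.\<close>

definition "lo t = \<psi> t + e * \<lceil>lam * of_int t\<rceil>"
definition "hi t = \<psi> t + e * \<lfloor>mu * of_int t\<rfloor>"

lemma level_cong: "[lo t = \<psi> t] (mod e)" "[hi t = \<psi> t] (mod e)"
  unfolding lo_def hi_def by (simp_all add: cong_iff_dvd_diff)

lemma attained:
  assumes "v \<ge> 0"
  obtains t where "t \<ge> 0" "[v = \<psi> t] (mod e)" "lo t \<le> v" "v \<le> hi t"
proof -
  have "v \<in> (\<lambda>(t, z). \<psi> t + e * z) ` {(t, z). lam * of_int t \<le> of_int z \<and> of_int z \<le> mu * of_int t}"
    using bij_betw_imp_surj_on[OF bij] assms by simp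
  then obtain t z where tz: "lam * of_int t \<le> of_int z" "of_int z \<le> mu * of_int t" "v = \<psi> t + e * z" by auto
  have "0 \<le> (mu - lam) * of_int t" using tz by (simp add: algebra_simps)
  then have "t \<ge> 0" using lam_mu by (simp add: zero_le_mult_iff)
  moreover have "\<lceil>lam * of_int t\<rceil> \<le> z" "z \<le> \<lfloor>mu * of_int t\<rfloor>"
    using tz by (auto simp: ceiling_le_iff le_floor_iff)
  then have "lo t \<le> v" "v \<le> hi t" unfolding lo_def hi_def tz(3) using e_pos by auto
  ultimately show ?thesis using that[of t] tz(3) by (simp add: cong_iff_dvd_diff)
qed

lemma level_point:
  assumes "[v = \<psi> t] (mod e)" "lo t \<le> v" "v \<le> hi t"
  obtains z where "lam * of_int t \<le> of_int z" "of_int z \<le> mu * of_int t" "v = \<psi> t + e * z"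
proof -
  obtain z where z: "v = \<psi> t + e * z" using assms(1) by (metis cong_iff_lin cong_sym)
  then have "\<lceil>lam * of_int t\<rceil> \<le> z" "z \<le> \<lfloor>mu * of_int t\<rfloor>" using assms e_pos unfolding lo_def hi_def by auto
  then show ?thesis using that z by (simp add: ceiling_le_iff le_floor_iff)
qed

lemma attained_nonneg:
  assumes "[v = \<psi> t] (mod e)" "lo t \<le> v" "v \<le> hi t"
  shows "v \<ge> 0"
proof -
  obtain z where "lam * of_int t \<le> of_int z" "of_int z \<le> mu * of_int t" "v = \<psi> t + e * z"
    using level_point[OF assms] .
  then show ?thesis using bij_betwE[OF bij] by fastforce
qed

lemma attained_unique:
  assumes "[v = \<psi> t] (mod e)" "lo t \<le> v" "v \<le> hi t"
    and "[v = \<psi> t'] (mod e)" "lo t' \<le> v" "v \<le> hi t'"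
  shows "t = t'"
proof -
  obtain z where z: "lam * of_int t \<le> of_int z" "of_int z \<le> mu * of_int t" "v = \<psi> t + e * z"
    using level_point[OF assms(1-3)] .
  obtain z' where z': "lam * of_int t' \<le> of_int z'" "of_int z' \<le> mu * of_int t'" "v = \<psi> t' + e * z'"
    using level_point[OF assms(4-6)] .
  have "(t, z) = (t', z')"
    by (rule inj_onD[OF bij_betw_imp_inj_on[OF bij]]) (use z z' in auto)
  then show ?thesis by simp
qed

lemma psi_add: "2 * (\<psi> (t + h) - \<psi> t) = h * (2 * s * t + s * h + d)"
  using psi_eq[of "t + h"] psi_eq[of t] by (simp add: algebra_simps power2_eq_square)

text \<open>Since \<psi> has half-integral coefficients, \<open>2 e\<close> is the period available
  at once. That \<open>e\<close> itself is a period comes from the packing, in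
  \<open>spacing_eq\<close>.\<close>

lemma psi_period_2e: "[\<psi> (t + 2 * e * i) = \<psi> t] (mod e)"
proof -
  have "\<psi> (t + 2 * e * i) - \<psi> t = e * (i * (2 * s * t + s * (2 * e * i) + d))"
    using psi_add[of t "2 * e * i"] by (simp add: algebra_simps)
  then show ?thesis by (simp add: cong_iff_dvd_diff)
qed

text \<open>From one line to the next \<psi> gains about \<open>s t\<close>, whereas the edge
  contributes a bounded change. The last summand of \<open>T\<close> makes the line at least one
  unit wide, so that it contains a lattice point.\<close>

lemma lo_eventually_increasing:
  obtains T where "T \<ge> 0" "\<And>t. t \<ge> T \<Longrightarrow> lo t < lo (t + 1)" "\<And>t. t \<ge> T \<Longrightarrow> lo t \<le> hi t"
proof -
  define T where "T = 1 + \<bar>s + d\<bar> + 2 * \<bar>e * \<lfloor>lam\<rfloor>\<bar> + \<bar>\<lceil>1 / (mu - lam)\<rceil>\<bar>"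
  have "lo t < lo (t + 1)" if t: "t \<ge> T" for t
  proof -
    have aux: "a + b \<le> c \<Longrightarrow> 2 * p' = 2 * p + 2 * r + q \<Longrightarrow> t \<le> r \<Longrightarrow> \<bar>q\<bar> + 2 * \<bar>b\<bar> < t \<Longrightarrow> p + a < p' + c"
      for a b c p p' q r :: int by linarith
    have t0: "t \<ge> 0" using t unfolding T_def by linarith
    have "\<lceil>lam * of_int t\<rceil> + \<lfloor>lam\<rfloor> \<le> \<lceil>lam * of_int (t + 1)\<rceil>"
    proof -
      have "lam * of_int (t + 1) = lam * of_int t + lam" by (simp add: algebra_simps)
      then show ?thesis by linarith
    qed
    then have "e * (\<lceil>lam * of_int t\<rceil> + \<lfloor>lam\<rfloor>) \<le> e * \<lceil>lam * of_int (t + 1)\<rceil>" using e_pos by simp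
    moreover have "2 * \<psi> (t + 1) = 2 * \<psi> t + 2 * (s * t) + (s + d)" using psi_add[of t 1] by simp
    moreover have "t \<le> s * t" using s_pos t0 by (simp add: mult_le_cancel_right1)
    moreover have "t > \<bar>s + d\<bar> + 2 * \<bar>e * \<lfloor>lam\<rfloor>\<bar>" using t unfolding T_def by linarith
    ultimately show ?thesis unfolding lo_def distrib_left by (rule aux)
  qed
  moreover have "lo t \<le> hi t" if t: "t \<ge> T" for t
  proof -
    have "1 / (mu - lam) \<le> of_int t" using t unfolding T_def by linarith
    then have "1 \<le> mu * of_int t - lam * of_int t" using lam_mu by (simp add: field_simps)
    then have "\<lceil>lam * of_int t\<rceil> \<le> \<lfloor>mu * of_int t\<rfloor>" by linarith
    then show ?thesis unfolding lo_def hi_def using e_pos by simp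
  qed
  moreover have "T \<ge> 0" unfolding T_def by linarith
  ultimately show ?thesis using that by blast
qed

text \<open>The value \<open>hi t + e\<close> has to lie on some line of the residue class of
  \<open>\<psi> t\<close>. The late lines of this class carry disjoint progressions in increasing
  order, because an overlap would give a value on two lines; the finitely many early lines only
  reach values below \<open>lo t\<close>. So the next line of the class must continue the
  progression directly.\<close>

lemma next_level:
  obtains T where "T \<ge> 0" "\<And>t h. t \<ge> T \<Longrightarrow> h \<ge> 1 \<Longrightarrow> [\<psi> (t + h) = \<psi> t] (mod e) \<Longrightarrow>
    (\<And>i. 1 \<le> i \<Longrightarrow> i < h \<Longrightarrow> \<not> [\<psi> (t + i) = \<psi> t] (mod e)) \<Longrightarrow> lo (t + h) = hi t + e"
proof -
  obtain T0 where T0: "T0 \<ge> 0" and inc1: "\<And>t. t \<ge> T0 \<Longrightarrow> lo t < lo (t + 1)" and lohi: "\<And>t. t \<ge> T0 \<Longrightarrow> lo t \<le> hi t"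
    by (rule lo_eventually_increasing) blast
  have inc: "lo t + (t' - t) \<le> lo t'" if "T0 \<le> t" "t \<le> t'" for t t'
    using that(2)
  proof (induction t' rule: int_ge_induct)
    case (step i)
    then show ?case using inc1[of i] that(1) by simp
  qed simp
  have sep: "hi t < lo t'" if t: "T0 \<le> t" "t < t'" and cong: "[\<psi> t' = \<psi> t] (mod e)" for t t'
  proof (rule ccontr)
    assume "\<not> ?thesis"
    moreover have "lo t \<le> lo t'" using inc[of t t'] t by simp
    moreover have "[lo t' = \<psi> t] (mod e)" using level_cong(1)[of t'] cong by (simp add: cong_def)
    ultimately have "t = t'"
      using t lohi[of t'] level_cong(1) by (intro attained_unique[of "lo t'"]) auto
    then show False using t by simp
  qed
  define M where "M = (\<Sum>t\<in>{0..<T0}. \<bar>hi t\<bar>)"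
  have M: "hi t \<le> M" if "0 \<le> t" "t < T0" for t
  proof -
    have "\<bar>hi t\<bar> \<le> M" unfolding M_def by (rule member_le_sum) (use that in auto)
    then show ?thesis by linarith
  qed
  \<comment> \<open>As \<open>lo\<close> gains at least \<open>1\<close> per line after
    \<open>T0\<close>, from \<open>T\<close> on it exceeds every value on the lines before
    \<open>T0\<close>.\<close>
  define T where "T = T0 + \<bar>M\<bar> + \<bar>lo T0\<bar> + 1"
  have step: "lo (t + h) = hi t + e"
    if t: "t \<ge> T" and h: "h \<ge> 1" "[\<psi> (t + h) = \<psi> t] (mod e)"
      and gap: "\<And>i. 1 \<le> i \<Longrightarrow> i < h \<Longrightarrow> \<not> [\<psi> (t + i) = \<psi> t] (mod e)" for t h
  proof -
    have tT0: "t \<ge> T0" using t unfolding T_def by linarith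
    have loM: "lo t > M" using inc[of T0 t] tT0 t unfolding T_def by linarith
    define v where "v = hi t + e"
    have cv: "[v = \<psi> t] (mod e)" unfolding v_def hi_def by (simp add: cong_iff_dvd_diff)
    have "0 \<le> lo t" using lohi[OF tT0] level_cong(1) by (intro attained_nonneg[of "lo t" t]) auto
    then have "v \<ge> 0" unfolding v_def using lohi[OF tT0] e_pos by linarith
    then obtain u where u: "u \<ge> 0" "[v = \<psi> u] (mod e)" "lo u \<le> v" "v \<le> hi u" by (rule attained)
    have cu: "[\<psi> u = \<psi> t] (mod e)" using u(2) cv by (simp add: cong_def)
    have "u \<ge> T0"
    proof (rule ccontr)
      assume "\<not> ?thesis"
      then have "v \<le> M" using M[of u] u by linarith
      then show False using loM lohi[OF tT0] e_pos unfolding v_def by linarith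
    qed
    moreover have "u \<noteq> t" using u e_pos unfolding v_def by auto
    moreover have "\<not> u < t"
    proof
      assume "u < t"
      then have "hi u < lo t" using sep[of u t] \<open>u \<ge> T0\<close> cu by (simp add: cong_def)
      then show False using u lohi[OF tT0] e_pos unfolding v_def by linarith
    qed
    ultimately have "u > t" by linarith
    have "u \<ge> t + h"
    proof (rule ccontr)
      assume "\<not> ?thesis"
      then have "\<not> [\<psi> (t + (u - t)) = \<psi> t] (mod e)" using \<open>u > t\<close> by (intro gap) linarith+
      then show False using cu by simp
    qed
    then have "lo (t + h) \<le> v" using inc[of "t + h" u] u(3) tT0 h by linarith
    moreover have "hi t < lo (t + h)" using sep[of t "t + h"] tT0 h by simp
    moreover have "e dvd lo (t + h) - hi t"
    proof -
      have "[lo (t + h) = hi t] (mod e)" using level_cong(1)[of "t + h"] level_cong(2)[of t] h(2) by (simp add: cong_def)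
      then show ?thesis by (simp add: cong_iff_dvd_diff)
    qed
    then have "lo (t + h) - hi t \<ge> e \<or> lo (t + h) - hi t \<le> 0" using zdvd_imp_le[of e "lo (t + h) - hi t"] by linarith
    ultimately show ?thesis unfolding v_def by linarith
  qed
  have "T \<ge> 0" unfolding T_def using T0 by linarith
  then show ?thesis using step by (rule that)
qed

text \<open>In \<open>lo (t + h) = hi t + e\<close> the terms linear in \<open>t\<close> are
  \<open>s h t\<close> and \<open>e (mu - lam) t\<close>, and all others are bounded. The first
  return \<open>h\<close> of the residue is at most \<open>2 e\<close>, so only finitely many
  \<open>h\<close> compete, and for large \<open>t\<close> the linear terms must cancel exactly.
  Hence \<open>h\<close> is the same for all large \<open>t\<close>, and the period
  \<open>2 e\<close> carries the congruences back to every \<open>t\<close>.\<close>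

lemma spacing:
  obtains h T where "h \<ge> 1" "T \<ge> 0" "of_int (s * h) = of_int e * (mu - lam)"
    "\<And>t. [\<psi> (t + h) = \<psi> t] (mod e)" "\<And>t i. 1 \<le> i \<Longrightarrow> i < h \<Longrightarrow> \<not> [\<psi> (t + i) = \<psi> t] (mod e)"
    "\<And>t. t \<ge> T \<Longrightarrow> lo (t + h) = hi t + e"
proof -
  obtain T1 where T1: "T1 \<ge> 0" and nxt: "\<And>t h. t \<ge> T1 \<Longrightarrow> h \<ge> 1 \<Longrightarrow> [\<psi> (t + h) = \<psi> t] (mod e) \<Longrightarrow>
    (\<And>i. 1 \<le> i \<Longrightarrow> i < h \<Longrightarrow> \<not> [\<psi> (t + i) = \<psi> t] (mod e)) \<Longrightarrow> lo (t + h) = hi t + e"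
    by (rule next_level) blast
  define K where "K = real_of_int e * (3 + 2 * of_int e * \<bar>lam\<bar>) + 2 * of_int e * (2 * of_int s * of_int e + \<bar>of_int d\<bar>)"
  have K0: "K \<ge> 0" unfolding K_def using e_pos s_pos by (intro add_nonneg_nonneg mult_nonneg_nonneg) auto
  define \<gamma> where "\<gamma> h = \<bar>real_of_int (s * h) - of_int e * (mu - lam)\<bar>" for h
  \<comment> \<open>\<open>T\<close> exceeds \<open>K / \<gamma> h\<close> for every candidate
    \<open>h\<close>. A candidate with \<open>\<gamma> h = 0\<close> contributes \<open>0\<close>,
    by the convention for division by zero.\<close>
  define T where "T = T1 + \<lceil>\<Sum>h\<in>{1..2 * e}. K / \<gamma> h\<rceil> + 1"
  have \<gamma>0: "K / \<gamma> h \<ge> 0" for h unfolding \<gamma>_def using K0 by simp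
  have sum0: "(\<Sum>h\<in>{1..2 * e}. K / \<gamma> h) \<ge> 0" by (rule sum_nonneg) (rule \<gamma>0)
  have T: "T \<ge> T1" "T > 0" unfolding T_def using sum0 T1 by linarith+
  have key: "\<exists>h\<ge>1. h \<le> 2 * e \<and> of_int (s * h) = of_int e * (mu - lam) \<and> [\<psi> (t + h) = \<psi> t] (mod e) \<and>
     (\<forall>i. 1 \<le> i \<longrightarrow> i < h \<longrightarrow> \<not> [\<psi> (t + i) = \<psi> t] (mod e)) \<and> lo (t + h) = hi t + e" if t: "t \<ge> T" for t
  proof -
    define Pn where "Pn n \<longleftrightarrow> n \<ge> 1 \<and> [\<psi> (t + int n) = \<psi> t] (mod e)" for n
    have P2e: "Pn (nat (2 * e))" unfolding Pn_def using psi_period_2e[of t 1] e_pos by simp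
    define n where "n = (LEAST n. Pn n)"
    have Pn: "Pn n" unfolding n_def using P2e by (rule LeastI)
    have n_le: "n \<le> nat (2 * e)" unfolding n_def using P2e by (rule Least_le)
    have n_min: "\<not> Pn i" if "i < n" for i using that unfolding n_def by (rule not_less_Least)
    define h where "h = int n"
    have h: "1 \<le> h" "h \<le> 2 * e" "[\<psi> (t + h) = \<psi> t] (mod e)"
      using Pn n_le e_pos unfolding h_def Pn_def by auto
    have gap: "\<not> [\<psi> (t + i) = \<psi> t] (mod e)" if "1 \<le> i" "i < h" for i
    proof -
      have "\<not> Pn (nat i)" by (rule n_min) (use that in \<open>auto simp: h_def\<close>)
      then show ?thesis unfolding Pn_def using that by simp
    qed
    have lohi: "lo (t + h) = hi t + e" by (rule nxt) (use t T h gap in auto)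
    have t0: "t > 0" using t T by simp
    have "2 * real_of_int (\<psi> (t + h) - \<psi> t) = of_int (h * (2 * s * t + s * h + d))"
      using psi_add[of t h] by (metis of_int_mult of_int_numeral)
    then have X: "real_of_int (\<psi> (t + h) - \<psi> t) = of_int h * of_int s * of_int t + of_int h * (of_int s * of_int h + of_int d) / 2"
      by (simp add: field_simps)
    define \<theta> where "\<theta> = real_of_int \<lceil>lam * of_int (t + h)\<rceil> - lam * of_int (t + h)"
    define \<theta>' where "\<theta>' = mu * of_int t - real_of_int \<lfloor>mu * of_int t\<rfloor>"
    have ceil: "real_of_int \<lceil>lam * of_int (t + h)\<rceil> = lam * (of_int t + of_int h) + \<theta>"
      and floor: "real_of_int \<lfloor>mu * of_int t\<rfloor> = mu * of_int t - \<theta>'" unfolding \<theta>_def \<theta>'_def by simp_all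
    have "real_of_int (\<psi> (t + h) - \<psi> t) + of_int e * of_int \<lceil>lam * of_int (t + h)\<rceil> - of_int e * of_int \<lfloor>mu * of_int t\<rfloor> = of_int e"
      using arg_cong[OF lohi, of real_of_int] unfolding lo_def hi_def by simp
    then have "(of_int (s * h) - of_int e * (mu - lam)) * of_int t =
        of_int e * (1 - \<theta> - \<theta>' - lam * of_int h) - of_int h * (of_int s * of_int h + of_int d) / 2"
      unfolding X ceil floor by (simp add: algebra_simps)
    moreover have "\<bar>of_int e * (1 - \<theta> - \<theta>' - lam * of_int h)\<bar> \<le> of_int e * (3 + 2 * of_int e * \<bar>lam\<bar>)"
    proof -
      have "0 \<le> \<theta>" "\<theta> \<le> 1" "0 \<le> \<theta>'" "\<theta>' \<le> 1" unfolding \<theta>_def \<theta>'_def by linarith+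
      moreover have "\<bar>lam * of_int h\<bar> \<le> 2 * of_int e * \<bar>lam\<bar>"
      proof -
        have "\<bar>lam\<bar> * \<bar>real_of_int h\<bar> \<le> \<bar>lam\<bar> * (2 * of_int e)" using h by (intro mult_left_mono) auto
        then show ?thesis by (simp add: abs_mult mult_ac)
      qed
      ultimately have "\<bar>1 - \<theta> - \<theta>' - lam * of_int h\<bar> \<le> 3 + 2 * of_int e * \<bar>lam\<bar>" by linarith
      then show ?thesis unfolding abs_mult using e_pos by (intro mult_mono) auto
    qed
    moreover have "\<bar>of_int h * (of_int s * of_int h + real_of_int d) / 2\<bar> \<le> 2 * of_int e * (2 * of_int s * of_int e + \<bar>of_int d\<bar>)"
    proof -
      have "\<bar>of_int s * of_int h + real_of_int d\<bar> \<le> 2 * of_int s * of_int e + \<bar>of_int d\<bar>"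
      proof -
        have "of_int s * of_int h \<le> of_int s * (2 * real_of_int e)" using h s_pos by (intro mult_left_mono) auto
        moreover have "0 \<le> of_int s * real_of_int h" using h s_pos by simp
        moreover have "of_int s * (2 * real_of_int e) = 2 * of_int s * of_int e" by simp
        ultimately show ?thesis by linarith
      qed
      then have "\<bar>real_of_int h\<bar> * \<bar>of_int s * of_int h + real_of_int d\<bar> \<le> (2 * of_int e) * (2 * of_int s * of_int e + \<bar>of_int d\<bar>)"
        using h e_pos by (intro mult_mono) auto
      then have "\<bar>of_int h * (of_int s * of_int h + real_of_int d)\<bar> \<le> 2 * of_int e * (2 * of_int s * of_int e + \<bar>of_int d\<bar>)"
        unfolding abs_mult .
      then show ?thesis unfolding abs_divide by simp
    qed
    ultimately have "\<bar>(of_int (s * h) - of_int e * (mu - lam)) * of_int t\<bar> \<le> K"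
      unfolding K_def by linarith
    then have le: "\<gamma> h * of_int t \<le> K" unfolding \<gamma>_def abs_mult using t0 by simp
    have "\<gamma> h = 0"
    proof (rule ccontr)
      assume "\<gamma> h \<noteq> 0"
      then have pos: "\<gamma> h > 0" unfolding \<gamma>_def by simp
      have "K / \<gamma> h \<le> (\<Sum>h\<in>{1..2 * e}. K / \<gamma> h)"
        by (rule member_le_sum) (use h \<gamma>0 in auto)
      then have "K / \<gamma> h < of_int t" using t T1 unfolding T_def by linarith
      then have "K < \<gamma> h * of_int t" using pos by (simp add: divide_less_eq mult.commute)
      then show False using le by simp
    qed
    then have "of_int (s * h) = of_int e * (mu - lam)" unfolding \<gamma>_def by simp
    then show ?thesis using h gap lohi by blast
  qed
  obtain h where h: "h \<ge> 1" "of_int (s * h) = of_int e * (mu - lam)" using key[of T] by auto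
  have key': "[\<psi> (t + h) = \<psi> t] (mod e) \<and>
     (\<forall>i. 1 \<le> i \<longrightarrow> i < h \<longrightarrow> \<not> [\<psi> (t + i) = \<psi> t] (mod e)) \<and> lo (t + h) = hi t + e" if t: "t \<ge> T" for t
  proof -
    obtain h' where h': "of_int (s * h') = of_int e * (mu - lam)" "[\<psi> (t + h') = \<psi> t] (mod e)"
     "\<forall>i. 1 \<le> i \<longrightarrow> i < h' \<longrightarrow> \<not> [\<psi> (t + i) = \<psi> t] (mod e)" "lo (t + h') = hi t + e" using key[OF t] by auto
    have "real_of_int (s * h') = real_of_int (s * h)" using h'(1) h(2) by simp
    then have "h' = h" using s_pos by simp
    then show ?thesis using h' by simp
  qed
  have shift: "[\<psi> (t + 2 * e * \<bar>T\<bar> + 2 * e * \<bar>t\<bar>) = \<psi> t] (mod e)" "t + 2 * e * \<bar>T\<bar> + 2 * e * \<bar>t\<bar> \<ge> T" for t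
  proof -
    show "[\<psi> (t + 2 * e * \<bar>T\<bar> + 2 * e * \<bar>t\<bar>) = \<psi> t] (mod e)"
      using psi_period_2e[of "t + 2 * e * \<bar>T\<bar>" "\<bar>t\<bar>"] psi_period_2e[of t "\<bar>T\<bar>"] by (simp add: cong_def)
    have "1 * \<bar>T\<bar> \<le> 2 * e * \<bar>T\<bar>" "1 * \<bar>t\<bar> \<le> 2 * e * \<bar>t\<bar>" using e_pos by (intro mult_right_mono; simp)+
    then show "t + 2 * e * \<bar>T\<bar> + 2 * e * \<bar>t\<bar> \<ge> T" by linarith
  qed
  have transfer: "[\<psi> (t + i) = \<psi> t] (mod e) \<longleftrightarrow> 
      [\<psi> ((t + 2 * e * \<bar>T\<bar> + 2 * e * \<bar>t\<bar>) + i) = \<psi> (t + 2 * e * \<bar>T\<bar> + 2 * e * \<bar>t\<bar>)] (mod e)" for t i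
  proof -
    have "[\<psi> ((t + i) + 2 * e * (\<bar>T\<bar> + \<bar>t\<bar>)) = \<psi> (t + i)] (mod e)" by (rule psi_period_2e)
    moreover have "(t + i) + 2 * e * (\<bar>T\<bar> + \<bar>t\<bar>) = (t + 2 * e * \<bar>T\<bar> + 2 * e * \<bar>t\<bar>) + i" by (simp add: algebra_simps)
    ultimately show ?thesis using shift(1)[of t] by (simp add: cong_def)
  qed
  show ?thesis
  proof (rule that[of h T])
    show "[\<psi> (t + h) = \<psi> t] (mod e)" for t using key'[OF shift(2)[of t]] transfer[of t h] by blast
    show "\<not> [\<psi> (t + i) = \<psi> t] (mod e)" if "1 \<le> i" "i < h" for t i
      using key'[OF shift(2)[of t]] transfer[of t i] that by blast
    show "lo (t + h) = hi t + e" if "t \<ge> T" for t using key'[OF that] by blast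
  qed (use h T in auto)
qed

text \<open>By minimality of \<open>h\<close>, \<psi> is injective modulo \<open>e\<close> on a
  period of length \<open>h\<close>, and it meets every residue because all values are attained. So
  \<open>h = e\<close>, and \<psi> permutes the residues modulo \<open>e\<close>.\<close>

lemma spacing_eq:
  obtains T where "T \<ge> 0" "mu = lam + of_int s" "\<And>t t'. [\<psi> t = \<psi> t'] (mod e) \<longleftrightarrow> [t = t'] (mod e)"
    "\<And>t. t \<ge> T \<Longrightarrow> lo (t + e) = hi t + e"
proof -
  obtain h T where h: "h \<ge> 1" and T: "T \<ge> 0" and sh: "of_int (s * h) = of_int e * (mu - lam)"
    and per: "\<And>t. [\<psi> (t + h) = \<psi> t] (mod e)"
    and gap: "\<And>t i. 1 \<le> i \<Longrightarrow> i < h \<Longrightarrow> \<not> [\<psi> (t + i) = \<psi> t] (mod e)"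
    and nxt: "\<And>t. t \<ge> T \<Longrightarrow> lo (t + h) = hi t + e"
    by (rule spacing) blast
  have per': "[\<psi> (t + h * int n) = \<psi> t] (mod e)" for t n
  proof (induction n)
    case (Suc n)
    have "t + h * int (Suc n) = (t + h * int n) + h" by (simp add: algebra_simps)
    then show ?case using per[of "t + h * int n"] Suc by (simp only: cong_def)
  qed (simp add: cong_def)
  have perz: "[\<psi> (t + h * i) = \<psi> t] (mod e)" for t i
  proof (cases "i \<ge> 0")
    case True
    then show ?thesis using per'[of t "nat i"] by simp
  next
    case False
    then show ?thesis using per'[of "t + h * i" "nat (- i)"] by (simp add: cong_def)
  qed
  have modh: "[\<psi> (t mod h) = \<psi> t] (mod e)" for t
    using perz[of "t mod h" "t div h"] by (simp add: cong_def)
  have inj: "t = t'" if "t \<in> {0..<h}" "t' \<in> {0..<h}" "[\<psi> t = \<psi> t'] (mod e)" for t t'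
  proof -
    have "\<not> t < t'" using gap[of "t' - t" t] that by (auto simp: cong_def)
    moreover have "\<not> t' < t" using gap[of "t - t'" t'] that by (auto simp: cong_def)
    ultimately show ?thesis by simp
  qed
  have "bij_betw (\<lambda>t. \<psi> t mod e) {0..<h} {0..<e}"
    unfolding bij_betw_def
  proof (intro conjI equalityI subsetI)
    show "inj_on (\<lambda>t. \<psi> t mod e) {0..<h}" by (rule inj_onI) (use inj in \<open>auto simp: cong_def\<close>)
    fix r assume r: "r \<in> {0..<e}"
    then obtain t where t: "[r = \<psi> t] (mod e)" using attained[of r] by auto
    have "r = \<psi> (t mod h) mod e" using t modh[of t] r by (simp add: cong_def)
    then show "r \<in> (\<lambda>t. \<psi> t mod e) ` {0..<h}" by (rule image_eqI) (use h in auto)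
  qed (use e_pos in auto)
  then have "nat h = nat e" using bij_betw_same_card by fastforce
  then have "h = e" using h e_pos by simp
  have "of_int s = mu - lam" using sh e_pos unfolding \<open>h = e\<close> by simp
  moreover have "[\<psi> t = \<psi> t'] (mod e) \<longleftrightarrow> [t = t'] (mod e)" for t t'
  proof
    assume "[\<psi> t = \<psi> t'] (mod e)"
    then have "[\<psi> (t mod e) = \<psi> (t' mod e)] (mod e)" using modh[of t] modh[of t'] unfolding \<open>h = e\<close> by (simp add: cong_def)
    then show "[t = t'] (mod e)" using inj[of "t mod e" "t' mod e"] e_pos unfolding \<open>h = e\<close> by (simp add: cong_def)
  next
    assume "[t = t'] (mod e)"
    then show "[\<psi> t = \<psi> t'] (mod e)" using modh[of t] modh[of t'] unfolding \<open>h = e\<close> by (simp add: cong_def)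
  qed
  ultimately show ?thesis using that[of T] T nxt unfolding \<open>h = e\<close> by simp
qed

section \<open>Determination of the slope, the step and the constant\<close>

text \<open>The identity \<open>lo (t + e) = hi t + e\<close> determines the slope: \<open>D\<close>
  is the constant in \<open>\<psi> (t + e) = \<psi> t + e (s t + D)\<close>, and
  \<open>P e + D Q = 1\<close> says \<open>lam e = 1 / Q - D\<close>. The start of the progressions,
  that is, how the values \<open>0, ..., e - 1\<close> arise, then limits \<open>e\<close>,
  \<open>s\<close> and \<open>F\<close>.\<close>

lemma classification:
  fixes P Q :: int
  assumes Q: "Q > 0" and lam: "lam = of_int P / of_int Q" and PQ: "coprime P Q"
  shows "mu = lam + of_int s \<and> (\<exists>D. 2 * D = s * e + d \<and> P * e + D * Q = 1) \<and> F = e - 1 \<and>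
    (e = 1 \<or> e = 2 \<and> s = 4 \<or> e = 3 \<and> s = 3)"
proof -
  obtain T where T: "T \<ge> 0" and mu: "mu = lam + of_int s" and psi_cong: "\<And>t t'. [\<psi> t = \<psi> t'] (mod e) \<longleftrightarrow> [t = t'] (mod e)"
    and nxt: "\<And>t. t \<ge> T \<Longrightarrow> lo (t + e) = hi t + e"
    by (rule spacing_eq) blast
  have "[\<psi> (0 + e) = \<psi> 0] (mod e)" unfolding psi_cong by (simp add: cong_def)
  then obtain D where "\<psi> (0 + e) - \<psi> 0 = e * D" by (auto simp: cong_iff_dvd_diff elim: dvdE)
  then have "e * (2 * D) = e * (s * e + d)" using psi_add[of 0 e] by simp
  then have D: "2 * D = s * e + d" using e_pos by simp
  then have d: "d = 2 * D - s * e" by simp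
  have psi_e: "\<psi> (t + e) = \<psi> t + e * (s * t + D)" for t
  proof -
    have "2 * (\<psi> (t + e) - \<psi> t) = 2 * (e * (s * t + D))"
      unfolding psi_add d by (simp add: algebra_simps)
    then show ?thesis by simp
  qed
  have mu_floor: "\<lfloor>mu * of_int t\<rfloor> = \<lfloor>lam * of_int t\<rfloor> + s * t" for t
  proof -
    have "mu * of_int t = lam * of_int t + of_int (s * t)" unfolding mu by (simp add: algebra_simps)
    then show ?thesis by (simp only: floor_add_int)
  qed
  have E0: "\<lceil>lam * of_int (t + e)\<rceil> = \<lfloor>lam * of_int t\<rfloor> + 1 - D" if "t \<ge> T" for t
  proof -
    have "\<psi> t + e * (s * t + D) + e * \<lceil>lam * of_int (t + e)\<rceil> = \<psi> t + e * (\<lfloor>lam * of_int t\<rfloor> + s * t) + e"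
      using nxt[OF that] unfolding lo_def hi_def psi_e mu_floor .
    then have "e * \<lceil>lam * of_int (t + e)\<rceil> = e * (\<lfloor>lam * of_int t\<rfloor> + 1 - D)" by (simp add: algebra_simps)
    then show ?thesis using e_pos by simp
  qed
  \<comment> \<open>Both sides gain \<open>P N\<close> when \<open>t\<close> moves by
    \<open>Q N\<close>, so the identity extends from large \<open>t\<close> to all \<open>t\<close>,
    including the special values used next.\<close>
  have E1: "\<lceil>lam * of_int (t + e)\<rceil> = \<lfloor>lam * of_int t\<rfloor> + 1 - D" for t
  proof -
    define N where "N = \<bar>T\<bar> + \<bar>t\<bar>"
    have "1 * N \<le> Q * N" unfolding N_def using Q by (intro mult_right_mono) auto
    moreover have "T - t \<le> N" unfolding N_def by linarith
    ultimately have "t + Q * N \<ge> T" by linarith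
    from E0[OF this] have "\<lceil>lam * of_int (t + Q * N + e)\<rceil> = \<lfloor>lam * of_int (t + Q * N)\<rfloor> + 1 - D" .
    moreover have "lam * of_int (t + Q * N + e) = lam * of_int (t + e) + of_int (P * N)"
      "lam * of_int (t + Q * N) = lam * of_int t + of_int (P * N)"
      unfolding lam using Q by (simp_all add: field_simps)
    ultimately have "\<lceil>lam * of_int (t + e)\<rceil> + P * N = \<lfloor>lam * of_int t\<rfloor> + P * N + 1 - D"
      by (simp only: ceiling_add_of_int floor_add_int)
    then show ?thesis by simp
  qed
  have nxt': "lo (t + e) = hi t + e" for t
    unfolding lo_def hi_def psi_e mu_floor E1 by (simp add: algebra_simps)
  have PD: "P * e + D * Q = 1"
  proof -
    have "\<lceil>lam * of_int e\<rceil> = 1 - D" using E1[of 0] by simp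
    then have "- of_int D < lam * of_int e" by linarith
    then have "real_of_int (- (D * Q)) < of_int (P * e)" unfolding lam using Q by (simp add: field_simps)
    then have lower: "- (D * Q) < P * e" by (simp only: of_int_less_iff)
    \<comment> \<open>At \<open>t = - u\<close> the fractional part of \<open>lam t\<close> is as
      large as possible, namely \<open>1 - 1 / Q\<close>. This gives the sharpest upper bound for
      \<open>lam e\<close>, just as \<open>t = 0\<close> gave the sharpest lower bound.\<close>
    obtain u where "[P * u = 1] (mod Q)" using PQ cong_solve_coprime_int by blast
    then obtain k where k: "P * u = 1 + Q * k" by (metis cong_iff_lin cong_sym)
    have "lam * of_int (- u) = of_int (- (P * u)) / of_int Q" unfolding lam by simp
    then have lu: "lam * of_int (- u) = - of_int k - 1 / of_int Q" unfolding k using Q by (simp add: field_simps)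
    have "1 / real_of_int Q > 0" "1 / real_of_int Q \<le> 1" using Q by simp_all
    then have "\<lfloor>lam * of_int (- u)\<rfloor> = - k - 1" unfolding lu by linarith
    then have "\<lceil>lam * of_int (- u + e)\<rceil> = - k - D" using E1[of "- u"] by simp
    then have "lam * of_int (- u + e) \<le> - of_int k - of_int D" by linarith
    moreover have "lam * of_int (- u + e) = lam * of_int (- u) + lam * of_int e" by (simp add: algebra_simps)
    ultimately have "lam * of_int e \<le> 1 / of_int Q - of_int D" unfolding lu by linarith
    then have "real_of_int (P * e) \<le> of_int (1 - D * Q)" unfolding lam using Q by (simp add: field_simps)
    then have "P * e \<le> 1 - D * Q" by (simp only: of_int_le_iff)
    then show ?thesis using lower by linarith
  qed
  have D_e: "e = 1" if "e dvd D" 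
  proof -
    have "e dvd P * e + D * Q" using that by simp
    then show ?thesis unfolding PD using e_pos by simp
  qed
  have lohi: "lo t \<le> hi t" if "t \<ge> 0" for t
  proof -
    have "\<lceil>lam * of_int t\<rceil> \<le> \<lfloor>lam * of_int t\<rfloor> + s * t"
    proof (cases "t = 0")
      case False
      then have "1 * 1 \<le> s * t" using s_pos that by (intro mult_mono) auto
      then show ?thesis by linarith
    qed simp
    then show ?thesis unfolding lo_def hi_def mu_floor using e_pos by simp
  qed
  have lo_nonneg: "lo t \<ge> 0" if "t \<ge> 0" for t
    by (rule attained_nonneg[OF level_cong(1) _ lohi[OF that]]) simp
  have lo_chain: "lo t \<le> lo (t + e * int n)" if "t \<ge> 0" for t n
  proof (induction n)
    case (Suc n)
    have "t + e * int (Suc n) = (t + e * int n) + e" by (simp add: algebra_simps)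
    then have "lo (t + e * int (Suc n)) = hi (t + e * int n) + e" by (simp only: nxt')
    then show ?case using lohi[of "t + e * int n"] Suc that e_pos by simp
  qed simp
  \<comment> \<open>A value below \<open>e\<close> is the least nonnegative one in its residue
    class, so it can only be \<open>lo\<close> of the first line of that class.\<close>
  have "{0..<e} \<subseteq> lo ` {0..<e}"
  proof
    fix r assume r: "r \<in> {0..<e}"
    then have "0 \<le> r" by simp
    then obtain t where t: "t \<ge> 0" "[r = \<psi> t] (mod e)" "lo t \<le> r" "r \<le> hi t" by (rule attained)
    define t0 where "t0 = t mod e"
    have t0: "0 \<le> t0" "t0 < e" unfolding t0_def using e_pos by auto
    have "t = t0 + e * int (nat (t div e))"
      unfolding t0_def using t(1) e_pos by (simp add: pos_imp_zdiv_nonneg_iff)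
    then have "lo t0 \<le> lo t" using lo_chain[OF t0(1)] by metis
    moreover have "[lo t0 = \<psi> t0] (mod e)" by (rule level_cong)
    moreover have "[\<psi> t0 = \<psi> t] (mod e)" unfolding psi_cong t0_def by (simp add: cong_def)
    ultimately have "lo t0 mod e = r mod e" "lo t0 \<le> r" using t by (auto simp: cong_def)
    then have "lo t0 = r" using lo_nonneg[OF t0(1)] r by simp
    then show "r \<in> lo ` {0..<e}" using t0 by auto
  qed
  moreover have "card (lo ` {0..<e}) \<le> card {0..<e}" by (rule card_image_le) simp
  ultimately have img: "{0..<e} = lo ` {0..<e}" by (intro card_seteq) auto
  have lo_lt: "lo t < e" if "0 \<le> t" "t < e" for t
  proof -
    have "lo t \<in> lo ` {0..<e}" using that by simp
    then show ?thesis unfolding img[symmetric] by simp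
  qed
  \<comment> \<open>\<open>w\<close> is what remains of \<open>lo\<close> without its quadratic part
    and its constant. By \<open>P e + D Q = 1\<close>, \<open>Q w t\<close> is \<open>t\<close> plus
    \<open>e\<close> times a remainder between \<open>0\<close> and \<open>Q - 1\<close>, which
    confines \<open>w\<close> to \<open>1, ..., e\<close> on the lines
    \<open>1, ..., e\<close>.\<close>
  define w where "w t = D * t + e * \<lceil>lam * of_int t\<rceil>" for t
  have two_psi: "2 * \<psi> t = s * t * (t - e) + 2 * D * t + 2 * F" for t
    unfolding psi_eq D by (simp add: algebra_simps power2_eq_square)
  have lo_w: "2 * lo t = s * t * (t - e) + 2 * F + 2 * w t" for t
    using two_psi[of t] unfolding lo_def w_def by (simp add: algebra_simps)
  have w_bounds: "t \<le> Q * w t" "Q * w t \<le> t + e * (Q - 1)" for t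
  proof -
    define c where "c = \<lceil>lam * of_int t\<rceil>"
    have "real_of_int (P * t) \<le> of_int (Q * c)" "real_of_int (Q * c) < of_int (P * t + Q)"
    proof -
      have "lam * of_int t \<le> of_int c" "of_int c < lam * of_int t + 1" unfolding c_def by linarith+
      then show "real_of_int (P * t) \<le> of_int (Q * c)" "real_of_int (Q * c) < of_int (P * t + Q)"
        unfolding lam using Q by (simp_all add: field_simps)
    qed
    then have c: "P * t \<le> Q * c" "Q * c \<le> P * t + (Q - 1)" by linarith+
    have "Q * w t = (D * Q) * t + e * (Q * c)" unfolding w_def c_def by (simp add: algebra_simps)
    also have "D * Q = 1 - P * e" using PD by simp
    finally have Qw: "Q * w t = t + e * (Q * c - P * t)" by (simp add: algebra_simps)
    show "t \<le> Q * w t" unfolding Qw using c(1) e_pos by simp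
    have "e * (Q * c - P * t) \<le> e * (Q - 1)" using c(2) e_pos by (intro mult_left_mono) auto
    then show "Q * w t \<le> t + e * (Q - 1)" unfolding Qw by simp
  qed
  have w_pos: "w t \<ge> 1" if "t \<ge> 1" for t
  proof -
    have "Q * w t > 0" using w_bounds(1)[of t] that by linarith
    then show ?thesis using Q by (simp add: zero_less_mult_iff)
  qed
  have w_le: "w t \<le> e" if "t \<le> e" for t
  proof -
    have "Q * w t \<le> Q * e" using w_bounds(2)[of t] that by (simp add: algebra_simps)
    then show ?thesis using Q by simp
  qed
  (* The excluded pairs (e, s) are those for which psi repeats the value psi 0 modulo e at a multiple of D,
     although D is a unit modulo e. *)
  have collide: "e dvd t" if "2 * (\<psi> t - F) = 2 * (e * k)" for t k
  proof -
    have "\<psi> 0 = F" using two_psi[of 0] by simp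
    then have "\<psi> t - \<psi> 0 = e * k" using that by simp
    then have "[\<psi> t = \<psi> 0] (mod e)" by (simp add: cong_iff_dvd_diff)
    then show ?thesis unfolding psi_cong by (simp add: cong_iff_dvd_diff)
  qed
  have parity: "even (s * e - s)"
  proof -
    have "2 * (\<psi> 1 - F) = s + d" using psi_eq[of 1] by simp
    then have "s * e - s = 2 * (D - (\<psi> 1 - F))" using D by simp
    then show ?thesis by simp
  qed
  have s1: "e = 1" if "s = 1"
  proof -
    \<comment> \<open>The multiple of \<open>D\<close> is chosen so that the terms in
      \<open>D^2\<close> cancel; in later exclusions they become divisible by \<open>e\<close>
      instead.\<close>
    have "2 * (\<psi> (- 2 * D) - F) = 2 * (e * D)" 
      using two_psi[of "- 2 * D"] that by (simp add: algebra_simps)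
    from collide[OF this] have "e dvd 2 * D" by simp
    moreover have "odd e" using parity that by simp
    ultimately have "e dvd D" by (simp add: coprime_dvd_mult_right_iff)
    then show ?thesis by (rule D_e)
  qed
  have s2: "e = 1" if "s = 2"
  proof -
    have "2 * (\<psi> (- D) - F) = 2 * (e * D)" 
      using two_psi[of "- D"] that by (simp add: algebra_simps)
    from collide[OF this] have "e dvd D" by simp
    then show ?thesis by (rule D_e)
  qed
  have F: "0 \<le> F" "F < e"
    using lo_nonneg[of 0] lo_lt[of 0] lo_w[of 0] e_pos by (simp_all add: w_def)
  \<comment> \<open>With \<open>F \<le> e - 1\<close> and \<open>w \<le> e\<close> these give
    \<open>s (e - 1) \<le> 4 e - 2\<close> and \<open>s (e - 2) \<le> 2 e - 1\<close>, the upper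
    bounds that leave finitely many pairs with \<open>e > 1\<close> and
    \<open>s > 2\<close>.\<close>
  have lo1: "s * (e - 1) \<le> 2 * F + 2 * w 1" using lo_w[of 1] lo_nonneg[of 1] by (simp add: algebra_simps)
  have lo2: "s * (e - 2) \<le> F + w 2" using lo_w[of 2] lo_nonneg[of 2] by (simp add: algebra_simps)
  have "F = e - 1 \<and> (e = 1 \<or> e = 2 \<and> s = 4 \<or> e = 3 \<and> s = 3)"
  proof -
    consider "e = 1" | "e = 2" | "e = 3" | "e \<ge> 4" using e_pos by linarith
    then show ?thesis
    proof cases
      case 1
      then show ?thesis using F by simp
    next
      case 2
      have oddD: "odd D" using D_e 2 by auto
      have "even s" using parity 2 by simp
      have "s \<le> 6" using lo1 w_le[of 1] F 2 by simp
      moreover have "s \<noteq> 2" using s2 2 by auto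
      moreover have "s \<noteq> 6"
      proof
        assume "s = 6"
        then have "2 * (\<psi> 1 - F) = 2 * (D - 3)" using two_psi[of 1] 2 by simp
        moreover have "even (D - 3)" using oddD by simp
        then obtain k where "D - 3 = 2 * k" by (rule evenE)
        ultimately have "2 * (\<psi> 1 - F) = 2 * (e * k)" using 2 by simp
        from collide[OF this] show False using 2 by simp
      qed
      ultimately have "s = 4" using \<open>even s\<close> s_pos by presburger
      have "w 1 \<noteq> 2"
      proof
        assume "w 1 = 2"
        then have "D = 2 - 2 * \<lceil>lam * of_int 1\<rceil>" unfolding w_def 2 by simp
        then show False using oddD by simp
      qed
      then have "w 1 = 1" using w_pos[of 1] w_le[of 1] 2 by simp
      then have "F = 1" using lo1 F \<open>s = 4\<close> 2 by simp
      then show ?thesis using \<open>s = 4\<close> 2 by simp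
    next
      case 3
      have D3: "\<not> 3 dvd D" using D_e 3 by auto
      have "s \<le> 5" using lo1 w_le[of 1] F 3 by simp
      moreover have "s \<noteq> 1" "s \<noteq> 2" using s1 s2 3 by auto
      moreover have "s \<noteq> 4"
      proof
        assume "s = 4"
        then have "2 * (\<psi> D - F) = 2 * (e * (D\<^sup>2 - 2 * D))"
          using two_psi[of D] 3 by (simp add: algebra_simps power2_eq_square)
        from collide[OF this] show False using 3 D3 by simp
      qed
      moreover have "s \<noteq> 5"
      proof
        assume "s = 5"
        then have eq: "2 * (\<psi> (- D) - F) = 3 * (D\<^sup>2 + 5 * D)"
          using two_psi[of "- D"] 3 by (simp add: algebra_simps power2_eq_square)
        define X where "X = \<psi> (- D) - F"
        have "3 dvd 2 * X" unfolding X_def eq by simp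
        then have "3 dvd X" by presburger
        then obtain k where "\<psi> (- D) - F = 3 * k" unfolding X_def by (rule dvdE)
        then have "2 * (\<psi> (- D) - F) = 2 * (e * k)" using 3 by simp
        from collide[OF this] show False using 3 D3 by simp
      qed
      ultimately have s3: "s = 3" using s_pos by linarith
      have w1: "w 1 = D + 3 * \<lceil>lam * of_int 1\<rceil>" and w2: "w 2 = 2 * D + 3 * \<lceil>lam * of_int 2\<rceil>" unfolding w_def 3 by simp_all
      have b: "1 \<le> w 1" "w 1 \<le> 3" "1 \<le> w 2" "w 2 \<le> 3" using w_pos w_le 3 by auto
      have "F \<ge> 3 - w 1" "F \<ge> 3 - w 2" using lo1 lo2 s3 3 by simp_all
      \<comment> \<open>Modulo \<open>3\<close> these are \<open>D\<close> and \<open>2 D\<close>.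
        As \<open>3\<close> does not divide \<open>D\<close>, one of them is congruent to
        \<open>1\<close>, and both lie between \<open>1\<close> and \<open>3\<close>.\<close>
      moreover have "w 1 = 1 \<or> w 2 = 1"
        using w1 w2 b D3 by presburger
      ultimately have "F = 2" using F 3 by auto
      then show ?thesis using s3 3 by simp
    next
      case 4
      have "s \<ge> 3" using s1 s2 s_pos 4 by fastforce
      have le: "s * (e - 2) \<le> 2 * e - 1" using lo2 w_le[of 2] F 4 by linarith
      have "3 * (e - 2) \<le> s * (e - 2)" using \<open>s \<ge> 3\<close> 4 by (intro mult_right_mono) auto
      then have "e = 4 \<or> e = 5" using le 4 by auto
      \<comment> \<open>For \<open>e = 4\<close> the bound gives \<open>s = 3\<close>, and then
        \<open>s (e - 1) = 9\<close> violates the parity condition.\<close>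
      then have "e = 5"
        using le \<open>s \<ge> 3\<close> parity by auto
      then have "s = 3" using le \<open>s \<ge> 3\<close> by simp
      then have eq: "2 * (\<psi> D - F) = 5 * (D\<^sup>2 - 3 * D)"
        using two_psi[of D] \<open>e = 5\<close> by (simp add: algebra_simps power2_eq_square)
      define X where "X = \<psi> D - F"
      have "5 dvd 2 * X" unfolding X_def eq by simp
      then have "5 dvd X" by presburger
      then obtain k where "\<psi> D - F = 5 * k" unfolding X_def by (rule dvdE)
      then have "2 * (\<psi> D - F) = 2 * (e * k)" using \<open>e = 5\<close> by simp
      from collide[OF this] D_e have False using \<open>e = 5\<close> by simp
      then show ?thesis ..
    qed
  qed
  then show ?thesis using mu D PD by blast
qed

end

section \<open>Unimodular coordinates adapted to the degenerate form\<close>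

context cone_packing
begin

text \<open>A form of discriminant zero is a multiple of the square of a primitive linear form. The
  multiple is an integer: from \<open>g b^2 = a C\<close> and coprimality, \<open>a\<close> divides
  \<open>g\<close>.\<close>

lemma rank_one_form:
  obtains s a b :: int where "s > 0" "a > 0" "coprime a b" "A = s * a\<^sup>2" "B = s * a * b" "C = s * b\<^sup>2"
proof -
  define g where "g = gcd A B"
  have g: "g > 0" unfolding g_def using A_pos by simp
  define a where "a = A div g"
  define b where "b = B div g"
  have A: "A = g * a" and B: "B = g * b" unfolding a_def b_def g_def by simp_all
  have cop: "coprime a b" unfolding a_def b_def g_def using A_pos by (intro div_gcd_coprime) auto
  have a: "a > 0" using A_pos g unfolding A by (simp add: zero_less_mult_iff)
  have "g * (g * b\<^sup>2) = g * (a * C)" using disc_zero unfolding A B by (simp add: power2_eq_square algebra_simps)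
  then have gb: "g * b\<^sup>2 = a * C" using g by simp
  then have "a dvd g * b\<^sup>2" by simp
  then have "a dvd g" using cop by (simp add: coprime_dvd_mult_left_iff)
  then obtain s where s: "g = a * s" by (rule dvdE)
  have "a * (s * b\<^sup>2) = a * C" using gb unfolding s by (simp add: algebra_simps)
  then have "C = s * b\<^sup>2" using a by simp
  moreover have "s > 0" using g a unfolding s by (simp add: zero_less_mult_iff)
  ultimately show ?thesis
    using that[of s a b] a cop A B unfolding s by (simp add: power2_eq_square algebra_simps)
qed

text \<open>In the coordinates \<open>t = a x + b y\<close>, \<open>z = g x + h y\<close> the edge
  through \<open>(1, 0)\<close> has slope \<open>lam = g / a\<close> and the edge through
  \<open>(\<beta>, 1)\<close> has slope \<open>mu\<close>. Their difference is
  \<open>1 / (a \<kappa>)\<close>, so \<open>mu = lam + s\<close> is an equation for \<beta>. The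
  number \<open>k\<close> is the coefficient \<open>e\<close> of \<open>z\<close>, taken with its
  sign.\<close>

lemma cone_classification:
  obtains s a b k :: int where "s > 0" "a > 0" "coprime a b" "\<beta> = of_int (1 - a * b * s) / of_int (s * a\<^sup>2)"
    "[- b = k] (mod a)" "k \<in> {1, -1} \<or> k \<in> {2, -2} \<and> s = 4 \<or> k \<in> {3, -3} \<and> s = 3"
    "\<And>x y. 2 * a * f x y = a * s * (a * x + b * y) * (a * x + b * y - k) + 2 * (a * x + b * y + k * y) + 2 * a * (\<bar>k\<bar> - 1)"
proof -
  obtain s a b where s: "s > 0" and a: "a > 0" and cop: "coprime a b"
    and ABC: "A = s * a\<^sup>2" "B = s * a * b" "C = s * b\<^sup>2" by (rule rank_one_form)
  obtain u v where "u * a + v * b = 1" using bezout_int[of a b] cop by auto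
  then obtain g h where gh: "a * h - b * g = 1"
    by (metis diff_minus_eq_add mult.commute mult_minus_right)
  \<comment> \<open>The value of \<open>t\<close> at \<open>(\<beta>, 1)\<close>. It is positive,
    since otherwise the cone would contain the ray on which the form vanishes.\<close>
  define \<kappa> where "\<kappa> = of_int b + \<beta> * of_int a"
  have \<kappa>: "\<kappa> > 0"
  proof (rule ccontr)
    assume "\<not> \<kappa> > 0"
    then have "\<beta> \<le> - of_int b / of_int a" unfolding \<kappa>_def using a by (simp add: field_simps)
    from form_pos_on_ray[OF this] show False unfolding ABC using a by (simp add: field_simps power2_eq_square)
  qed
  define lam where "lam = real_of_int g / of_int a"
  define mu where "mu = (of_int h + \<beta> * of_int g) / \<kappa>"
  have ra: "real_of_int a > 0" using a by simp
  have rgh: "real_of_int a * of_int h - of_int b * of_int g = 1"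
    using arg_cong[OF gh, of real_of_int] by simp
  have width: "mu - lam = 1 / (of_int a * \<kappa>)"
  proof -
    have "mu - lam = ((of_int h + \<beta> * of_int g) * of_int a - of_int g * \<kappa>) / (of_int a * \<kappa>)"
      unfolding mu_def lam_def using \<kappa> ra by (simp add: field_simps)
    also have "(of_int h + \<beta> * of_int g) * of_int a - of_int g * \<kappa> = 1"
      unfolding \<kappa>_def using rgh by (simp add: algebra_simps)
    finally show ?thesis .
  qed
  moreover have "1 / (of_int a * \<kappa>) > 0" using \<kappa> ra by simp
  ultimately have lam_mu: "lam < mu" by linarith
  define X where "X = {(t, z). lam * of_int t \<le> of_int z \<and> of_int z \<le> mu * of_int t}"
  define \<Phi> where "\<Phi> = (\<lambda>(t, z). (h * t - b * z, a * z - g * t))"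
  have \<Phi>_in: "\<Phi> (t, z) \<in> lattice_cone \<beta> \<longleftrightarrow> (t, z) \<in> X" for t z
  proof -
    have "0 \<le> a * z - g * t \<longleftrightarrow> real_of_int (g * t) \<le> of_int (a * z)" by linarith
    also have "\<dots> \<longleftrightarrow> lam * of_int t \<le> of_int z" unfolding lam_def using ra by (simp add: field_simps)
    finally have 1: "0 \<le> a * z - g * t \<longleftrightarrow> lam * of_int t \<le> of_int z" .
    have "\<beta> * of_int (a * z - g * t) \<le> of_int (h * t - b * z) \<longleftrightarrow> of_int z * \<kappa> \<le> (of_int h + \<beta> * of_int g) * of_int t"
      unfolding \<kappa>_def by (simp add: algebra_simps)
    also have "\<dots> \<longleftrightarrow> of_int z \<le> mu * of_int t" unfolding mu_def using \<kappa> by (simp add: field_simps)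
    finally show ?thesis using 1 unfolding \<Phi>_def X_def lattice_cone_def by simp
  qed
  have coords: "h * (a * x + b * y) - b * (g * x + h * y) = x" "a * (g * x + h * y) - g * (a * x + b * y) = y" for x y
  proof -
    have "h * (a * x + b * y) - b * (g * x + h * y) = (a * h - b * g) * x" by (simp add: algebra_simps)
    then show "h * (a * x + b * y) - b * (g * x + h * y) = x" using gh by simp
    have "a * (g * x + h * y) - g * (a * x + b * y) = (a * h - b * g) * y" by (simp add: algebra_simps)
    then show "a * (g * x + h * y) - g * (a * x + b * y) = y" using gh by simp
  qed
  have coords': "a * (h * t - b * z) + b * (a * z - g * t) = t" "g * (h * t - b * z) + h * (a * z - g * t) = z" for t z
  proof -
    have "a * (h * t - b * z) + b * (a * z - g * t) = (a * h - b * g) * t" by (simp add: algebra_simps)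
    then show "a * (h * t - b * z) + b * (a * z - g * t) = t" using gh by simp
    have "g * (h * t - b * z) + h * (a * z - g * t) = (a * h - b * g) * z" by (simp add: algebra_simps)
    then show "g * (h * t - b * z) + h * (a * z - g * t) = z" using gh by simp
  qed
  have bij\<Phi>: "bij_betw \<Phi> X (lattice_cone \<beta>)"
  proof (rule bij_betw_byWitness[where f' = "\<lambda>(x, y). (a * x + b * y, g * x + h * y)"])
    show "\<forall>p\<in>X. (case \<Phi> p of (x, y) \<Rightarrow> (a * x + b * y, g * x + h * y)) = p"
      unfolding \<Phi>_def by (auto simp: coords')
    show "\<forall>p\<in>lattice_cone \<beta>. \<Phi> (case p of (x, y) \<Rightarrow> (a * x + b * y, g * x + h * y)) = p"
      unfolding \<Phi>_def by (auto simp: coords)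
    show "\<Phi> ` X \<subseteq> lattice_cone \<beta>" using \<Phi>_in by auto
    show "(\<lambda>(x, y). (a * x + b * y, g * x + h * y)) ` lattice_cone \<beta> \<subseteq> X"
    proof clarify
      fix x y assume "(x, y) \<in> lattice_cone \<beta>"
      then have "\<Phi> (a * x + b * y, g * x + h * y) \<in> lattice_cone \<beta>" unfolding \<Phi>_def by (simp add: coords)
      then show "(a * x + b * y, g * x + h * y) \<in> X" by (simp only: \<Phi>_in)
    qed
  qed
  define \<phi> where "\<phi> t z = f (h * t - b * z) (a * z - g * t)" for t z
  define dd where "dd = D * h - E * g"
  define EE where "EE = E * a - D * b"
  have two_phi: "2 * \<phi> t z = s * t\<^sup>2 + dd * t + EE * z + F" for t z
  proof -
    have "2 * \<phi> t z = s * (a * (h * t - b * z) + b * (a * z - g * t))\<^sup>2 + D * (h * t - b * z) + E * (a * z - g * t) + F"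
      unfolding \<phi>_def f_eq ABC by (simp add: algebra_simps power2_eq_square)
    also have "\<dots> = s * t\<^sup>2 + dd * t + EE * z + F" unfolding coords' dd_def EE_def by (simp add: algebra_simps)
    finally show ?thesis .
  qed
  define F' where "F' = \<phi> 0 0"
  define e where "e = \<phi> 0 1 - \<phi> 0 0"
  define \<psi> where "\<psi> t = \<phi> t 0" for t
  have F': "F = 2 * F'" unfolding F'_def two_phi by simp
  have EE: "EE = 2 * e" unfolding e_def right_diff_distrib two_phi by simp
  have psi: "2 * \<psi> t = s * t\<^sup>2 + dd * t + 2 * F'" for t unfolding \<psi>_def two_phi F' by simp
  have phi: "\<phi> t z = \<psi> t + e * z" for t z
  proof -
    have "2 * \<phi> t z = 2 * (\<psi> t + e * z)" unfolding distrib_left psi unfolding two_phi EE F' by simp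
    then show ?thesis by simp
  qed
  have "bij_betw ((\<lambda>(x, y). f x y) \<circ> \<Phi>) X {0..}" using bij\<Phi> bij by (rule bij_betw_trans)
  moreover have "(\<lambda>(x, y). f x y) \<circ> \<Phi> = (\<lambda>(t, z). \<psi> t + e * z)"
    unfolding phi[symmetric] \<phi>_def \<Phi>_def by auto
  ultimately have bijX: "bij_betw (\<lambda>(t, z). \<psi> t + e * z) X {0..}" by simp
  have f_phi: "2 * f x y = s * (a * x + b * y)\<^sup>2 + dd * (a * x + b * y) + 2 * e * (g * x + h * y) + 2 * F'" for x y
    using two_phi[of "a * x + b * y" "g * x + h * y"] unfolding \<phi>_def coords EE F' by simp
  have beta: "\<beta> = of_int (1 - a * b * s) / of_int (s * a\<^sup>2)" if "mu = lam + of_int s"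
  proof -
    have "of_int s = 1 / (of_int a * \<kappa>)" using that width by simp
    then have "of_int s * (of_int a * \<kappa>) = 1" using ra \<kappa> by simp
    then have "\<beta> * of_int (s * a\<^sup>2) = of_int (1 - a * b * s)" unfolding \<kappa>_def by (simp add: algebra_simps power2_eq_square)
    then show ?thesis using s a by (simp add: field_simps)
  qed
  have "e \<noteq> 0"
  proof
    assume e: "e = 0"
    define t where "t = \<lceil>2 / (mu - lam)\<rceil>"
    have "2 / (mu - lam) \<le> of_int t" unfolding t_def by linarith
    then have "2 \<le> mu * of_int t - lam * of_int t" using lam_mu by (simp add: field_simps)
    then have "(t, \<lceil>lam * of_int t\<rceil>) \<in> X" "(t, \<lceil>lam * of_int t\<rceil> + 1) \<in> X" unfolding X_def by simp_all linarith+
    then show False using inj_onD[OF bij_betw_imp_inj_on[OF bijX], of "(t, \<lceil>lam * of_int t\<rceil>)" "(t, \<lceil>lam * of_int t\<rceil> + 1)"] e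
      by simp
  qed
  then consider "e > 0" | "e < 0" by linarith
  then show ?thesis
  proof cases
    case 1
    interpret L: level_packing lam mu s dd e F' \<psi>
      by standard (use lam_mu s 1 psi bijX[unfolded X_def] in auto)
    have "coprime g a"
    proof (rule coprimeI)
      fix c assume "c dvd g" "c dvd a"
      then have "c dvd a * h - b * g" by simp
      then show "is_unit c" unfolding gh .
    qed
    from L.classification[OF a lam_def this]
    obtain D' where mu: "mu = lam + of_int s" and D': "2 * D' = s * e + dd" "g * e + D' * a = 1" and Fe: "F' = e - 1"
      and es: "e = 1 \<or> e = 2 \<and> s = 4 \<or> e = 3 \<and> s = 3" by blast
    show ?thesis
    proof (rule that[of s a b e])
      \<comment> \<open>Both \<open>e\<close> and \<open>- b\<close> are inverse to \<open>g\<close>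
        modulo \<open>a\<close>, by \<open>g e + D' a = 1\<close> and
        \<open>a h - b g = 1\<close>.\<close>
      show "[- b = e] (mod a)"
      proof -
        have "e - (- b) = e * (a * h - b * g) + b * (g * e + D' * a)" unfolding gh D' by simp
        also have "\<dots> = a * (e * h + b * D')" by (simp add: algebra_simps)
        finally have "a dvd e - (- b)" by simp
        then show ?thesis by (simp add: cong_iff_dvd_diff dvd_diff_commute)
      qed
      show "e \<in> {1, -1} \<or> e \<in> {2, -2} \<and> s = 4 \<or> e \<in> {3, -3} \<and> s = 3" using es by auto
      show "2 * a * f x y = a * s * (a * x + b * y) * (a * x + b * y - e) + 2 * (a * x + b * y + e * y) + 2 * a * (\<bar>e\<bar> - 1)" for x y
      proof -
        define t where "t = a * x + b * y"
        define z where "z = g * x + h * y"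
        have y: "y = a * z - g * t" unfolding t_def z_def coords ..
        have dd: "dd = 2 * D' - s * e" using D' by simp
        have aD: "D' * a = 1 - g * e" using D' by simp
        have "2 * a * f x y = a * (s * t\<^sup>2 + dd * t + 2 * e * z + 2 * F')" using f_phi[of x y] unfolding t_def z_def by simp
        also have "\<dots> = a * s * t\<^sup>2 - a * s * e * t + 2 * (D' * a) * t + 2 * a * e * z + 2 * a * (e - 1)"
          unfolding dd Fe by (simp add: algebra_simps)
        also have "\<dots> = a * s * t * (t - e) + 2 * (t + e * (a * z - g * t)) + 2 * a * (e - 1)"
          unfolding aD by (simp add: algebra_simps power2_eq_square)
        finally show ?thesis using 1 unfolding y[symmetric] t_def[symmetric] by simp
      qed
    qed (use s a cop beta mu in auto)
  next
    case 2
    \<comment> \<open>Reflecting \<open>z\<close> exchanges the edges and turns the step into the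
      positive number \<open>- e\<close>.\<close>
    define X' where "X' = {(t, z). (- mu) * of_int t \<le> of_int z \<and> of_int z \<le> (- lam) * of_int t}"
    have "bij_betw (\<lambda>(t, z). (t, - z)) X' X"
      by (rule bij_betw_byWitness[where f' = "\<lambda>(t, z). (t, - z)"]) (auto simp: X'_def X_def)
    from bij_betw_trans[OF this bijX] have bijX': "bij_betw (\<lambda>(t, z). \<psi> t + (- e) * z) X' {0..}"
      by (rule bij_betw_cong[THEN iffD1, rotated]) auto
    interpret L: level_packing "- mu" "- lam" s dd "- e" F' \<psi>
      by standard (use lam_mu s 2 psi bijX'[unfolded X'_def] in auto)
    \<comment> \<open>After the reflection the lower slope is \<open>- mu\<close>, and
      \<open>classification\<close> wants it as a reduced fraction. \<open>spacing_eq\<close> is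
      available before any rationality is known and provides it, because \<open>lam\<close> is
      rational by construction.\<close>
    obtain T :: int where mu: "mu = lam + of_int s"
      by (rule L.spacing_eq) simp
    have "coprime (- (g + s * a)) a"
    proof (rule coprimeI)
      fix c assume "c dvd - (g + s * a)" "c dvd a"
      then have "c dvd g" by (metis dvd_add_left_iff dvd_minus_iff dvd_mult)
      then have "c dvd a * h - b * g" using \<open>c dvd a\<close> by simp
      then show "is_unit c" unfolding gh .
    qed
    moreover have "- mu = of_int (- (g + s * a)) / of_int a" unfolding mu lam_def using a by (simp add: field_simps)
    ultimately obtain D' where D': "2 * D' = s * (- e) + dd" "- (g + s * a) * (- e) + D' * a = 1" and Fe: "F' = (- e) - 1"
      and es: "- e = 1 \<or> - e = 2 \<and> s = 4 \<or> - e = 3 \<and> s = 3" using L.classification[OF a] by blast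
    show ?thesis
    proof (rule that[of s a b e])
      have aD: "D' * a = 1 - (g + s * a) * e" using D' by (simp add: algebra_simps)
      show "[- b = e] (mod a)"
      proof -
        have "e - (- b) = e * (a * h - b * g) + b * ((g + s * a) * e + D' * a)" unfolding gh aD by simp
        also have "\<dots> = a * (e * h + b * D' + b * s * e)" by (simp add: algebra_simps)
        finally have "a dvd e - (- b)" by simp
        then show ?thesis by (simp add: cong_iff_dvd_diff dvd_diff_commute)
      qed
      show "e \<in> {1, -1} \<or> e \<in> {2, -2} \<and> s = 4 \<or> e \<in> {3, -3} \<and> s = 3" using es by auto
      show "2 * a * f x y = a * s * (a * x + b * y) * (a * x + b * y - e) + 2 * (a * x + b * y + e * y) + 2 * a * (\<bar>e\<bar> - 1)" for x y
      proof -
        define t where "t = a * x + b * y"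
        define z where "z = g * x + h * y"
        have y: "y = a * z - g * t" unfolding t_def z_def coords ..
        have dd: "dd = 2 * D' + s * e" using D' by simp
        have "2 * a * f x y = a * (s * t\<^sup>2 + dd * t + 2 * e * z + 2 * F')" using f_phi[of x y] unfolding t_def z_def by simp
        also have "\<dots> = a * s * t\<^sup>2 + a * s * e * t + 2 * (D' * a) * t + 2 * a * e * z + 2 * a * (- e - 1)"
          unfolding dd Fe by (simp add: algebra_simps)
        also have "\<dots> = a * s * t * (t - e) + 2 * (t + e * (a * z - g * t)) + 2 * a * (- e - 1)"
          unfolding aD by (simp add: algebra_simps power2_eq_square)
        finally show ?thesis using 2 unfolding y[symmetric] t_def[symmetric] by simp
      qed
    qed (use s a cop beta mu in auto)
  qed
qed

end

section \<open>The packing polynomials\<close>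

lemma int_le_div_iff:
  fixes q z a :: int
  assumes "q > 0"
  shows "z \<le> a div q \<longleftrightarrow> q * z \<le> a"
proof
  assume "z \<le> a div q"
  then have "q * z \<le> q * (a div q)" using assms by simp
  also have "\<dots> \<le> a" using pos_mod_sign[OF assms, of a] mult_div_mod_eq[of q a] by linarith
  finally show "q * z \<le> a" .
next
  assume "q * z \<le> a"
  then show "z \<le> a div q" using zdiv_mono1[of "q * z" a q] assms by simp
qed

lemma int_between_of_mult:
  fixes q v b :: int
  assumes "q > 0" "- q < q * v" "q * v < q * b"
  shows "0 \<le> v" "v < b"
proof -
  have "q * (- 1) < q * v" using assms by simp
  then have "- 1 < v" using assms(1) mult_less_cancel_left_pos by blast
  then show "0 \<le> v" by simp
  show "v < b" using assms by simp
qed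

text \<open>\<open>P e + D Q = 1\<close> yields \<open>lo (t + e) = hi t + e\<close>, so the
  progressions on the lines \<open>t0\<close>, \<open>t0 + e\<close>, ... join without gap or
  overlap. In the three cases \<open>lo\<close> permutes \<open>0, ..., e - 1\<close>, so that every
  residue class starts at its least nonnegative member. Denominators are cleared, which turns the
  ceilings and floors of the edges into integer divisions.\<close>

lemma level_polynomial_bij:
  fixes P Q s e D :: int and \<psi> :: "int \<Rightarrow> int"
  assumes Q: "Q > 0" and s: "s > 0" and PD: "P * e + D * Q = 1"
    and es: "e = 1 \<or> e = 2 \<and> s = 4 \<or> e = 3 \<and> s = 3"
    and psi: "\<And>t. 2 * \<psi> t = s * t * (t - e) + 2 * D * t + 2 * (e - 1)"
  shows "bij_betw (\<lambda>(t, z). \<psi> t + e * z) {(t, z). P * t \<le> Q * z \<and> Q * z \<le> (P + s * Q) * t} {0..}"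
proof -
  have e: "e > 0" using es by auto
  define c where "c t = - ((- (P * t)) div Q)" for t
  define fl where "fl t = (P * t) div Q" for t
  have c_iff: "P * t \<le> Q * z \<longleftrightarrow> c t \<le> z" for t z
  proof -
    have "P * t \<le> Q * z \<longleftrightarrow> Q * - z \<le> - (P * t)" by simp
    also have "\<dots> \<longleftrightarrow> - z \<le> (- (P * t)) div Q" using Q by (simp only: int_le_div_iff)
    finally show ?thesis unfolding c_def by linarith
  qed
  have fl_iff: "Q * z \<le> (P + s * Q) * t \<longleftrightarrow> z \<le> fl t + s * t" for t z
  proof -
    have "Q * z \<le> (P + s * Q) * t \<longleftrightarrow> Q * (z - s * t) \<le> P * t" by (simp add: algebra_simps)
    also have "\<dots> \<longleftrightarrow> z - s * t \<le> fl t" unfolding fl_def using Q by (simp only: int_le_div_iff)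
    finally show ?thesis by linarith
  qed
  have c_le: "P * t \<le> Q * c t" "Q * c t \<le> P * t + (Q - 1)" for t
  proof -
    show "P * t \<le> Q * c t" using c_iff by blast
    have "\<not> P * t \<le> Q * (c t - 1)" unfolding c_iff by simp
    then show "Q * c t \<le> P * t + (Q - 1)" by (simp add: algebra_simps)
  qed
  \<comment> \<open>Since \<open>P (t + e) = P t + 1 - D Q\<close>, a shift by \<open>e\<close>
    moves \<open>P t\<close> by exactly the unit that separates strict from weak inequalities
    between integers.\<close>
  have c_shift: "c (t + e) = fl t + 1 - D" for t
  proof (rule antisym)
    have "\<not> fl t + 1 \<le> (P * t) div Q" unfolding fl_def by simp
    then have "P * t < Q * (fl t + 1)" unfolding int_le_div_iff[OF Q] by simp
    then have "P * (t + e) \<le> Q * (fl t + 1 - D)" using PD by (simp add: algebra_simps)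
    then show "c (t + e) \<le> fl t + 1 - D" unfolding c_iff .
    have "Q * fl t \<le> P * t" unfolding int_le_div_iff[OF Q, symmetric] fl_def by simp
    then have "\<not> P * (t + e) \<le> Q * (fl t - D)" using PD by (simp add: algebra_simps)
    then show "fl t + 1 - D \<le> c (t + e)" unfolding c_iff by linarith
  qed
  define lo where "lo t = \<psi> t + e * c t" for t
  define hi where "hi t = \<psi> t + e * (fl t + s * t)" for t
  have psi_e: "\<psi> (t + e) = \<psi> t + e * (s * t + D)" for t
  proof -
    have "2 * \<psi> (t + e) = 2 * (\<psi> t + e * (s * t + D))" unfolding distrib_left psi by (simp add: algebra_simps)
    then show ?thesis by simp
  qed
  have nxt: "lo (t + e) = hi t + e" for t
    unfolding lo_def hi_def psi_e c_shift by (simp add: algebra_simps)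
  have lohi: "lo t \<le> hi t" if "t \<ge> 0" for t
  proof -
    have "c t \<le> fl t + s * t"
    proof (cases "t = 0")
      case True
      then show ?thesis unfolding c_def fl_def by simp
    next
      case False
      then have "1 * 1 \<le> s * t" using s that by (intro mult_mono) auto
      moreover have "\<not> Q * (fl t + 1) \<le> P * t"
        using fl_iff[of "fl t + 1 + s * t" t] by (simp add: algebra_simps)
      then have "c t \<le> fl t + 1" using c_iff[of t "fl t + 1"] by linarith
      ultimately show ?thesis by linarith
    qed
    then show ?thesis unfolding lo_def hi_def using e by simp
  qed
  have chain: "lo t + e * int n \<le> lo (t + e * int n)" if "t \<ge> 0" for t n
  proof (induction n)
    case (Suc n)
    have "t + e * int (Suc n) = (t + e * int n) + e" by (simp add: algebra_simps)
    then have "lo (t + e * int (Suc n)) = hi (t + e * int n) + e" by (simp only: nxt)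
    moreover have "lo (t + e * int n) \<le> hi (t + e * int n)" using that e by (intro lohi) auto
    ultimately show ?case using Suc by (simp add: algebra_simps)
  qed simp
  \<comment> \<open>For \<open>e = 2\<close>, \<open>Q lo 1\<close> lies strictly between
    \<open>- Q\<close> and \<open>Q\<close>, hence \<open>lo 1 = 0\<close>. For
    \<open>e = 3\<close>, \<open>lo 1\<close> and \<open>lo 2\<close> both lie in
    \<open>{0, 1}\<close>, and they differ because \<open>3\<close> does not divide
    \<open>D\<close>.\<close>
  have start: "lo ` {0..<e} = {0..<e} \<and> inj_on lo {0..<e}"
  proof -
    have lo0: "lo 0 = e - 1" using psi[of 0] unfolding lo_def c_def by simp
    have DQ: "D * Q = 1 - P * e" using PD by simp
    from es show ?thesis
    proof (elim disjE conjE)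
      assume "e = 1"
      then have "{0..<e} = {0}" by auto
      then show ?thesis using lo0 \<open>e = 1\<close> by simp
    next
      assume e2: "e = 2" "s = 4"
      have l1: "lo 1 = D - 1 + 2 * c 1" using psi[of 1] e2 unfolding lo_def by simp
      have "Q * lo 1 = D * Q - Q + 2 * (Q * c 1)" unfolding l1 by (simp add: algebra_simps)
      then have "- Q < Q * lo 1" "Q * lo 1 < Q * 1" using c_le[of 1] DQ e2 by simp_all
      then have "0 \<le> lo 1" "lo 1 < 1" by (rule int_between_of_mult[OF Q])+
      then have "lo 1 = 0" by simp
      moreover have "lo 0 = 1" using lo0 e2 by simp
      moreover have "{0..<e} = {0, 1}" using e2 by auto
      ultimately show ?thesis by (simp add: insert_commute)
    next
      assume e3: "e = 3" "s = 3"
      have l1: "lo 1 = D - 1 + 3 * c 1" using psi[of 1] e3 unfolding lo_def by simp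
      have "Q * lo 1 = D * Q - Q + 3 * (Q * c 1)" unfolding l1 by (simp add: algebra_simps)
      then have "- Q < Q * lo 1" "Q * lo 1 < Q * 2" using c_le[of 1] DQ e3 Q by simp_all
      then have b1: "0 \<le> lo 1" "lo 1 < 2" by (rule int_between_of_mult[OF Q])+
      have l2: "lo 2 = 2 * D - 1 + 3 * c 2" using psi[of 2] e3 unfolding lo_def by simp
      have "Q * lo 2 = 2 * (D * Q) - Q + 3 * (Q * c 2)" unfolding l2 by (simp add: algebra_simps)
      then have "- Q < Q * lo 2" "Q * lo 2 < Q * 2" using c_le[of 2] DQ e3 Q by simp_all
      then have b2: "0 \<le> lo 2" "lo 2 < 2" by (rule int_between_of_mult[OF Q])+
      have "\<not> 3 dvd D"
      proof
        assume "3 dvd D"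
        then have "3 dvd P * e + D * Q" using e3 by simp
        then show False unfolding PD by simp
      qed
      moreover have "D = 3 * (c 1 - c 2)" if "lo 1 = lo 2" using l1 l2 that by simp
      ultimately have "lo 1 \<noteq> lo 2" by auto
      then have "lo 1 = 0 \<and> lo 2 = 1 \<or> lo 1 = 1 \<and> lo 2 = 0" using b1 b2 by linarith
      moreover have "lo 0 = 2" using lo0 e3 by simp
      moreover have "{0..<e} = {0, 1, 2}" using e3 by auto
      ultimately show ?thesis by (elim disjE) (simp_all add: insert_commute)
    qed
  qed
  have cong_lo: "[lo t = \<psi> t] (mod e)" for t unfolding lo_def by (simp add: cong_iff_dvd_diff)
  have psi_mod: "[\<psi> (t mod e) = \<psi> t] (mod e)" for t
  proof -
    have per: "[\<psi> (t + e * int n) = \<psi> t] (mod e)" for t n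
    proof (induction n)
      case (Suc n)
      have "t + e * int (Suc n) = (t + e * int n) + e" by (simp add: algebra_simps)
      then have "\<psi> (t + e * int (Suc n)) = \<psi> (t + e * int n) + e * (s * (t + e * int n) + D)" by (simp only: psi_e)
      then show ?case using Suc by (simp add: cong_def)
    qed (simp add: cong_def)
    show ?thesis
    proof (cases "t div e \<ge> 0")
      case True
      then have "t mod e + e * int (nat (t div e)) = t" by simp
      then show ?thesis using per[of "t mod e" "nat (t div e)"] by (simp add: cong_def)
    next
      case False
      then have "t + e * int (nat (- (t div e))) = t mod e" by (simp add: minus_mult_div_eq_mod)
      then show ?thesis using per[of t "nat (- (t div e))"] by simp
    qed
  qed
  have t_nonneg: "t \<ge> 0" if "c t \<le> z" "z \<le> fl t + s * t" for t z
  proof -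
    have "P * t \<le> (P + s * Q) * t" using that unfolding c_iff[symmetric] fl_iff[symmetric] by linarith
    then have "0 \<le> (s * Q) * t" by (simp add: algebra_simps)
    moreover have "0 < s * Q" using s Q by simp
    ultimately show ?thesis by (metis mult_le_cancel_left_pos mult_zero_right)
  qed
  show ?thesis
    unfolding bij_betw_def
  proof (intro conjI equalityI subsetI)
    show "inj_on (\<lambda>(t, z). \<psi> t + e * z) {(t, z). P * t \<le> Q * z \<and> Q * z \<le> (P + s * Q) * t}"
    proof (rule inj_onI, unfold c_iff fl_iff, clarsimp)
      \<comment> \<open>Lines with a common value lie in the same residue class. The later one is
        then at least \<open>e\<close> further on, where \<open>lo\<close> is already above
        \<open>hi t\<close>.\<close>
      have lt: False if tz: "c t \<le> z" "z \<le> fl t + s * t" and tz': "c t' \<le> z'" "z' \<le> fl t' + s * t'"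
          and eq: "\<psi> t + e * z = \<psi> t' + e * z'" and less: "t < t'" for t z t' z'
      proof -
        have t0: "t \<ge> 0" using t_nonneg[OF tz] .
        have "[\<psi> t = \<psi> t'] (mod e)"
        proof -
          have "\<psi> t - \<psi> t' = e * (z' - z)" using eq by (simp add: algebra_simps)
          then show ?thesis by (simp add: cong_iff_dvd_diff)
        qed
        then have "lo (t mod e) mod e = lo (t' mod e) mod e"
          using cong_lo[of "t mod e"] cong_lo[of "t' mod e"] psi_mod[of t] psi_mod[of t'] by (simp add: cong_def)
        moreover have "t mod e \<in> {0..<e}" "t' mod e \<in> {0..<e}" using e by auto
        moreover from this have "lo (t mod e) \<in> {0..<e}" "lo (t' mod e) \<in> {0..<e}" using start by blast+
        ultimately have "lo (t mod e) = lo (t' mod e)" by simp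
        then have "t mod e = t' mod e"
          by (rule inj_onD[OF conjunct2[OF start]]) (use e in auto)
        then obtain n where n: "t' = t + e * n" by (metis mod_eqE)
        then have "n \<ge> 1" using less e by (auto simp: zero_less_mult_iff)
        then have "t' = (t + e) + e * int (nat (n - 1))" using n by (simp add: algebra_simps)
        then have "lo (t + e) + e * int (nat (n - 1)) \<le> lo t'" using chain[of "t + e" "nat (n - 1)"] t0 e by simp
        moreover have "0 \<le> e * int (nat (n - 1))" using e by simp
        ultimately have "lo (t + e) \<le> lo t'" by linarith
        then have "hi t < lo t'" using nxt[of t] e by simp
        moreover have "\<psi> t + e * z \<le> hi t" unfolding hi_def using tz e by simp
        moreover have "lo t' \<le> \<psi> t' + e * z'" unfolding lo_def using tz' e by simp
        ultimately show False using eq by simp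
      qed
      fix t z t' z' assume *: "c t \<le> z" "z \<le> fl t + s * t" "c t' \<le> z'" "z' \<le> fl t' + s * t'" "\<psi> t + e * z = \<psi> t' + e * z'"
      have "\<not> t < t'" using lt[OF *] by blast
      moreover have "\<not> t' < t" using lt[OF *(3,4,1,2) *(5)[symmetric]] by blast
      ultimately have "t = t'" by simp
      then show "t = t' \<and> z = z'" using * e by simp
    qed
  next
    fix v :: int assume "v \<in> {0..}"
    then have v: "v \<ge> 0" by simp
    have "v mod e \<in> lo ` {0..<e}" using start e by simp
    then obtain t0 where t0: "0 \<le> t0" "t0 < e" "lo t0 = v mod e" by auto
    have ex: "v < lo (t0 + e * (int (nat v) + 1))"
    proof -
      have "lo t0 + e * int (nat v + 1) \<le> lo (t0 + e * int (nat v + 1))" using t0 by (intro chain)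
      moreover have "1 * (v + 1) \<le> e * (v + 1)" using v e by (intro mult_right_mono) auto
      moreover have "lo t0 \<ge> 0" using t0 e by simp
      ultimately show ?thesis using v by (simp add: algebra_simps)
    qed
    \<comment> \<open>This selects the line of the class just before the first one whose least value
      exceeds \<open>v\<close>.\<close>
    define n where "n = (LEAST n. v < lo (t0 + e * (int n + 1)))"
    have n1: "v < lo (t0 + e * (int n + 1))" unfolding n_def by (rule LeastI[of _ "nat v"]) (rule ex)
    define t where "t = t0 + e * int n"
    have t: "t \<ge> 0" unfolding t_def using t0 e by simp
    have "lo t \<le> v"
    proof (cases n)
      case 0
      then show ?thesis unfolding t_def using t0 v e by (simp add: zmod_le_nonneg_dividend)
    next
      case (Suc k)
      then have "\<not> v < lo (t0 + e * (int k + 1))" using not_less_Least[of k "\<lambda>n. v < lo (t0 + e * (int n + 1))"] unfolding n_def by simp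
      then show ?thesis unfolding t_def Suc by (simp add: add.commute)
    qed
    have "t0 + e * (int n + 1) = t + e" unfolding t_def by (simp add: algebra_simps)
    then have "v < hi t + e" using n1 nxt[of t] by simp
    have "[v = \<psi> t] (mod e)"
    proof -
      have "t mod e = t0" unfolding t_def using t0 by simp
      then show ?thesis using psi_mod[of t] cong_lo[of t0] t0 by (simp add: cong_def)
    qed
    then obtain z where z: "v = \<psi> t + e * z" by (metis cong_iff_lin cong_sym)
    have "e * c t \<le> e * z" using \<open>lo t \<le> v\<close> unfolding lo_def z by simp
    then have "c t \<le> z" using e by simp
    moreover have "e * z < e * (fl t + s * t + 1)" using \<open>v < hi t + e\<close> unfolding hi_def z by (simp add: algebra_simps)
    then have "z \<le> fl t + s * t" using e by simp
    ultimately show "v \<in> (\<lambda>(t, z). \<psi> t + e * z) ` {(t, z). P * t \<le> Q * z \<and> Q * z \<le> (P + s * Q) * t}"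
      unfolding c_iff fl_iff by (intro image_eqI[of _ _ "(t, z)"]) (use z in auto)
  next
    fix v assume "v \<in> (\<lambda>(t, z). \<psi> t + e * z) ` {(t, z). P * t \<le> Q * z \<and> Q * z \<le> (P + s * Q) * t}"
    then obtain t z where tz: "c t \<le> z" "z \<le> fl t + s * t" "v = \<psi> t + e * z" unfolding c_iff fl_iff by auto
    have t: "t \<ge> 0" using t_nonneg[OF tz(1,2)] .
    have "t mod e \<in> {0..<e}" using e by simp
    then have "lo (t mod e) \<in> {0..<e}" using start by blast
    then have "lo (t mod e) \<ge> 0" by simp
    moreover have "t = t mod e + e * int (nat (t div e))" using t e by (simp add: pos_imp_zdiv_nonneg_iff)
    then have "lo (t mod e) + e * int (nat (t div e)) \<le> lo t" using chain[of "t mod e" "nat (t div e)"] e by simp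
    moreover have "0 \<le> e * int (nat (t div e))" using e by simp
    moreover have "lo t \<le> v" unfolding lo_def tz(3) using tz(1) e by simp
    ultimately show "v \<in> {0..}" by simp
  qed
qed

text \<open>\<open>k\<close> is coprime to \<open>a\<close> because it is congruent to
  \<open>- b\<close>, so Bezout's identity provides the slope \<open>P / a\<close> and the constant
  \<open>D\<close> for the step \<open>e = |k|\<close>. The map to \<open>(t, z)\<close> is chosen
  such that \<open>y\<close> becomes \<open>a z - P t\<close> for positive \<open>k\<close> and
  \<open>(P + s a) t - a z\<close> for negative \<open>k\<close>; either way the cone, described by
  \<open>0 \<le> y \<le> s a t\<close>, becomes \<open>X\<close>.\<close>

lemma packing_cone_bij:
  fixes s a b k :: int
  assumes s: "s > 0" and a: "a > 0" and cop: "coprime a b" and bk: "[- b = k] (mod a)"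
    and ks: "k \<in> {1, -1} \<or> k \<in> {2, -2} \<and> s = 4 \<or> k \<in> {3, -3} \<and> s = 3"
    and beta: "\<beta> = of_int (1 - a * b * s) / of_int (s * a\<^sup>2)"
  obtains f :: "int \<Rightarrow> int \<Rightarrow> int" where "bij_betw (\<lambda>(x, y). f x y) (lattice_cone \<beta>) {0..}"
    "\<And>x y. 2 * a * f x y = a * s * (a * x + b * y) * (a * x + b * y - k) + 2 * (a * x + b * y + k * y) + 2 * a * (\<bar>k\<bar> - 1)"
proof -
  define e where "e = \<bar>k\<bar>"
  have es: "e = 1 \<or> e = 2 \<and> s = 4 \<or> e = 3 \<and> s = 3" unfolding e_def using ks by auto
  obtain i where i: "k = - b + a * i" using bk by (auto simp: cong_iff_lin)
  have "coprime e a"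
  proof -
    have "coprime k a"
    proof (rule coprimeI)
      fix c assume "c dvd k" "c dvd a"
      then have "c dvd k - a * i" by simp
      then have "c dvd b" unfolding i by simp
      then show "is_unit c" using cop \<open>c dvd a\<close> by (metis coprime_common_divisor)
    qed
    then show ?thesis unfolding e_def by simp
  qed
  then obtain P D where PD: "P * e + D * a = 1" using bezout_int[of e a] by auto
  define \<psi> where "\<psi> t = s * t * (t - e) div 2 + D * t + (e - 1)" for t
  have psi: "2 * \<psi> t = s * t * (t - e) + 2 * D * t + 2 * (e - 1)" for t
  proof -
    \<comment> \<open>Either \<open>s\<close> is even, or \<open>e\<close> is odd and
      \<open>t (t - e)\<close> is even.\<close>
    have "even (s * t * (t - e))" using es by (elim disjE) auto
    then show ?thesis unfolding \<psi>_def by simp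
  qed
  define X where "X = {(t, z). P * t \<le> a * z \<and> a * z \<le> (P + s * a) * t}"
  have bijX: "bij_betw (\<lambda>(t, z). \<psi> t + e * z) X {0..}"
    unfolding X_def using level_polynomial_bij[OF a s PD es psi] .
  have cone: "(x, y) \<in> lattice_cone \<beta> \<longleftrightarrow> 0 \<le> y \<and> y \<le> s * a * (a * x + b * y)" for x y
  proof -
    have pos: "real_of_int (s * a\<^sup>2) > 0" using s a by simp
    have "\<beta> * of_int y \<le> of_int x \<longleftrightarrow> of_int (1 - a * b * s) * of_int y \<le> real_of_int x * of_int (s * a\<^sup>2)"
      unfolding beta using pos by (simp only: times_divide_eq_left pos_divide_le_eq)
    also have "\<dots> \<longleftrightarrow> real_of_int ((1 - a * b * s) * y) \<le> of_int (x * (s * a\<^sup>2))" by (simp only: of_int_mult)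
    also have "\<dots> \<longleftrightarrow> (1 - a * b * s) * y \<le> x * (s * a\<^sup>2)" by (simp only: of_int_le_iff)
    also have "\<dots> \<longleftrightarrow> y \<le> s * a * (a * x + b * y)" by (simp add: algebra_simps power2_eq_square)
    finally show ?thesis unfolding lattice_cone_def by simp
  qed
  have aD: "a * D = 1 - P * e" using PD by (simp add: algebra_simps)
  show ?thesis
  proof (cases "k > 0")
    case True
    then have ek: "k = e" unfolding e_def by simp
    \<comment> \<open>As \<open>a i - b = e\<close>, this is the \<open>h\<close> for which the
      determinant \<open>a h - b P\<close> reduces to \<open>P e + D a = 1\<close>.\<close>
    define h where "h = D + i * P"
    have ah: "a * h - b * P = 1"
    proof -
      have "a * h - b * P = a * D + P * (a * i - b)" unfolding h_def by (simp add: algebra_simps)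
      also have "a * i - b = e" using i ek by simp
      finally show ?thesis using aD by simp
    qed
    define G where "G = (\<lambda>(x, y). (a * x + b * y, P * x + h * y))"
    have y: "a * (P * x + h * y) - P * (a * x + b * y) = y" for x y
    proof -
      have "a * (P * x + h * y) - P * (a * x + b * y) = (a * h - b * P) * y" by (simp add: algebra_simps)
      then show ?thesis unfolding ah by simp
    qed
    have x: "h * (a * x + b * y) - b * (P * x + h * y) = x" for x y
    proof -
      have "h * (a * x + b * y) - b * (P * x + h * y) = (a * h - b * P) * x" by (simp add: algebra_simps)
      then show ?thesis unfolding ah by simp
    qed
    have GX: "G (x, y) \<in> X \<longleftrightarrow> (x, y) \<in> lattice_cone \<beta>" for x y
    proof -
      have "G (x, y) \<in> X \<longleftrightarrow> 0 \<le> a * (P * x + h * y) - P * (a * x + b * y) \<and>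
        a * (P * x + h * y) - P * (a * x + b * y) \<le> s * a * (a * x + b * y)"
        unfolding G_def X_def by (simp add: algebra_simps)
      then show ?thesis unfolding y cone .
    qed
    define G' where "G' = (\<lambda>(t, z). (h * t - b * z, a * z - P * t))"
    have GG': "G (G' (t, z)) = (t, z)" for t z
    proof -
      have "a * (h * t - b * z) + b * (a * z - P * t) = (a * h - b * P) * t" by (simp add: algebra_simps)
      moreover have "P * (h * t - b * z) + h * (a * z - P * t) = (a * h - b * P) * z" by (simp add: algebra_simps)
      ultimately show ?thesis unfolding G_def G'_def ah by simp
    qed
    have G'G: "G' (G (x, y)) = (x, y)" for x y unfolding G_def G'_def by (simp add: x y)
    have "bij_betw G (lattice_cone \<beta>) X"
    proof (rule bij_betw_byWitness[where f' = G'])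
      show "\<forall>p\<in>lattice_cone \<beta>. G' (G p) = p" using G'G by auto
      show "\<forall>p\<in>X. G (G' p) = p" using GG' by auto
      show "G ` lattice_cone \<beta> \<subseteq> X" using GX by auto
      show "G' ` X \<subseteq> lattice_cone \<beta>"
      proof (rule image_subsetI)
        fix p assume "p \<in> X"
        moreover obtain t z where p: "p = (t, z)" by force
        moreover obtain x y where xy: "G' p = (x, y)" by force
        ultimately have "G (x, y) \<in> X" using GG'[of t z] by simp
        then show "G' p \<in> lattice_cone \<beta>" unfolding xy by (simp only: GX)
      qed
    qed
    from bij_betw_trans[OF this bijX]
    have "bij_betw (\<lambda>(x, y). \<psi> (a * x + b * y) + e * (P * x + h * y)) (lattice_cone \<beta>) {0..}"
      by (rule bij_betw_cong[THEN iffD1, rotated]) (auto simp: G_def)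
    moreover have "2 * a * (\<psi> (a * x + b * y) + e * (P * x + h * y)) = a * s * (a * x + b * y) * (a * x + b * y - k) + 2 * (a * x + b * y + k * y) + 2 * a * (\<bar>k\<bar> - 1)" for x y
    proof -
      define t where "t = a * x + b * y"
      define z where "z = P * x + h * y"
      have "2 * a * (\<psi> t + e * z) = a * (2 * \<psi> t) + 2 * a * e * z" by (simp add: algebra_simps)
      also have "\<dots> = a * s * t * (t - e) + 2 * (a * D) * t + 2 * a * e * z + 2 * a * (e - 1)"
        unfolding psi by (simp add: algebra_simps)
      also have "\<dots> = a * s * t * (t - e) + 2 * (t + e * (a * z - P * t)) + 2 * a * (e - 1)"
        unfolding aD by (simp add: algebra_simps)
      also have "a * z - P * t = y" unfolding z_def t_def by (rule y)
      finally show ?thesis unfolding t_def z_def ek using es by auto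
    qed
    ultimately show ?thesis by (rule that)
  next
    case False
    then have ek: "k = - e" unfolding e_def by simp
    \<comment> \<open>\<open>R / a\<close> is the upper slope \<open>P / a + s\<close>. The map now
      reverses orientation, so the edge \<open>y = 0\<close> goes to the upper edge, and
      \<open>h\<close> is chosen to make the determinant \<open>-1\<close>.\<close>
    define R where "R = P + s * a"
    define h where "h = e * s - D + i * R"
    have ah: "b * R - a * h = 1"
    proof -
      have "b * R - a * h = (b - a * i) * R - a * e * s + a * D" unfolding h_def by (simp add: algebra_simps)
      also have "b - a * i = e" using i ek by simp
      finally show ?thesis using aD unfolding R_def by (simp add: algebra_simps)
    qed
    define G where "G = (\<lambda>(x, y). (a * x + b * y, R * x + h * y))"
    have y: "R * (a * x + b * y) - a * (R * x + h * y) = y" for x y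
    proof -
      have "R * (a * x + b * y) - a * (R * x + h * y) = (b * R - a * h) * y" by (simp add: algebra_simps)
      then show ?thesis unfolding ah by simp
    qed
    have x: "b * (R * x + h * y) - h * (a * x + b * y) = x" for x y
    proof -
      have "b * (R * x + h * y) - h * (a * x + b * y) = (b * R - a * h) * x" by (simp add: algebra_simps)
      then show ?thesis unfolding ah by simp
    qed
    have GX: "G (x, y) \<in> X \<longleftrightarrow> (x, y) \<in> lattice_cone \<beta>" for x y
    proof -
      have "G (x, y) \<in> X \<longleftrightarrow> 0 \<le> R * (a * x + b * y) - a * (R * x + h * y) \<and>
        R * (a * x + b * y) - a * (R * x + h * y) \<le> s * a * (a * x + b * y)"
        unfolding G_def X_def R_def by (auto simp: algebra_simps)
      then show ?thesis unfolding y cone .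
    qed
    define G' where "G' = (\<lambda>(t, z). (b * z - h * t, R * t - a * z))"
    have GG': "G (G' (t, z)) = (t, z)" for t z
    proof -
      have "a * (b * z - h * t) + b * (R * t - a * z) = (b * R - a * h) * t" by (simp add: algebra_simps)
      moreover have "R * (b * z - h * t) + h * (R * t - a * z) = (b * R - a * h) * z" by (simp add: algebra_simps)
      ultimately show ?thesis unfolding G_def G'_def ah by simp
    qed
    have G'G: "G' (G (x, y)) = (x, y)" for x y unfolding G_def G'_def by (simp add: x y)
    have "bij_betw G (lattice_cone \<beta>) X"
    proof (rule bij_betw_byWitness[where f' = G'])
      show "\<forall>p\<in>lattice_cone \<beta>. G' (G p) = p" using G'G by auto
      show "\<forall>p\<in>X. G (G' p) = p" using GG' by auto
      show "G ` lattice_cone \<beta> \<subseteq> X" using GX by auto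
      show "G' ` X \<subseteq> lattice_cone \<beta>"
      proof (rule image_subsetI)
        fix p assume "p \<in> X"
        moreover obtain t z where p: "p = (t, z)" by force
        moreover obtain x y where xy: "G' p = (x, y)" by force
        ultimately have "G (x, y) \<in> X" using GG'[of t z] by simp
        then show "G' p \<in> lattice_cone \<beta>" unfolding xy by (simp only: GX)
      qed
    qed
    from bij_betw_trans[OF this bijX]
    have "bij_betw (\<lambda>(x, y). \<psi> (a * x + b * y) + e * (R * x + h * y)) (lattice_cone \<beta>) {0..}"
      by (rule bij_betw_cong[THEN iffD1, rotated]) (auto simp: G_def)
    moreover have "2 * a * (\<psi> (a * x + b * y) + e * (R * x + h * y)) = a * s * (a * x + b * y) * (a * x + b * y - k) + 2 * (a * x + b * y + k * y) + 2 * a * (\<bar>k\<bar> - 1)" for x y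
    proof -
      define t where "t = a * x + b * y"
      define z where "z = R * x + h * y"
      have "2 * a * (\<psi> t + e * z) = a * (2 * \<psi> t) + 2 * a * e * z" by (simp add: algebra_simps)
      also have "\<dots> = a * s * t * (t - e) + 2 * (a * D) * t + 2 * a * e * z + 2 * a * (e - 1)"
        unfolding psi by (simp add: algebra_simps)
      also have "\<dots> = a * s * t * (t + e) + 2 * (t - e * (R * t - a * z)) + 2 * a * (e - 1)"
        unfolding aD R_def by (simp add: algebra_simps)
      also have "R * t - a * z = y" unfolding z_def t_def by (rule y)
      finally show ?thesis unfolding t_def z_def ek using es by auto
    qed
    ultimately show ?thesis by (rule that)
  qed
qed

section \<open>From real sectors and polynomials to integers\<close>

definition real_point :: "int \<times> int \<Rightarrow> real \<times> real" where
  "real_point = (\<lambda>(x, y). (of_int x, of_int y))"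

lemma inj_real_point: "inj real_point"
  by (auto simp: real_point_def inj_def)

lemma sector_lattice_infinity: "sector_lattice \<infinity> = real_point ` lattice_cone 0"
  by (auto simp: sector_lattice_def sector_def lattice_cone_def real_point_def image_iff elim!: Ints_cases)

lemma sector_lattice_ereal:
  assumes "r > 0"
  shows "sector_lattice (ereal r) = real_point ` lattice_cone (1 / r)"
proof -
  have "y \<le> r * x \<longleftrightarrow> 1 / r * y \<le> x" for x y :: real
    using assms by (simp add: field_simps)
  then show ?thesis
    by (auto simp: sector_lattice_def sector_def lattice_cone_def real_point_def image_iff elim!: Ints_cases)
qed

lemma sector_lattice_rational:
  assumes "n > 0"
  shows "sector_lattice (rational_slope n m) = real_point ` lattice_cone (real m / real n)"
proof (cases "m = 0")
  case True
  then show ?thesis using assms by (simp add: rational_slope_zero sector_lattice_infinity)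
next
  case False
  then show ?thesis using assms sector_lattice_ereal[of "real n / real m"] by (simp add: rational_slope_pos)
qed

text \<open>The last clause recovers the slope from \<beta> once that is known to be a fraction;
  \<open>m = 0\<close> corresponds to the infinite slope.\<close>

lemma inverse_slope:
  fixes \<alpha> :: ereal
  assumes "\<alpha> > 0"
  obtains \<beta> where "\<beta> \<ge> 0" "sector_lattice \<alpha> = real_point ` lattice_cone \<beta>"
    "\<And>m n. n > 0 \<Longrightarrow> \<beta> = real m / real n \<Longrightarrow> \<alpha> = rational_slope n m"
proof (cases \<alpha>)
  case (real r)
  then have r: "r > 0" using assms by simp
  show ?thesis
  proof (rule that[of "1 / r"])
    fix m n :: nat assume n: "n > 0" and eq: "1 / r = real m / real n"
    have "1 / r > 0" using r by simp
    then have "m \<noteq> 0" unfolding eq by (cases "m = 0") auto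
    moreover from this have "r = real n / real m" using eq n r by (simp add: field_simps)
    ultimately show "\<alpha> = rational_slope n m" using real by (simp add: rational_slope_pos)
  qed (use r real sector_lattice_ereal in auto)
next
  case PInf
  show ?thesis
    by (rule that[of 0]) (use PInf sector_lattice_infinity rational_slope_zero in auto)
next
  case MInf
  then show ?thesis using assms by simp
qed

lemma packing_function_on_real_point:
  assumes eq: "\<And>x y. (x, y) \<in> K \<Longrightarrow> f (of_int x, of_int y) = of_int (g x y)"
  shows "packing_function_on (real_point ` K) f \<longleftrightarrow> bij_betw (\<lambda>(x, y). g x y) K {0..}"
proof -
  have comp: "(f \<circ> real_point) p = (of_int \<circ> (\<lambda>(x, y). g x y)) p" if "p \<in> K" for p
    using eq that by (cases p) (simp add: real_point_def)
  have nats: "\<nat> = (of_int ` {0..} :: real set)"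
  proof (intro equalityI subsetI)
    fix x :: real assume "x \<in> \<nat>"
    then obtain n where "x = of_nat n" by (rule Nats_cases)
    then have "x = of_int (int n)" by simp
    then show "x \<in> of_int ` {0..}" by (rule image_eqI) simp
  next
    fix x :: real assume "x \<in> of_int ` {0..}"
    then obtain z where z: "z \<ge> 0" "x = of_int z" by auto
    then have "x = of_nat (nat z)" by simp
    then show "x \<in> \<nat>" by simp
  qed
  have inj: "inj (of_int :: int \<Rightarrow> real)" by (simp add: inj_def)
  have "packing_function_on (real_point ` K) f \<longleftrightarrow> bij_betw (f \<circ> real_point) K \<nat>"
    unfolding packing_function_on_def
    by (rule bij_betw_comp_iff) (auto intro: inj_on_imp_bij_betw inj_on_subset[OF inj_real_point])
  also have "\<dots> \<longleftrightarrow> bij_betw (of_int \<circ> (\<lambda>(x, y). g x y)) K (of_int ` {0..} :: real set)"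
    unfolding nats by (rule bij_betw_cong) (rule comp)
  also have "\<dots> \<longleftrightarrow> bij_betw (\<lambda>(x, y). g x y) K {0..}"
    unfolding bij_betw_def image_comp[symmetric] inj_image_eq_iff[OF inj]
    by (auto simp: inj_on_def)
  finally show ?thesis .
qed

lemma sum_degree_two:
  fixes c :: "nat \<Rightarrow> nat \<Rightarrow> real"
  shows "(\<Sum>(i, j) | i + j \<le> 2. c i j * x ^ i * y ^ j) =
    c 2 0 * x\<^sup>2 + c 1 1 * x * y + c 0 2 * y\<^sup>2 + c 1 0 * x + c 0 1 * y + c 0 0"
proof -
  have "{(i, j). i + j \<le> 2} = {(2, 0), (1, 1), (0, 2), (1, 0), (0, 1), (0, 0 :: nat)}" for i j :: nat
    by auto
  then have "(\<Sum>(i, j) | i + j \<le> 2. c i j * x ^ i * y ^ j) =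
      (\<Sum>(i, j) \<in> {(2, 0), (1, 1), (0, 2), (1, 0), (0, 1), (0, 0)}. c i j * x ^ i * y ^ j)"
    by simp
  then show ?thesis by simp
qed

text \<open>The values at the origin, at its four neighbours and at \<open>(1, 1)\<close> determine
  the six coefficients. This extends an identity of quadratic polynomials from integer to real
  arguments.\<close>

lemma quadratic_vanishing_on_ints:
  fixes c1 c2 c3 c4 c5 c6 x y :: real
  assumes zero: "\<And>x y :: int. c1 * (of_int x)\<^sup>2 + c2 * of_int x * of_int y + c3 * (of_int y)\<^sup>2 + c4 * of_int x + c5 * of_int y + c6 = 0"
  shows "c1 * x\<^sup>2 + c2 * x * y + c3 * y\<^sup>2 + c4 * x + c5 * y + c6 = 0"
proof -
  have "c6 = 0" using zero[of 0 0] by simp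
  moreover from this have "c1 + c4 = 0" "c1 - c4 = 0" "c3 + c5 = 0" "c3 - c5 = 0"
    using zero[of 1 0] zero[of "-1" 0] zero[of 0 1] zero[of 0 "-1"] by simp_all
  moreover from calculation have "c1 = 0" "c4 = 0" "c3 = 0" "c5 = 0" by linarith+
  moreover from calculation have "c2 = 0" using zero[of 1 1] by simp
  ultimately show ?thesis by simp
qed

text \<open>In the integer parameters, \<open>u\<close> is \<open>(a x + b y) / a\<close> and
  \<open>k l / n\<close> is \<open>k / a\<close>. Multiplying by \<open>2 a\<close> clears all
  denominators and gives the shape shared by \<open>cone_classification\<close> and
  \<open>packing_cone_bij\<close>.\<close>

lemma packing_poly_eq:
  fixes s a b k :: int
  assumes s: "s > 0" and a: "a > 0" and n: "int n = s * a\<^sup>2" and m: "int m = 1 - a * b * s"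
    and l: "packing_gcd m n = s * a"
  shows "2 * of_int a * packing_poly m n k (x, y) = of_int a * of_int s * (of_int a * x + of_int b * y) * (of_int a * x + of_int b * y - of_int k)
    + 2 * (of_int a * x + of_int b * y + of_int k * y) + 2 * of_int a * (of_int \<bar>k\<bar> - 1)"
proof -
  define s' a' b' k' where r: "s' = real_of_int s" "a' = real_of_int a" "b' = real_of_int b" "k' = real_of_int k"
  have pos: "s' > 0" "a' > 0" using s a unfolding r by simp_all
  have n': "real n = s' * a'\<^sup>2" using arg_cong[OF n, of real_of_int] unfolding r by simp
  have m': "real m - 1 = - (a' * b' * s')" using arg_cong[OF m, of real_of_int] unfolding r by simp
  have l': "real_of_int (packing_gcd m n) = s' * a'" unfolding l r by simp
  have "x - (real m - 1) / real n * y = (a' * x + b' * y) / a'"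
    unfolding n' m' using pos by (simp add: field_simps power2_eq_square)
  moreover have "k' * (s' * a') / real n = k' / a'" unfolding n' using pos by (simp add: field_simps power2_eq_square)
  moreover have "(k' * (s' * a') - (real m - 1)) / real n = (k' + b') / a'"
    unfolding n' m' using pos by (simp add: field_simps power2_eq_square)
  ultimately have "packing_poly m n k (x, y) = s' * a'\<^sup>2 / 2 * ((a' * x + b' * y) / a') * ((a' * x + b' * y) / a' - k' / a')
      + x + (k' + b') / a' * y + \<bar>k'\<bar> - 1"
    unfolding packing_poly_def Let_def l' r(4)[symmetric] by (simp add: n')
  also have "2 * a' * \<dots> = a' * s' * (a' * x + b' * y) * (a' * x + b' * y - k') + 2 * (a' * x + b' * y + k' * y) + 2 * a' * (\<bar>k'\<bar> - 1)"
    using pos by (simp add: field_simps power2_eq_square)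
  finally show ?thesis unfolding r by simp
qed

text \<open>Dividing \<open>m - 1\<close> and \<open>n\<close> by their gcd \<open>l\<close> gives
  the coprime pair. The condition that \<open>n\<close> divides \<open>l^2\<close> makes
  \<open>s = l^2 / n\<close> an integer, and cancelling \<open>l\<close> in
  \<open>l^2 = l a s\<close> yields \<open>l = s a\<close>.\<close>

lemma packing_parameters:
  assumes n: "n > 0" and cond: "packing_condition m n k"
  obtains s a b :: int where "s > 0" "a > 0" "coprime a b" "int n = s * a\<^sup>2" "int m = 1 - a * b * s"
    "packing_gcd m n = s * a" "[- b = k] (mod a)" "k \<in> {1, -1} \<or> k \<in> {2, -2} \<and> s = 4 \<or> k \<in> {3, -3} \<and> s = 3"
proof -
  define l where "l = packing_gcd m n"
  have l: "l > 0" unfolding l_def packing_gcd_def using n by simp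
  define a where "a = int n div l"
  define b where "b = - ((int m - 1) div l)"
  have na: "int n = l * a" unfolding a_def l_def packing_gcd_def by simp
  have mb: "int m - 1 = - (l * b)" unfolding b_def l_def packing_gcd_def by simp
  have a: "a > 0" using n na l by (metis of_nat_0_less_iff zero_less_mult_pos)
  have "coprime ((int m - 1) div l) (int n div l)" unfolding l_def packing_gcd_def using n by (intro div_gcd_coprime) auto
  then have cop: "coprime a b" unfolding a_def b_def by (simp add: coprime_commute)
  have "int n dvd l\<^sup>2" using cond unfolding packing_condition_def Let_def l_def by blast
  then obtain s where s: "l\<^sup>2 = int n * s" by (rule dvdE)
  then have "l * l = l * (a * s)" unfolding na by (simp add: power2_eq_square)
  then have las: "l = s * a" using l by (simp add: mult.commute)
  then have s0: "s > 0" using l a by (simp add: zero_less_mult_iff)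
  show ?thesis
  proof (rule that[of s a b])
    show "int n = s * a\<^sup>2" using na unfolding las by (simp add: power2_eq_square)
    show "int m = 1 - a * b * s" using mb unfolding las by (simp add: algebra_simps)
    have "l\<^sup>2 div int n = s" unfolding s using n by simp
    then show "k \<in> {1, -1} \<or> k \<in> {2, -2} \<and> s = 4 \<or> k \<in> {3, -3} \<and> s = 3"
      using cond unfolding packing_condition_def Let_def l_def by auto
    show "[- b = k] (mod a)" using cond unfolding packing_condition_def Let_def l_def a_def b_def by simp
  qed (use s0 a cop las l_def in auto)
qed

lemma packing_poly_packs:
  assumes n: "n > 0" and cond: "packing_condition m n k"
  shows "quadratic_packing_polynomial_on (sector_lattice (rational_slope n m)) (packing_poly m n k)"
proof -
  obtain s a b :: int where s: "s > 0" and a: "a > 0" and cop: "coprime a b" and nn: "int n = s * a\<^sup>2" and mm: "int m = 1 - a * b * s"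
    and l: "packing_gcd m n = s * a" and bk: "[- b = k] (mod a)" and ks: "k \<in> {1, -1} \<or> k \<in> {2, -2} \<and> s = 4 \<or> k \<in> {3, -3} \<and> s = 3"
    using packing_parameters[OF assms] .
  note poly = packing_poly_eq[OF s a nn mm l]
  have ra: "real_of_int a > 0" using a by simp
  have "real m / real n = of_int (int m) / of_int (int n)" by simp
  then have beta: "real m / real n = of_int (1 - a * b * s) / of_int (s * a\<^sup>2)" unfolding nn mm .
  obtain f where bij: "bij_betw (\<lambda>(x, y). f x y) (lattice_cone (real m / real n)) {0..}"
    and f: "\<And>x y. 2 * a * f x y = a * s * (a * x + b * y) * (a * x + b * y - k) + 2 * (a * x + b * y + k * y) + 2 * a * (\<bar>k\<bar> - 1)"
    by (rule packing_cone_bij[OF s a cop bk ks beta]) blast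
  have "packing_poly m n k (of_int x, of_int y) = of_int (f x y)" for x y
  proof -
    have "2 * of_int a * packing_poly m n k (of_int x, of_int y) = real_of_int (2 * a * f x y)"
      unfolding poly f by simp
    then show ?thesis using ra by simp
  qed
  then have "packing_function_on (real_point ` lattice_cone (real m / real n)) (packing_poly m n k)"
    using packing_function_on_real_point bij by blast
  then have pack: "packing_function_on (sector_lattice (rational_slope n m)) (packing_poly m n k)"
    by (simp only: sector_lattice_rational[OF n])
  \<comment> \<open>The coefficients result from expanding \<open>packing_poly_eq\<close> and
    dividing by \<open>2 a\<close>.\<close>
  define c :: "nat \<Rightarrow> nat \<Rightarrow> real" where "c i j =
    (if i = 2 \<and> j = 0 then of_int s * (of_int a)\<^sup>2 / 2 else if i = 1 \<and> j = 1 then of_int s * of_int a * of_int b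
     else if i = 0 \<and> j = 2 then of_int s * (of_int b)\<^sup>2 / 2 else if i = 1 \<and> j = 0 then 1 - of_int s * of_int a * of_int k / 2
     else if i = 0 \<and> j = 1 then (2 * of_int b + 2 * of_int k - of_int a * of_int s * of_int b * of_int k) / (2 * of_int a)
     else of_int \<bar>k\<bar> - 1)" for i j
  have "packing_poly m n k (x, y) = (\<Sum>(i, j) | i + j \<le> 2. c i j * x ^ i * y ^ j)" for x y
  proof -
    have "2 * of_int a * packing_poly m n k (x, y) = 2 * of_int a * (c 2 0 * x\<^sup>2 + c 1 1 * x * y + c 0 2 * y\<^sup>2 + c 1 0 * x + c 0 1 * y + c 0 0)"
      unfolding poly c_def using ra by (simp add: field_simps power2_eq_square)
    then show ?thesis unfolding sum_degree_two using ra by simp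
  qed
  moreover have "c 2 0 \<noteq> 0" unfolding c_def using s a by simp
  ultimately have "bivariate_polynomial_of_degree 2 (packing_poly m n k)"
    unfolding bivariate_polynomial_of_degree_def by (intro exI[of _ c] conjI exI[of _ 2] exI[of _ 0]) auto
  then show ?thesis unfolding quadratic_packing_polynomial_on_def using pack by blast
qed

text \<open>Integrality is known only inside the cone, so the coefficients are expressed by finite
  differences at points of the cone and then control the polynomial on the whole lattice.\<close>

lemma integer_valued_quadratic:
  fixes f :: "real \<times> real \<Rightarrow> real"
  assumes f: "\<And>x y. f (x, y) = c1 * x\<^sup>2 + c2 * x * y + c3 * y\<^sup>2 + c4 * x + c5 * y + c6"
    and int: "\<And>x y. (x, y) \<in> lattice_cone \<beta> \<Longrightarrow> f (of_int x, of_int y) \<in> \<int>" and beta: "\<beta> \<ge> 0"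
  obtains A B C D E F :: int and g :: "int \<Rightarrow> int \<Rightarrow> int"
  where "\<And>x y. f (of_int x, of_int y) = of_int (g x y)"
    "\<And>x y. 2 * g x y = A * x\<^sup>2 + 2 * B * x * y + C * y\<^sup>2 + D * x + E * y + F"
proof -
  \<comment> \<open>Far enough to the right for the second difference in \<open>y\<close>, which
    reaches height \<open>2\<close>, to stay inside the cone.\<close>
  define X where "X = \<lceil>2 * \<beta>\<rceil>"
  have X: "of_int X \<ge> 2 * \<beta>" "of_int X \<ge> \<beta>" "of_int X \<ge> (0 :: real)" unfolding X_def using beta by linarith+
  have cone: "(0, 0) \<in> lattice_cone \<beta>" "(1, 0) \<in> lattice_cone \<beta>" "(2, 0) \<in> lattice_cone \<beta>"
    "(X, 0) \<in> lattice_cone \<beta>" "(X, 1) \<in> lattice_cone \<beta>" "(X, 2) \<in> lattice_cone \<beta>" "(X + 1, 0) \<in> lattice_cone \<beta>"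
    "(X + 1, 1) \<in> lattice_cone \<beta>"
    unfolding lattice_cone_def using X by auto
  note v = cone[THEN int]
  define r where "r = real_of_int X"
  have v': "f (0, 0) \<in> \<int>" "f (1, 0) \<in> \<int>" "f (2, 0) \<in> \<int>" "f (r, 0) \<in> \<int>" "f (r, 1) \<in> \<int>" "f (r, 2) \<in> \<int>" "f (r + 1, 0) \<in> \<int>" "f (r + 1, 1) \<in> \<int>"
    using v unfolding r_def by simp_all
  have "c6 = f (0, 0)" "2 * c1 = f (2, 0) - 2 * f (1, 0) + f (0, 0)" "c1 + c4 = f (1, 0) - f (0, 0)"
    "c2 = f (r + 1, 1) - f (r, 1) - f (r + 1, 0) + f (r, 0)" "2 * c3 = f (r, 2) - 2 * f (r, 1) + f (r, 0)"
    "c3 + c5 = f (r, 1) - f (r, 0) - (f (r + 1, 1) - f (r, 1) - f (r + 1, 0) + f (r, 0)) * r"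
    unfolding f by (simp_all add: algebra_simps power2_eq_square)
  then have "c6 \<in> \<int>" "2 * c1 \<in> \<int>" "c1 + c4 \<in> \<int>" "c2 \<in> \<int>" "2 * c3 \<in> \<int>" "c3 + c5 \<in> \<int>"
    using v' by (auto simp: r_def intro!: Ints_add Ints_diff Ints_mult)
  then obtain F A D' B C E' where z: "c6 = of_int F" "2 * c1 = of_int A" "c1 + c4 = of_int D'" "c2 = of_int B" "2 * c3 = of_int C" "c3 + c5 = of_int E'"
    by (auto elim!: Ints_cases)
  \<comment> \<open>In the binomial basis \<open>x (x - 1) / 2\<close>, \<open>x y\<close>,
    \<open>y (y - 1) / 2\<close>, \<open>x\<close>, \<open>y\<close>, \<open>1\<close> the
    coefficients are integers.\<close>
  define g where "g x y = A * (x * (x - 1) div 2) + B * x * y + C * (y * (y - 1) div 2) + D' * x + E' * y + F" for x y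
  have g: "2 * g x y = A * x\<^sup>2 + 2 * B * x * y + C * y\<^sup>2 + (2 * D' - A) * x + (2 * E' - C) * y + 2 * F" for x y
  proof -
    have "2 * (x * (x - 1) div 2) = x * (x - 1)" for x :: int by simp
    then have *: "2 * (k * (x * (x - 1) div 2)) = k * (x * (x - 1))" for x k :: int by (metis mult.left_commute)
    show ?thesis unfolding g_def distrib_left * by (simp add: algebra_simps power2_eq_square)
  qed
  have "f (of_int x, of_int y) = of_int (g x y)" for x y
  proof -
    have c4: "2 * c4 = 2 * of_int D' - of_int A" and c5: "2 * c5 = 2 * of_int E' - of_int C" using z by linarith+
    have "2 * f (of_int x, of_int y) = (2 * c1) * (of_int x)\<^sup>2 + 2 * c2 * of_int x * of_int y + (2 * c3) * (of_int y)\<^sup>2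
       + (2 * c4) * of_int x + (2 * c5) * of_int y + 2 * c6" unfolding f by (simp add: algebra_simps)
    also have "\<dots> = of_int (2 * g x y)" unfolding g c4 c5 z by (simp add: algebra_simps)
    finally show ?thesis by simp
  qed
  then show ?thesis using g that[of g A B C "2 * D' - A" "2 * E' - C" "2 * F"] by blast
qed

lemma quadratic_packing_is_packing_poly:
  fixes \<alpha> :: ereal
  assumes "\<alpha> > 0" and qpp: "quadratic_packing_polynomial_on (sector_lattice \<alpha>) f"
  shows "\<exists>m n k. n > 0 \<and> gcd m n = 1 \<and> packing_condition m n k \<and> \<alpha> = rational_slope n m \<and> f = packing_poly m n k"
proof -
  obtain \<beta> where beta: "\<beta> \<ge> 0" and sec: "sector_lattice \<alpha> = real_point ` lattice_cone \<beta>"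
    and slope: "\<And>m n. n > 0 \<Longrightarrow> \<beta> = real m / real n \<Longrightarrow> \<alpha> = rational_slope n m"
    by (rule inverse_slope[OF assms(1)]) blast
  obtain c :: "nat \<Rightarrow> nat \<Rightarrow> real" where "\<And>x y. f (x, y) = (\<Sum>(i, j) | i + j \<le> 2. c i j * x ^ i * y ^ j)"
    using qpp unfolding quadratic_packing_polynomial_on_def bivariate_polynomial_of_degree_def by blast
  then have f: "f (x, y) = c 2 0 * x\<^sup>2 + c 1 1 * x * y + c 0 2 * y\<^sup>2 + c 1 0 * x + c 0 1 * y + c 0 0" for x y
    by (simp only: sum_degree_two)
  have pack: "packing_function_on (real_point ` lattice_cone \<beta>) f"
    using qpp unfolding quadratic_packing_polynomial_on_def sec by blast
  have "f (of_int x, of_int y) \<in> \<int>" if "(x, y) \<in> lattice_cone \<beta>" for x y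
  proof -
    have "real_point (x, y) \<in> real_point ` lattice_cone \<beta>" using that by (rule imageI)
    then have "f (real_point (x, y)) \<in> \<nat>" using bij_betwE[OF pack[unfolded packing_function_on_def]] by blast
    then show ?thesis unfolding real_point_def using Nats_subset_Ints by auto
  qed
  then obtain A B C D E F g where fg: "\<And>x y. f (of_int x, of_int y) = of_int (g x y)"
    and g: "\<And>x y. 2 * g x y = A * x\<^sup>2 + 2 * B * x * y + C * y\<^sup>2 + D * x + E * y + F"
    using integer_valued_quadratic[OF f _ beta] by metis
  have "bij_betw (\<lambda>(x, y). g x y) (lattice_cone \<beta>) {0..}"
    using pack packing_function_on_real_point[of "lattice_cone \<beta>" f g] fg by blast
  then interpret cone_packing \<beta> A B C D E F g
    by unfold_locales (use beta g in auto)
  obtain s a b k :: int where s: "s > 0" and a: "a > 0" and cop: "coprime a b" and b: "\<beta> = of_int (1 - a * b * s) / of_int (s * a\<^sup>2)"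
    and bk: "[- b = k] (mod a)" and ks: "k \<in> {1, -1} \<or> k \<in> {2, -2} \<and> s = 4 \<or> k \<in> {3, -3} \<and> s = 3"
    and geq: "\<And>x y. 2 * a * g x y = a * s * (a * x + b * y) * (a * x + b * y - k) + 2 * (a * x + b * y + k * y) + 2 * a * (\<bar>k\<bar> - 1)"
    by (rule cone_classification) blast
  have sa: "s * a\<^sup>2 > 0" using s a by simp
  have m0: "1 - a * b * s \<ge> 0"
  proof -
    have "real_of_int (s * a\<^sup>2) > 0" using sa by (simp only: of_int_0_less_iff)
    then have "real_of_int (1 - a * b * s) \<ge> 0" using beta unfolding b by (simp only: zero_le_divide_iff) linarith
    then show ?thesis by (simp only: of_int_0_le_iff)
  qed
  \<comment> \<open>Numerator and denominator of \<beta>. They are coprime because a common divisor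
    with \<open>s\<close> or \<open>a\<close> would divide \<open>1\<close>.\<close>
  define n where "n = nat (s * a\<^sup>2)"
  define m where "m = nat (1 - a * b * s)"
  have nn: "int n = s * a\<^sup>2" and mm: "int m = 1 - a * b * s" unfolding n_def m_def using sa m0 by simp_all
  have n0: "n > 0" unfolding n_def using sa by simp
  have cmn: "gcd m n = 1"
  proof -
    have "coprime (1 - a * b * s) (s * a\<^sup>2)"
    proof -
      have "coprime (1 - a * b * s) s" "coprime (1 - a * b * s) a"
      proof -
        show "coprime (1 - a * b * s) s"
        proof (rule coprimeI)
          fix c assume "c dvd 1 - a * b * s" "c dvd s"
          then have "c dvd (1 - a * b * s) + a * b * s" by (intro dvd_add) auto
          then show "is_unit c" by simp
        qed
        show "coprime (1 - a * b * s) a"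
        proof (rule coprimeI)
          fix c assume "c dvd 1 - a * b * s" "c dvd a"
          then have "c dvd (1 - a * b * s) + a * b * s" by (intro dvd_add) auto
          then show "is_unit c" by simp
        qed
      qed
      then show ?thesis by simp
    qed
    then have "coprime (int m) (int n)" unfolding nn mm .
    then show ?thesis by (simp add: coprime_iff_gcd_eq_1)
  qed
  have l: "packing_gcd m n = s * a"
  proof -
    have "packing_gcd m n = gcd ((s * a) * (- b)) ((s * a) * a)"
      unfolding packing_gcd_def nn mm by (simp add: algebra_simps power2_eq_square)
    also have "\<dots> = \<bar>s * a\<bar> * gcd (- b) a" using gcd_mult_left[of "s * a" "- b" a] by (simp add: abs_mult)
    also have "\<dots> = s * a" using s a cop by (simp add: gcd.commute coprime_iff_gcd_eq_1)
    finally show ?thesis .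
  qed
  have cond: "packing_condition m n k"
  proof -
    have "int n dvd (s * a)\<^sup>2" unfolding nn by (simp add: power2_eq_square)
    moreover have "(s * a)\<^sup>2 div int n = s"
    proof -
      have "(s * a)\<^sup>2 = s * int n" unfolding nn by (simp add: power2_eq_square)
      then show ?thesis using n0 by simp
    qed
    moreover have "int n div (s * a) = a"
    proof -
      have "int n = a * (s * a)" unfolding nn by (simp add: power2_eq_square)
      then show ?thesis using s a by simp
    qed
    moreover have "(int m - 1) div (s * a) = - b"
    proof -
      have eq: "int m - 1 = (s * a) * (- b)" unfolding mm by (simp add: algebra_simps)
      show ?thesis unfolding eq by (rule nonzero_mult_div_cancel_left) (use s a in simp)
    qed
    ultimately show ?thesis unfolding packing_condition_def l Let_def using bk ks by (simp only: simp_thms)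
  qed
  have "\<alpha> = rational_slope n m"
  proof (rule slope[OF n0])
    have "real m / real n = of_int (int m) / of_int (int n)" by simp
    then show "\<beta> = real m / real n" unfolding nn mm b by simp
  qed
  moreover have "f = packing_poly m n k"
  proof
    fix p :: "real \<times> real"
    obtain x y where p: "p = (x, y)" by force
    define s' a' b' k' where r: "s' = real_of_int s" "a' = real_of_int a" "b' = real_of_int b" "k' = real_of_int k"
    \<comment> \<open>\<open>2 a\<close> times the difference of the two polynomials, with its
      coefficients collected so that \<open>quadratic_vanishing_on_ints\<close> applies.\<close>
    define q where "q x y = (2 * a' * c 2 0 - a' * s' * a'\<^sup>2) * x\<^sup>2 + (2 * a' * c 1 1 - 2 * a' * s' * a' * b') * x * y + (2 * a' * c 0 2 - a' * s' * b'\<^sup>2) * y\<^sup>2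
      + (2 * a' * c 1 0 + a' * s' * a' * k' - 2 * a') * x + (2 * a' * c 0 1 + a' * s' * b' * k' - 2 * b' - 2 * k') * y + (2 * a' * c 0 0 - 2 * a' * (\<bar>k'\<bar> - 1))" for x y
    have q: "q x y = 2 * a' * f (x, y) - (a' * s' * (a' * x + b' * y) * (a' * x + b' * y - k') + 2 * (a' * x + b' * y + k' * y) + 2 * a' * (\<bar>k'\<bar> - 1))" for x y
      unfolding q_def f by (simp add: algebra_simps power2_eq_square)
    have zero: "q (of_int x) (of_int y) = 0" for x y
    proof -
      have "2 * a' * f (of_int x, of_int y) = real_of_int (2 * a * g x y)" unfolding fg r by simp
      then show ?thesis unfolding q geq r by simp
    qed
    have "q x y = 0" unfolding q_def by (rule quadratic_vanishing_on_ints) (rule zero[unfolded q_def])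
    moreover have "2 * a' * packing_poly m n k (x, y) =
        a' * s' * (a' * x + b' * y) * (a' * x + b' * y - k') + 2 * (a' * x + b' * y + k' * y) + 2 * a' * (\<bar>k'\<bar> - 1)"
      unfolding r packing_poly_eq[OF s a nn mm l] by (simp only: of_int_abs)
    ultimately have "2 * a' * f (x, y) = 2 * a' * packing_poly m n k (x, y)"
      unfolding q by (simp only: right_minus_eq)
    then show "f p = packing_poly m n k p" unfolding p r using a by simp
  qed
  ultimately show ?thesis using n0 cmn cond by (intro exI[of _ m] exI[of _ n] exI[of _ k] conjI)
qed

theorem theorem9:
  shows "(\<forall>(m::nat) (n::nat) (k::int).
            n > 0 \<and> gcd m n = 1 \<and> packing_condition m n k \<longrightarrow>
            quadratic_packing_polynomial_on (sector_lattice (rational_slope n m)) (packing_poly m n k)) \<and>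
         (\<forall>(\<alpha>::ereal) (f :: real \<times> real \<Rightarrow> real).
            \<alpha> > 0 \<and> quadratic_packing_polynomial_on (sector_lattice \<alpha>) f \<longrightarrow>
            (\<exists>(m::nat) (n::nat) (k::int).
               n > 0 \<and> gcd m n = 1 \<and> packing_condition m n k \<and>
               \<alpha> = rational_slope n m \<and> f = packing_poly m n k))"
  using packing_poly_packs quadratic_packing_is_packing_poly by blast

end
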